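(* Let $l\neq 2,3,7$ be a prime. The irreducible factors of $\hat H_{7,l}(x)$ over $\mathbb{F}_l$ are: (i) quadratic, if $l\equiv 1\pmod 7$; (ii) linear or quadratic, if $l\equiv 6\pmod 7$; (iii) $x^2-x+1$ or sextic, if $l\equiv 2,4\pmod 7$; (iv) $x^2-x+1$, cubic or sextic, if $l\equiv 3,5\pmod 7$.
   Context: Let $n_l=\lfloor l/12\rfloor$, $r=\frac{1}{2}\left(1-\left(\frac{-3}{l}\right)\right)$, $s=\frac12\left(1-\left(\frac{-4}{l}\right)\right)$, and $J_l(t)\equiv \sum_{k=0}^{n_l}\binom{2n_l+s}{2k+s}\binom{2n_l-2k}{n_l-k}(-432)^{n_l-k}(t-1728)^k \pmod l$. Let $$j_7(x)=\frac{(x^2-x+1)^3(x^6-11x^5+30x^4-15x^3-10x^2+5x+1)^3}{x^7(x-1)^7(x^3-8x^2+5x+1)}$$ (the $j$-invariant of the Tate normal form $E_7: Y^2+(1+d-d^2)XY+(d^2-d^3)Y=X^3+(d^2-d^3)X^2$ at $d=x$). The Hasse invariant of $E_7$ is $$\hat H_{7,l}(x)=(x^2-x+1)^r(x^6-11x^5+30x^4-15x^3-10x^2+5x+1)^r\,f_2(x)^s\,x^{7n_l}(x-1)^{7n_l}(x^3-8x^2+5x+1)^{n_l}J_l(j_7(x))\in\mathbb{F}_l[x],$$ where $f_2(x)=x^{12}-18x^{11}+117x^{10}-354x^9+570x^8-486x^7+273x^6-222x^5+174x^4-46x^3-15x^2+6x+1$. *)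

theory Defs
  imports "HOL-Number_Theory.Number_Theory" "Berlekamp_Zassenhaus.Finite_Field"
    "HOL-Computational_Algebra.Polynomial"
begin

definition nl :: "nat \<Rightarrow> nat" where "nl l = l div 12"

definition rl :: "nat \<Rightarrow> nat" where "rl l = nat ((1 - Legendre (-3) (int l)) div 2)"
definition sl :: "nat \<Rightarrow> nat" where "sl l = nat ((1 - Legendre (-4) (int l)) div 2)"

definition J_poly :: "nat \<Rightarrow> 'a::comm_ring_1 poly" where
  "J_poly l = (let n = nl l; s = sl l in
     \<Sum>k = 0..n. smult (of_int (int ((2*n + s) choose (2*k + s)) * int ((2*n - 2*k) choose (n - k))
                               * (-432) ^ (n - k)))
                   ([:-1728, 1:] ^ k))"

definition p_a :: "'a::comm_ring_1 poly" where "p_a = [:1, -1, 1:]"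
definition p_b :: "'a::comm_ring_1 poly" where
  "p_b = [:1, 5, -10, -15, 30, -11, 1:]"
definition p_c :: "'a::comm_ring_1 poly" where "p_c = [:1, 5, -8, 1:]"
definition f2 :: "'a::comm_ring_1 poly" where
  "f2 = [:1, 6, -15, -46, 174, -222, 273, -486, 570, -354, 117, -18, 1:]"

(* j_7 = num7 / den7 *)
definition num7 :: "'a::comm_ring_1 poly" where "num7 = p_a ^ 3 * p_b ^ 3"
definition den7 :: "'a::comm_ring_1 poly" where "den7 = [:0,1:] ^ 7 * [:-1,1:] ^ 7 * p_c"

(* den^n * J(num/den), i.e. the composition J(j_7(x)) with denominators cleared
   (valid since degree J <= n) *)
definition homog_comp :: "'a::comm_ring_1 poly \<Rightarrow> nat \<Rightarrow> 'a poly \<Rightarrow> 'a poly \<Rightarrow> 'a poly" where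
  "homog_comp J n N D = (\<Sum>i = 0..n. smult (coeff J i) (N ^ i * D ^ (n - i)))"

definition H7 :: "nat \<Rightarrow> 'a::comm_ring_1 poly" where
  "H7 l = p_a ^ rl l * p_b ^ rl l * f2 ^ sl l * homog_comp (J_poly l) (nl l) num7 den7"

end

theory Submission
  imports "HOL-Algebra.Algebraic_Closure_Type" Defs
begin

text \<open>
  The roots \<open>d\<close> of \<open>H\<close> in an algebraic closure are the parameters for which \<open>E\<^sub>7(d)\<close> is supersingular.
  For a supersingular curve \<open>y\<^sup>2 = f(x)\<close> the derivation \<open>D = 2y d/dx\<close> satisfies \<open>D\<^sup>l x = 0\<close>. This makes it
  possible to solve explicitly for the function \<open>w\<^sub>R\<close> with divisor \<open>l(R) + (-Q) - (l+1)O\<close>, where \<open>Q = [l]R\<close>;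
  its coefficients are \<open>D\<close>-constants in the coordinates of \<open>R\<close>, and it follows that \<open>[l]\<close> is
  \<open>(x, y) \<mapsto> (C\<^sup>2 x\<^bsup>l\<^sup>2\<^esup>, - C\<^sup>3 y\<^bsup>l\<^sup>2\<^esup>)\<close> for a constant \<open>C\<close>.

  Applied to the point \<open>P = (0, 0)\<close> of order 7, this says that \<open>(E\<^sub>7(d), [l]P)\<close> is isomorphic to
  \<open>(E\<^sub>7(d\<^bsup>l\<^sup>2\<^esup>), P)\<close>. As \<open>(E\<^sub>7(d), [2]P)\<close> and \<open>(E\<^sub>7(d), [4]P)\<close> have the parameters \<open>(d - 1)/d\<close> and
  \<open>1/(1 - d)\<close>, the residue of \<open>l\<close> modulo 7 determines \<open>d\<^bsup>l\<^sup>2\<^esup>\<close>. The degree of the minimal polynomial of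
  \<open>d\<close> is the period of \<open>d\<close> under Frobenius, and the odd periods that do not occur are excluded by the sign of
  \<open>C\<close>, which is determined by an isomorphism of the curve with its Frobenius twist.
\<close>

text \<open>The point Q = [l]R enters only as the residual zero of a function w with an l-fold zero
  at R. In characteristic l that zero leaves no residue in \<open>D w / w\<close>, whose poles are
  therefore only at -Q and O; this yields both coordinates of Q without addition formulas. The
  vanishing conditions at R become triangular in the basis D^i x, because D^(l-1) x is a nonzero
  constant \<epsilon>; the scaling is C = \<epsilon>^(1-l). Knowing d^(l^2) alone does not exclude
  odd periods. If d had such a period, the curve would be isomorphic to its l-Frobenius twist, which
  computes C a second time, and in the excluded cases the two values clash. That a root of
  \<open>H7\<close> gives a supersingular curve needs a comparison of two expansions:
  \<open>H7\<close> is written in the discriminant and c_6, the coefficient of x^(l-1) in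
  f^((l-1)/2) in c_4^3 and c_6. The bridge is the middle coefficient of (T^2 + F T + S)^N, which
  completing the square carries from the first pair of invariants to the second.\<close>

hide_const (open) Polynomials.degree up_ring.coeff up_ring.monom

section \<open>The derivation 2y d/dx and its Leibniz rule\<close>

text \<open>With x the inner and y the outer variable this is 2y d/dx + f'(x) d/dy. It kills y^2 - f
  and so descends to the coordinate ring, where it is dual to the invariant differential
  dx/2y.\<close>

definition curve_deriv :: "'a::idom poly \<Rightarrow> 'a poly poly \<Rightarrow> 'a poly poly" where
  "curve_deriv f p = [:0, 2:] * map_poly pderiv p + [:pderiv f:] * pderiv p"

lemma map_poly_pderiv_add:
  "map_poly pderiv (p + q) = map_poly pderiv p + map_poly pderiv (q :: 'a::idom poly poly)"
  by (rule poly_eqI) (simp add: coeff_map_poly pderiv_add)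

lemma map_poly_pderiv_mult:
  "map_poly pderiv (p * q) = map_poly pderiv p * q + p * map_poly pderiv (q :: 'a::idom poly poly)"
proof (rule poly_eqI)
  fix n
  have "coeff (map_poly pderiv (p * q)) n =
      (\<Sum>i\<le>n. coeff p i * pderiv (coeff q (n - i)) + coeff q (n - i) * pderiv (coeff p i))"
    by (simp add: coeff_map_poly coeff_mult pderiv_sum pderiv_mult)
  also have "\<dots> = (\<Sum>i\<le>n. coeff p i * pderiv (coeff q (n - i))) + (\<Sum>i\<le>n. pderiv (coeff p i) * coeff q (n - i))"
    by (simp only: sum.distrib mult.commute)
  also have "\<dots> = coeff (map_poly pderiv p * q + p * map_poly pderiv q) n"
    by (simp add: coeff_map_poly coeff_mult)
  finally show "coeff (map_poly pderiv (p * q)) n = coeff (map_poly pderiv p * q + p * map_poly pderiv q) n" .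
qed

lemma curve_deriv_add [simp]: "curve_deriv f (p + q) = curve_deriv f p + curve_deriv f q"
  by (simp add: curve_deriv_def map_poly_pderiv_add pderiv_add algebra_simps)

lemma curve_deriv_mult: "curve_deriv f (p * q) = curve_deriv f p * q + p * curve_deriv f q"
  unfolding curve_deriv_def map_poly_pderiv_mult pderiv_mult
  by (simp only: distrib_left distrib_right ac_simps)

lemma curve_deriv_0 [simp]: "curve_deriv f 0 = 0"
  by (simp add: curve_deriv_def)

lemma curve_deriv_minus [simp]: "curve_deriv f (- p) = - curve_deriv f p"
proof -
  have "curve_deriv f (- p) + curve_deriv f p = 0"
    by (simp only: curve_deriv_add[symmetric] add.left_inverse curve_deriv_0)
  thus ?thesis by (simp only: eq_neg_iff_add_eq_0)
qed

lemma curve_deriv_diff [simp]: "curve_deriv f (p - q) = curve_deriv f p - curve_deriv f q"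
  using curve_deriv_add[of f p "- q"] by simp

lemma curve_deriv_sum: "curve_deriv f (sum g S) = (\<Sum>i\<in>S. curve_deriv f (g i))"
  by (induction S rule: infinite_finite_induct) auto

text \<open>The last coefficient belongs to y^2 and is left unreduced; uses of the lemma replace y^2
  by f.\<close>

lemma curve_deriv_reduced:
  "curve_deriv f [:a, b:] = [:pderiv f * b, 2 * pderiv a, 2 * pderiv b:]"
proof -
  have "map_poly pderiv [:a, b:] = [:pderiv a, pderiv b:]"
    by (rule poly_eqI) (auto simp: coeff_map_poly coeff_pCons split: nat.splits)
  moreover have "pderiv [:a, b:] = [:b:]" by (simp add: pderiv_pCons)
  ultimately show ?thesis by (simp add: curve_deriv_def)
qed

lemma curve_deriv_const [simp]: "curve_deriv f [:[:a:]:] = 0"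
  using curve_deriv_reduced[of f "[:a:]" 0] by (simp add: pderiv_pCons)

lemma curve_deriv_power: "curve_deriv f (p ^ Suc n) = of_nat (Suc n) * p ^ n * curve_deriv f p"
proof (induction n)
  case (Suc n)
  have "curve_deriv f (p ^ Suc (Suc n)) = curve_deriv f p * p ^ Suc n + p * curve_deriv f (p ^ Suc n)"
    by (simp only: power_Suc[of p "Suc n"] curve_deriv_mult)
  also have "\<dots> = curve_deriv f p * p ^ Suc n + p * (of_nat (Suc n) * p ^ n * curve_deriv f p)"
    by (simp only: Suc)
  also have "\<dots> = of_nat (Suc (Suc n)) * p ^ Suc n * curve_deriv f p"
    by (simp add: algebra_simps)
  finally show ?case .
qed simp

lemma curve_deriv_smult [simp]: "curve_deriv f (smult [:a:] p) = smult [:a:] (curve_deriv f p)"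
  using curve_deriv_mult[of f "[:[:a:]:]" p] by simp

lemma curve_deriv_iter_linear:
  "(curve_deriv f ^^ n) 0 = 0"
  "(curve_deriv f ^^ n) (p + q) = (curve_deriv f ^^ n) p + (curve_deriv f ^^ n) q"
  "(curve_deriv f ^^ n) (- p) = - (curve_deriv f ^^ n) p"
  "(curve_deriv f ^^ n) (p - q) = (curve_deriv f ^^ n) p - (curve_deriv f ^^ n) q"
  "(curve_deriv f ^^ n) (smult [:a:] p) = smult [:a:] ((curve_deriv f ^^ n) p)"
  by (induction n) simp_all

lemma curve_deriv_iter_sum:
  "(curve_deriv f ^^ n) (sum g S) = (\<Sum>i\<in>S. (curve_deriv f ^^ n) (g i))"
  by (induction S rule: infinite_finite_induct) (auto simp: curve_deriv_iter_linear)

lemma curve_deriv_iter_const: "n > 0 \<Longrightarrow> (curve_deriv f ^^ n) [:[:a:]:] = 0"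
  using curve_deriv_iter_linear(1)[of "n - 1" f]
  by (cases n) (simp, simp only: funpow_Suc_right comp_apply curve_deriv_const diff_Suc_1)

lemma curve_deriv_Leibniz:
  "(curve_deriv f ^^ n) (p * q) =
     (\<Sum>k\<le>n. of_nat (n choose k) * ((curve_deriv f ^^ k) p * (curve_deriv f ^^ (n - k)) q))"
proof (induction n)
  case (Suc n)
  define u where "u k = (curve_deriv f ^^ k) p" for k
  define v where "v k = (curve_deriv f ^^ k) q" for k
  have u: "curve_deriv f (u k) = u (Suc k)" and v: "curve_deriv f (v k) = v (Suc k)" for k
    by (simp_all add: u_def v_def)
  have c: "curve_deriv f (of_nat m * w) = of_nat m * curve_deriv f w" for m w
    by (induction m) (simp_all add: distrib_right)
  have "(curve_deriv f ^^ Suc n) (p * q) = curve_deriv f (\<Sum>k\<le>n. of_nat (n choose k) * (u k * v (n - k)))"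
    unfolding u_def v_def using Suc by simp
  also have "\<dots> = (\<Sum>k\<le>n. of_nat (n choose k) * (u (Suc k) * v (n - k)))
      + (\<Sum>k\<le>n. of_nat (n choose k) * (u k * v (Suc (n - k))))"
    unfolding curve_deriv_sum c by (simp only: curve_deriv_mult u v distrib_left sum.distrib)
  also have "(\<Sum>k\<le>n. of_nat (n choose k) * (u (Suc k) * v (n - k))) =
      (\<Sum>k\<le>Suc n. (if k = 0 then 0 else of_nat (n choose (k - 1)) * (u k * v (Suc n - k))))"
    by (subst sum.atMost_Suc_shift) simp
  also have "(\<Sum>k\<le>n. of_nat (n choose k) * (u k * v (Suc (n - k)))) =
      (\<Sum>k\<le>Suc n. of_nat (n choose k) * (u k * v (Suc n - k)))"
    by (simp add: Suc_diff_le binomial_eq_0)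
  also have "(\<Sum>k\<le>Suc n. (if k = 0 then 0 else of_nat (n choose (k - 1)) * (u k * v (Suc n - k))))
      + (\<Sum>k\<le>Suc n. of_nat (n choose k) * (u k * v (Suc n - k)))
      = (\<Sum>k\<le>Suc n. of_nat (Suc n choose k) * (u k * v (Suc n - k)))"
    unfolding sum.distrib[symmetric]
    by (rule sum.cong[OF refl]) (auto simp: gr0_conv_Suc distrib_right)
  finally show ?case unfolding u_def v_def .
qed simp

section \<open>The coordinate ring of a Weierstrass curve and leading terms at infinity\<close>

text \<open>Stated with degree bounds instead of degrees, so that leading coefficients can be
  followed even when they vanish.\<close>

lemma coeff_mult_top:
  fixes p q :: "'a::comm_semiring_0 poly"
  assumes "degree p \<le> m" "degree q \<le> n"
  shows "coeff (p * q) (m + n) = coeff p m * coeff q n"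
proof -
  have "coeff (p * q) (m + n) = (\<Sum>i\<le>m + n. coeff p i * coeff q (m + n - i))"
    by (simp add: coeff_mult)
  also have "\<dots> = (\<Sum>i\<le>m + n. if i = m then coeff p m * coeff q n else 0)"
  proof (rule sum.cong[OF refl])
    fix i assume "i \<in> {..m + n}"
    consider "i < m" | "i = m" | "i > m" by linarith
    thus "coeff p i * coeff q (m + n - i) = (if i = m then coeff p m * coeff q n else 0)"
      by cases (use assms in \<open>auto simp: coeff_eq_0\<close>)
  qed
  finally show ?thesis by simp
qed

text \<open>Elements of the coordinate ring are represented by polynomials in \<open>y\<close> over \<open>K[x]\<close>, modulo \<open>P = y\<^sup>2 - f\<close>.\<close>

locale weierstrass =
  fixes A B :: "'a::field"
begin

definition f :: "'a poly" where "f = [:B, A, 0, 1:]"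
definition P :: "'a poly poly" where "P = [:- f, 0, 1:]"
abbreviation D where "D \<equiv> curve_deriv f"
definition x :: "'a poly poly" where "x = [:[:0, 1:]:]"
definition y :: "'a poly poly" where "y = [:0, 1:]"
definition eqv :: "'a poly poly \<Rightarrow> 'a poly poly \<Rightarrow> bool" (infix \<open>\<approx>\<close> 50)
  where "p \<approx> q \<longleftrightarrow> P dvd (p - q)"

lemma degree_f [simp]: "degree f = 3" and coeff_f_3 [simp]: "coeff f 3 = 1" and f_nz [simp]: "f \<noteq> 0"
  by (simp_all add: f_def numeral_3_eq_3)

lemma degree_P [simp]: "degree P = 2"
  by (simp add: P_def numeral_2_eq_2)

lemma P_dvd_reduced: "P dvd [:a, b:] \<longleftrightarrow> a = 0 \<and> b = 0"
proof
  assume dv: "P dvd [:a, b:]"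
  have "[:a, b:] = 0"
  proof (rule ccontr)
    assume "[:a, b:] \<noteq> 0"
    with dv have "degree P \<le> degree [:a, b:]" by (rule dvd_imp_degree_le)
    thus False by (auto split: if_splits)
  qed
  thus "a = 0 \<and> b = 0" by simp
qed simp

lemma D_x [simp]: "D x = 2 * y"
  using curve_deriv_reduced[of f "[:0, 1:]" 0]
  by (simp add: x_def y_def pderiv_pCons numeral_poly)

lemma D_P: "D P = 0"
  by (simp add: curve_deriv_def P_def map_poly_pCons pderiv_pCons numeral_poly pderiv_minus algebra_simps)

lemma eqv_refl [simp, intro]: "p \<approx> p" by (simp add: eqv_def)
lemma eqv_sym: "p \<approx> q \<Longrightarrow> q \<approx> p"
  unfolding eqv_def by (metis dvd_minus_iff minus_diff_eq)
lemma eqv_trans [trans]: "p \<approx> q \<Longrightarrow> q \<approx> r \<Longrightarrow> p \<approx> r"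
  unfolding eqv_def using dvd_add[of P "p - q" "q - r"] by simp
lemma eqv_eq_trans [trans]: "p \<approx> q \<Longrightarrow> q = r \<Longrightarrow> p \<approx> r" by simp
lemma eq_eqv_trans [trans]: "p = q \<Longrightarrow> q \<approx> r \<Longrightarrow> p \<approx> r" by simp
lemma eqv_add: "p \<approx> q \<Longrightarrow> r \<approx> s \<Longrightarrow> p + r \<approx> q + s"
  unfolding eqv_def using dvd_add[of P "p - q" "r - s"] by (simp add: algebra_simps)
lemma eqv_diff: "p \<approx> q \<Longrightarrow> r \<approx> s \<Longrightarrow> p - r \<approx> q - s"
  unfolding eqv_def using dvd_diff[of P "p - q" "r - s"] by (simp add: algebra_simps)
lemma eqv_mult: assumes "p \<approx> q" "r \<approx> s" shows "p * r \<approx> q * s"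
proof -
  have "p * r - q * s = (p - q) * r + q * (r - s)" by (simp add: algebra_simps)
  thus ?thesis using assms unfolding eqv_def by (metis dvd_add dvd_mult dvd_mult2)
qed
lemma eqv_power: "p \<approx> q \<Longrightarrow> p ^ n \<approx> q ^ n"
  by (induction n) (auto intro: eqv_mult)
lemma eqv_sum: "(\<And>i. i \<in> S \<Longrightarrow> g i \<approx> h i) \<Longrightarrow> sum g S \<approx> sum h S"
  by (induction S rule: infinite_finite_induct) (auto intro: eqv_add)
lemma eqv_D: "p \<approx> q \<Longrightarrow> D p \<approx> D q"
  unfolding eqv_def dvd_def by (metis D_P curve_deriv_mult add_0 mult_zero_left curve_deriv_diff)
lemma eqv_D_iter: "p \<approx> q \<Longrightarrow> (D ^^ n) p \<approx> (D ^^ n) q"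
  by (induction n) (auto intro: eqv_D)

lemma eqv_reduced_iff: "[:a, b:] \<approx> [:a', b':] \<longleftrightarrow> a = a' \<and> b = b'"
  by (simp add: eqv_def P_dvd_reduced)

lemma y_sq: "y * y \<approx> [:f:]"
  by (simp add: eqv_def P_def y_def)

lemma reduced_exists: "\<exists>a b. p \<approx> [:a, b:]"
proof (induction p)
  case 0 show ?case by (intro exI[of _ 0]) simp
next
  case (pCons c p)
  then obtain a b where ab: "p \<approx> [:a, b:]" by auto
  have "pCons c p = [:c:] + y * p" by (simp add: y_def)
  also have "\<dots> \<approx> [:c:] + y * [:a, b:]" by (intro eqv_add eqv_mult ab eqv_refl)
  also have "\<dots> = [:c, a:] + [:b:] * (y * y)" by (simp add: y_def)
  also have "\<dots> \<approx> [:c, a:] + [:b:] * [:f:]" by (intro eqv_add eqv_mult y_sq eqv_refl)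
  also have "\<dots> = [:c + b * f, a:]" by simp
  finally show ?case by blast
qed

text \<open>\<open>hom n k p\<close>: \<open>p\<close> is even or odd in \<open>y\<close> and has leading term \<open>k t\<^bsup>-n\<^esup>\<close> at infinity, where \<open>t\<close> is a
  local parameter with \<open>x \<sim> t\<^bsup>-2\<^esup>\<close> and \<open>y \<sim> - t\<^bsup>-3\<^esup>\<close>. The case \<open>k = 0\<close> is allowed.\<close>

definition hom :: "nat \<Rightarrow> 'a \<Rightarrow> 'a poly poly \<Rightarrow> bool" where
  "hom n k p \<longleftrightarrow> (\<exists>m a. n = 2 * m \<and> p \<approx> [:a:] \<and> degree a \<le> m \<and> coeff a m = k) \<or>
                 (\<exists>m b. n = 2 * m + 3 \<and> p \<approx> [:0, b:] \<and> degree b \<le> m \<and> coeff b m = - k)"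

lemma hom_evenI: "n = 2 * m \<Longrightarrow> p \<approx> [:a:] \<Longrightarrow> degree a \<le> m \<Longrightarrow> coeff a m = k \<Longrightarrow> hom n k p"
  unfolding hom_def by blast

lemma hom_oddI: "n = 2 * m + 3 \<Longrightarrow> p \<approx> [:0, b:] \<Longrightarrow> degree b \<le> m \<Longrightarrow> coeff b m = - k \<Longrightarrow> hom n k p"
  unfolding hom_def by blast

lemma homE:
  assumes "hom n k p"
  obtains m a where "n = 2 * m" "p \<approx> [:a:]" "degree a \<le> m" "coeff a m = k"
        | m b where "n = 2 * m + 3" "p \<approx> [:0, b:]" "degree b \<le> m" "coeff b m = - k"
  using assms unfolding hom_def by blast

lemma hom_x: "hom 2 1 x" 
  by (rule hom_evenI[of _ 1 _ "[:0, 1:]"]) (simp_all add: x_def)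

lemma hom_y: "hom 3 (- 1) y"
  by (rule hom_oddI[of _ 0 _ 1]) (simp_all add: y_def)

lemma hom_const: "hom 0 k [:[:k:]:]"
  by (rule hom_evenI[of _ 0 _ "[:k:]"]) simp_all

lemma hom_add: assumes "hom n k p" "hom n k' q" shows "hom n (k + k') (p + q)"
  using assms(1)
proof (cases rule: homE)
  case (1 m a)
  note c1 = this
  from assms(2) show ?thesis
  proof (cases rule: homE)
    case (1 m' a')
    with c1 have "m' = m" by simp
    with 1 c1 show ?thesis
      by (intro hom_evenI[of _ m _ "a + a'"]) (use eqv_add[of p "[:a:]" q "[:a':]"] in \<open>auto intro: degree_add_le\<close>)
  next
    case 2
    with c1 have False by presburger
    thus ?thesis ..
  qed
next
  case (2 m b)
  note c1 = this
  from assms(2) show ?thesis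
  proof (cases rule: homE)
    case (2 m' b')
    with c1 have "m' = m" by simp
    with 2 c1 show ?thesis
      by (intro hom_oddI[of _ m _ "b + b'"]) (use eqv_add[of p "[:0, b:]" q "[:0, b':]"] in \<open>auto intro: degree_add_le\<close>)
  next
    case 1
    with c1 have False by presburger
    thus ?thesis ..
  qed
qed

lemma hom_mult: assumes "hom n k p" "hom n' k' q" shows "hom (n + n') (k * k') (p * q)"
  using assms(1)
proof (cases rule: homE)
  case (1 m a)
  note c1 = this
  from assms(2) show ?thesis
  proof (cases rule: homE)
    case (1 m' a')
    have "p * q \<approx> [:a * a':]" using eqv_mult[OF c1(2) 1(2)] by (simp add: mult.commute)
    thus ?thesis
      by (rule hom_evenI[of _ "m + m'", rotated])
         (use 1 c1 degree_mult_le[of a a'] in \<open>auto simp: coeff_mult_top\<close>)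
  next
    case (2 m' b)
    show ?thesis
      by (rule hom_oddI[of _ "m + m'" _ "a * b"])
         (use 2 c1 eqv_mult[OF c1(2) 2(2)] degree_mult_le[of a b] in \<open>auto simp: coeff_mult_top mult.commute\<close>)
  qed
next
  case (2 m b)
  note c1 = this
  from assms(2) show ?thesis
  proof (cases rule: homE)
    case (1 m' a)
    show ?thesis
      by (rule hom_oddI[of _ "m + m'" _ "b * a"])
         (use 1 c1 eqv_mult[OF c1(2) 1(2)] degree_mult_le[of b a] coeff_mult_top[of b m a m'] in \<open>auto simp: mult.commute\<close>)
  next
    case (2 m' b')
    have "p * q \<approx> [:0, b:] * [:0, b':]" by (intro eqv_mult c1 2)
    also have "\<dots> = [:b * b':] * (y * y)" by (simp add: y_def)
    also have "\<dots> \<approx> [:b * b':] * [:f:]" by (intro eqv_mult y_sq eqv_refl)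
    finally have e: "p * q \<approx> [:b * b' * f:]" by (simp add: mult.commute)
    have d: "degree (b * b') \<le> m + m'" using degree_mult_le[of b b'] 2 c1 by simp
    have "coeff (b * b' * f) (m + m' + 3) = coeff (b * b') (m + m') * coeff f 3"
      by (intro coeff_mult_top d) simp
    hence "coeff (b * b' * f) (m + m' + 3) = k * k'"
      using 2 c1 by (simp add: coeff_mult_top)
    moreover have "degree (b * b' * f) \<le> m + m' + 3"
      using degree_mult_le[of "b * b'" f] d by simp
    ultimately show ?thesis
      by (intro hom_evenI[of _ "m + m' + 3" _ "b * b' * f"] e) (use c1 2 in auto)
  qed
qed

text \<open>The difference has to be even because \<open>hom\<close> separates functions even in y
  from functions odd in y, and the pole order has the parity of the function.\<close>

lemma hom_weaken: assumes "hom n k p" "n < n'" "even (n' - n)" shows "hom n' 0 p"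
proof -
  have "n' = n + 2 * ((n' - n) div 2)" "(n' - n) div 2 > 0" using assms(2,3) by presburger+
  then obtain j where j: "n' = n + 2 * j" "j > 0" by blast
  from assms(1) show ?thesis
  proof (cases rule: homE)
    case (1 m a)
    thus ?thesis using j by (intro hom_evenI[of _ "m + j" _ a]) (auto intro: coeff_eq_0)
  next
    case (2 m a)
    thus ?thesis using j by (intro hom_oddI[of _ "m + j" _ a]) (auto intro: coeff_eq_0)
  qed
qed

lemma hom_power: "hom n k p \<Longrightarrow> hom (j * n) (k ^ j) (p ^ j)"
proof (induction j)
  case 0 show ?case using hom_const[of 1] by (simp add: one_pCons)
next
  case (Suc j) thus ?case using hom_mult[of n k p "j * n" "k ^ j" "p ^ j"] by simp
qed

lemma hom_smult: "hom n k p \<Longrightarrow> hom n (c * k) (smult [:c:] p)"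
  using hom_mult[OF hom_const[of c], of n k p] by simp

lemma hom_minus: "hom n k p \<Longrightarrow> hom n (- k) (- p)"
proof -
  have "smult [:- 1:] p = - p" by (rule poly_eqI) simp
  thus "hom n k p \<Longrightarrow> hom n (- k) (- p)" using hom_smult[of n k p "- 1"] by simp
qed

lemma hom_diff: "hom n k p \<Longrightarrow> hom n k' q \<Longrightarrow> hom n (k - k') (p - q)"
  using hom_add[of n k p "- k'" "- q"] hom_minus[of n k' q] by simp

text \<open>The number 1 is neither 2m nor 2m + 3: no function has a single simple pole.\<close>

lemma hom_0: "n \<noteq> 1 \<Longrightarrow> hom n 0 0"
proof (cases "even n")
  case True
  then obtain m where "n = 2 * m" ..
  thus ?thesis by (intro hom_evenI[of n m 0 0]) auto
next
  case False
  assume "n \<noteq> 1"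
  with False have "n = 2 * ((n - 3) div 2) + 3" by presburger
  then obtain m where "n = 2 * m + 3" by blast
  thus ?thesis by (intro hom_oddI[of n m 0 0]) auto
qed

lemma hom_sum: "(\<And>i. i \<in> S \<Longrightarrow> hom n (k i) (g i)) \<Longrightarrow> n \<noteq> 1 \<Longrightarrow> hom n (sum k S) (sum g S)"
  by (induction S rule: infinite_finite_induct) (auto intro: hom_0 hom_add)

text \<open>On leading terms D acts as d/dt, since x ~ t^-2 and D x = 2y ~ -2 t^-3. In particular a
  pole order divisible by l loses its leading term.\<close>

lemma hom_D: assumes "hom n k p" "n \<noteq> 0" shows "hom (Suc n) (- of_nat n * k) (D p)"
  using assms(1)
proof (cases rule: homE)
  case (1 m a)
  with assms(2) obtain j where j: "m = Suc j" by (cases m) auto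
  have "D p \<approx> D [:a, 0:]" using eqv_D[OF 1(2)] by simp
  also have "\<dots> = [:0, 2 * pderiv a:]" by (simp only: curve_deriv_reduced) simp
  finally have "D p \<approx> [:0, 2 * pderiv a:]" .
  moreover have "2 * pderiv a = smult 2 (pderiv a)" by (simp add: numeral_poly)
  moreover have "degree (smult 2 (pderiv a)) \<le> j"
    using degree_smult_le[of 2 "pderiv a"] degree_pderiv_le[of a] 1 j by linarith
  moreover have "coeff (smult 2 (pderiv a)) j = - (- of_nat n * k)"
    using 1 j by (simp add: coeff_pderiv algebra_simps)
  ultimately show ?thesis
    using 1 j by (intro hom_oddI[of _ j _ "smult 2 (pderiv a)"]) simp_all
next
  case (2 m b)
  have "D p \<approx> D [:0, b:]" using eqv_D[OF 2(2)] .
  also have "\<dots> = [:pderiv f * b:] + [:2 * pderiv b:] * (y * y)" by (simp add: curve_deriv_reduced y_def)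
  also have "\<dots> \<approx> [:pderiv f * b:] + [:2 * pderiv b:] * [:f:]" by (intro eqv_add eqv_mult y_sq eqv_refl)
  finally have e: "D p \<approx> [:pderiv f * b + 2 * pderiv b * f:]" by (simp add: mult.commute)
  have df: "degree (pderiv f) \<le> 2" "coeff (pderiv f) 2 = 3"
    by (auto simp: f_def pderiv_pCons numeral_2_eq_2)
  have c1: "coeff (pderiv f * b) (2 + m) = - 3 * k"
    using 2 df by (subst coeff_mult_top) auto
  have c2: "coeff (pderiv b * f) (m + 2) = - of_nat m * k"
  proof (cases m)
    case 0
    hence "pderiv b = 0" using 2 by (auto elim!: degree_eq_zeroE simp: pderiv_pCons)
    thus ?thesis using 0 by simp
  next
    case (Suc j)
    have "coeff (pderiv b * f) (j + 3) = coeff (pderiv b) j * coeff f 3"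
      by (intro coeff_mult_top) (use degree_pderiv_le[of b] 2 Suc in auto)
    thus ?thesis using 2 Suc coeff_f_3 by (simp add: coeff_pderiv numeral_3_eq_3 algebra_simps del: coeff_f_3)
  qed
  have d2: "degree (pderiv b * f) \<le> m + 2"
  proof (cases m)
    case 0
    hence "pderiv b = 0" using 2 by (auto elim!: degree_eq_zeroE simp: pderiv_pCons)
    thus ?thesis by simp
  next
    case (Suc j)
    thus ?thesis using degree_mult_le[of "pderiv b" f] degree_pderiv_le[of b] 2 by simp
  qed
  have d1: "degree (pderiv f * b) \<le> m + 2" using degree_mult_le[of "pderiv f" b] df 2 by simp
  have "degree (pderiv f * b + 2 * pderiv b * f) \<le> m + 2"
    using d1 d2 degree_smult_le[of 2 "pderiv b * f"] by (intro degree_add_le) (auto simp: numeral_poly)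
  moreover have "coeff (pderiv f * b + 2 * pderiv b * f) (m + 2) = - of_nat n * k"
    using c1 c2 2 by (simp add: numeral_poly algebra_simps)
  ultimately show ?thesis
    by (intro hom_evenI[of _ "m + 2", OF _ e]) (use 2 in auto)
qed

lemma hom_D_iter:
  "hom n k p \<Longrightarrow> n \<noteq> 0 \<Longrightarrow> hom (n + i) (k * (\<Prod>j<i. - of_nat (n + j))) ((D ^^ i) p)"
proof (induction i)
  case (Suc i)
  from hom_D[OF Suc.IH] Suc.prems show ?case by (simp add: algebra_simps)
qed simp

end

section \<open>Wilson's theorem, antiderivatives and evaluation at points\<close>

lemma fact_CHAR_minus_1:
  assumes "CHAR('a::idom) = p" "prime p"
  shows "of_nat (fact (p - 1)) = (- 1 :: 'a)"
proof -
  have "[int (fact (p - 1)) = - 1] (mod int p)"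
    using wilson_theorem[OF assms(2)] by simp
  hence "int p dvd int (fact (p - 1) + 1)"
    by (simp add: cong_iff_dvd_diff add.commute)
  hence "p dvd fact (p - 1) + 1"
    by (simp only: int_dvd_int_iff)
  hence "(of_nat (fact (p - 1) + 1) :: 'a) = 0"
    using assms(1) by (simp only: of_nat_eq_0_iff_char_dvd)
  thus ?thesis by (simp only: eq_neg_iff_add_eq_0 of_nat_add of_nat_1)
qed

text \<open>The monomials x^i with i + 1 = 0 in the field are the only obstruction to
  integration.\<close>

lemma pderiv_antiderivative_exists:
  fixes p :: "'a::field poly"
  assumes "\<And>i. of_nat (Suc i) = (0::'a) \<Longrightarrow> coeff p i = 0"
  shows "\<exists>g. pderiv g = p"
proof
  have "pderiv (monom (coeff p i / of_nat (Suc i)) (Suc i)) = monom (coeff p i) i" for i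
    using assms[of i] by (cases "of_nat (Suc i) = (0::'a)") (simp_all add: pderiv_monom del: of_nat_Suc)
  thus "pderiv (\<Sum>i\<le>degree p. monom (coeff p i / of_nat (Suc i)) (Suc i)) = p"
    by (simp add: pderiv_sum poly_as_sum_of_monoms del: of_nat_Suc)
qed

lemma prod_neg_consecutive: "(\<Prod>j<n. - of_nat (2 + j)) = (- 1) ^ n * (of_nat (fact (n + 1)) :: 'a::comm_ring_1)"
  by (induction n) (simp_all add: algebra_simps)

definition ev :: "'a::comm_ring_1 poly poly \<Rightarrow> 'a \<Rightarrow> 'a \<Rightarrow> 'a" where
  "ev p a b = poly (poly p [:b:]) a"

lemma ev_simps [simp]:
  "ev 0 a b = 0" "ev 1 a b = 1" "ev (p + q) a b = ev p a b + ev q a b" "ev (p - q) a b = ev p a b - ev q a b"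
  "ev (- p) a b = - ev p a b" "ev (p * q) a b = ev p a b * ev q a b" "ev (p ^ n) a b = ev p a b ^ n"
  "ev (smult g p) a b = poly g a * ev p a b" "ev [:g, h:] a b = poly g a + b * poly h a"
  "ev [:g:] a b = poly g a"
  by (simp_all add: ev_def)

lemma ev_sum [simp]: "ev (sum g S) a b = (\<Sum>i\<in>S. ev (g i) a b)"
  by (simp add: ev_def poly_sum)

section \<open>The supersingular curve: D^l = 0 and the constant \<epsilon>\<close>

text \<open>The assumption \<open>hasse\<close> is Deuring's criterion for supersingularity.\<close>

locale supersingular = weierstrass A B for A B :: "'a::alg_closed_field" +
  fixes l :: nat
  assumes char: "CHAR('a) = l" and l5: "l \<ge> 5"
    and disc: "4 * A ^ 3 + 27 * B ^ 2 \<noteq> 0"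
    and hasse: "coeff (f ^ ((l - 1) div 2)) (l - 1) = 0"
begin

lemma prime_l: "prime l"
  using prime_CHAR_semidom[where ?'a = 'a] char l5 by simp

lemma odd_l: "odd l"
  using prime_l l5 prime_odd_nat by force

lemma of_nat_eq_0: "of_nat n = (0::'a) \<longleftrightarrow> l dvd n"
  using of_nat_eq_0_iff_char_dvd[where ?'a = 'a] char by simp

lemma numeral_nz [simp]: "(2::'a) \<noteq> 0" "(3::'a) \<noteq> 0"
  using of_nat_eq_0[of 2] of_nat_eq_0[of 3] l5 by (auto dest: dvd_imp_le)

lemma D_power_l: "D (p ^ l) = 0"
proof -
  obtain n where n: "l = Suc n" using l5 by (cases l) auto
  have "of_nat l = (0 :: 'a poly poly)"
    using of_nat_CHAR[where ?'a = "'a poly poly"] char by simp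
  thus ?thesis using curve_deriv_power[of f p n] n by simp
qed

lemma pderiv_eq_0_const: assumes "pderiv (g::'a poly) = 0" "degree g < l" shows "g = [:coeff g 0:]"
proof (rule poly_eqI)
  fix n
  show "coeff g n = coeff [:coeff g 0:] n"
  proof (cases n)
    case (Suc i)
    have "of_nat (Suc i) * coeff g (Suc i) = 0" using assms(1) by (metis coeff_pderiv coeff_0)
    moreover have "coeff g (Suc i) = 0" if "l dvd Suc i"
      using that assms(2) by (intro coeff_eq_0) (auto dest: dvd_imp_le)
    ultimately show ?thesis using Suc of_nat_eq_0[of "Suc i"] by auto
  qed simp
qed

text \<open>The inner binomial coefficients of row l are divisible by l, so D^l is again a
  derivation.\<close>

lemma D_l_mult: "(D ^^ l) (p * q) = (D ^^ l) p * q + p * (D ^^ l) q"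
proof -
  define t where "t k = of_nat (l choose k) * ((D ^^ k) p * (D ^^ (l - k)) q)" for k
  have "t k = 0" if "k \<in> {..l} - {0, l}" for k
  proof -
    have "CHAR('a poly poly) dvd (l choose k)" using that prime_l l5 char by (auto intro: dvd_choose_prime)
    hence "of_nat (l choose k) = (0 :: 'a poly poly)" by (simp only: of_nat_eq_0_iff_char_dvd)
    thus ?thesis by (simp add: t_def)
  qed
  hence "(D ^^ l) (p * q) = sum t {0, l}"
    unfolding curve_deriv_Leibniz t_def[symmetric] by (intro sum.mono_neutral_right) auto
  also have "\<dots> = t l + t 0" using l5 by simp
  also have "\<dots> = (D ^^ l) p * q + p * (D ^^ l) q" by (simp add: t_def)
  finally show ?thesis .
qed

lemma D_l_poly_x: "(D ^^ l) [:g:] = [:pderiv g:] * (D ^^ l) x"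
proof (induction g)
  case 0 show ?case by (simp add: curve_deriv_iter_linear)
next
  case (pCons a g)
  have "[:pCons a g:] = [:[:a:]:] + x * [:g:]" by (simp add: x_def)
  moreover have "(D ^^ l) [:[:a:]:] = 0" using l5 by (intro curve_deriv_iter_const) simp
  ultimately have "(D ^^ l) [:pCons a g:] = (D ^^ l) x * [:g:] + x * (D ^^ l) [:g:]"
    by (simp only: curve_deriv_iter_linear D_l_mult) simp
  also have "\<dots> = [:pderiv (pCons a g):] * (D ^^ l) x"
    unfolding pCons.IH by (simp add: pderiv_pCons x_def smult_add_left algebra_simps)
  finally show ?case .
qed

lemma y_power_l: "y ^ l \<approx> [:0, f ^ ((l - 1) div 2):]"
proof -
  have "l = Suc (2 * ((l - 1) div 2))" using odd_l by presburger
  hence "y ^ l = y * (y * y) ^ ((l - 1) div 2)"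
    by (metis power_Suc power_mult power2_eq_square)
  also have "\<dots> \<approx> y * [:f:] ^ ((l - 1) div 2)" by (intro eqv_mult eqv_power y_sq eqv_refl)
  also have "[:f:] ^ n = [:f ^ n:]" for n by (induction n) (simp_all add: one_pCons)
  finally show ?thesis by (simp add: y_def)
qed

text \<open>The differential \<open>dx/2y\<close> is exact up to the \<open>D\<close>-constant \<open>y\<^sup>l\<close>: an antiderivative \<open>G\<close> of
  \<open>f\<^bsup>(l-1)/2\<^esup>\<close> satisfies \<open>D G = 2 y\<^sup>l\<close>, so the derivation \<open>D\<^sup>l\<close> kills \<open>G\<close> and hence \<open>x\<close>.\<close>

lemma D_l_x: "(D ^^ l) x \<approx> 0"
proof -
  define m where "m = (l - 1) div 2"
  have l_m: "l = 2 * m + 1" unfolding m_def using odd_l by presburger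
  have "\<exists>G. pderiv G = f ^ m"
  proof (rule pderiv_antiderivative_exists)
    fix i assume "of_nat (Suc i) = (0::'a)"
    hence "l dvd Suc i" by (simp only: of_nat_eq_0)
    then obtain k where k: "Suc i = l * k" by auto
    \<comment> \<open>Only i = l - 1 needs \<open>hasse\<close>: the next exponent congruent to -1
      is 2l - 1 = 4m + 1, above the degree 3m of f^m.\<close>
    show "coeff (f ^ m) i = 0"
    proof (cases "k = 1")
      case True
      hence "i = l - 1" using k by simp
      thus ?thesis using hasse by (simp add: m_def)
    next
      case False
      have "k \<noteq> 0" using k by (cases k) auto
      with False have "k \<ge> 2" by simp
      hence "l * 2 \<le> Suc i" using k by simp
      moreover have "degree (f ^ m) = 3 * m" by (simp add: degree_power_eq)
      ultimately show ?thesis using l_m by (intro coeff_eq_0) simp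
    qed
  qed
  then obtain G where G: "pderiv G = f ^ m" by blast
  have "D [:G:] = [:0, 2 * f ^ m:]"
    using curve_deriv_reduced[of f G 0] G by simp
  also have "\<dots> = 2 * [:0, f ^ m:]" by (simp add: numeral_poly)
  also have "\<dots> \<approx> 2 * y ^ l" by (intro eqv_mult eqv_refl eqv_sym[OF y_power_l[folded m_def]])
  finally have e: "D [:G:] \<approx> 2 * y ^ l" .
  have l1: "l = Suc (Suc (l - 2))" using l5 by simp
  have "(D ^^ l) [:G:] = (D ^^ (l - 2)) (D (D [:G:]))"
    by (subst l1) (simp only: funpow_Suc_right comp_apply)
  also have "\<dots> \<approx> (D ^^ (l - 2)) (D (2 * y ^ l))" by (intro eqv_D_iter eqv_D e)
  also have "D (2 * y ^ l) = 0"
    by (simp only: mult_2 curve_deriv_add D_power_l add_0)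
  also have "(D ^^ (l - 2)) 0 = 0" by (simp add: curve_deriv_iter_linear)
  finally have "[:f ^ m:] * (D ^^ l) x \<approx> 0" by (simp only: D_l_poly_x G)
  moreover obtain a b where ab: "(D ^^ l) x \<approx> [:a, b:]" using reduced_exists by blast
  ultimately have "[:f ^ m:] * [:a, b:] \<approx> 0"
    by (meson eqv_mult eqv_refl eqv_sym eqv_trans)
  hence "[:f ^ m * a, f ^ m * b:] \<approx> [:0, 0:]" by (simp add: mult.commute)
  hence "a = 0" "b = 0" unfolding eqv_reduced_iff by auto
  thus ?thesis using ab by simp
qed

lemma D_l_eqv_0: "(D ^^ l) p \<approx> 0"
proof (induction p)
  case 0 show ?case by (simp add: curve_deriv_iter_linear)
next
  case (pCons c p)
  have c0: "(D ^^ l) [:c:] \<approx> 0"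
    using eqv_mult[OF eqv_refl D_l_x, of "[:pderiv c:]"] by (simp only: D_l_poly_x) simp
  \<comment> \<open>D^l commutes with D, so its vanishing at x passes to y = D x / 2.\<close>
  have "y = smult [:1/2:] (D x)" by (simp add: y_def numeral_poly)
  hence "(D ^^ l) y = (D ^^ l) (smult [:1/2:] (D x))" by (rule arg_cong)
  also have "\<dots> = smult [:1/2:] (D ((D ^^ l) x))"
    by (simp only: curve_deriv_iter_linear funpow_swap1)
  also have "\<dots> = [:[:1/2:]:] * D ((D ^^ l) x)" by simp
  also have "\<dots> \<approx> [:[:1/2:]:] * D 0" by (intro eqv_mult eqv_D D_l_x eqv_refl)
  finally have y0: "(D ^^ l) y \<approx> 0" by simp
  have "pCons c p = [:c:] + y * p" by (simp add: y_def)
  hence "(D ^^ l) (pCons c p) = (D ^^ l) [:c:] + ((D ^^ l) y * p + y * (D ^^ l) p)"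
    by (simp only: curve_deriv_iter_linear D_l_mult)
  also have "\<dots> \<approx> 0 + (0 * p + y * 0)"
    by (intro eqv_add eqv_mult c0 y0 pCons eqv_refl)
  finally show ?case by simp
qed

lemma D_ge_l_eqv_0: assumes "k \<ge> l" shows "(D ^^ k) p \<approx> 0"
proof -
  have "(D ^^ k) p = (D ^^ l) ((D ^^ (k - l)) p)"
    using assms by (metis funpow_add comp_apply le_add_diff_inverse)
  thus ?thesis using D_l_eqv_0 by simp
qed

text \<open>\<open>s\<close> and \<open>t\<close> are Bezout cofactors: s f + t f' is, up to sign,
  the discriminant, so f and f' are coprime.\<close>

lemma f_dvd_pderiv_mult: assumes "f dvd pderiv f * u" shows "f dvd u"
proof -
  define s where "s = [:27 * B, - 18 * A:]"
  define t where "t = [:4 * A ^ 2, - 9 * B, 6 * A:]"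
  have "s * f + t * pderiv f = [:4 * A ^ 3 + 27 * B ^ 2:]"
    by (simp add: s_def t_def f_def pderiv_pCons power2_eq_square power3_eq_cube algebra_simps)
  hence "[:4 * A ^ 3 + 27 * B ^ 2:] * u = (s * f + t * pderiv f) * u" by (simp only:)
  also have "\<dots> = s * u * f + t * (pderiv f * u)" by (simp only: distrib_left distrib_right ac_simps)
  finally have "smult (4 * A ^ 3 + 27 * B ^ 2) u = s * u * f + t * (pderiv f * u)" by simp
  hence "f dvd smult (4 * A ^ 3 + 27 * B ^ 2) u"
    using assms by simp
  thus ?thesis using disc by (simp add: dvd_smult_iff)
qed

text \<open>The hypothesis says D(b y) = 0. Factors f are split off one by one: after k of them the
  remaining equation has the coefficient 2k + 1, which is invertible until 2k + 1 = l, where only c'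
  = 0 is left.\<close>

lemma pderiv_sqrt_f_multiple:
  assumes "pderiv f * b + 2 * f * pderiv b = 0"
  shows "\<exists>c. b = f ^ ((l - 1) div 2) * c \<and> pderiv c = 0"
proof -
  have "\<exists>c. b = f ^ k * c \<and> of_nat (2 * k + 1) * pderiv f * c + 2 * f * pderiv c = 0"
    if "k \<le> (l - 1) div 2" for k
    using that
  proof (induction k)
    case 0 thus ?case using assms by (intro exI[of _ b]) simp
  next
    case (Suc k)
    then obtain c where c: "b = f ^ k * c" "of_nat (2 * k + 1) * pderiv f * c + 2 * f * pderiv c = 0"
      by auto
    have "\<not> l dvd 2 * k + 1" using Suc.prems l5 by (auto dest!: dvd_imp_le)
    hence nz: "of_nat (2 * k + 1) \<noteq> (0::'a)" by (simp only: of_nat_eq_0 not_False_eq_True)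
    have "of_nat (2 * k + 1) * pderiv f * c = f * (- 2 * pderiv c)"
      using c(2) unfolding add_eq_0_iff2 by (simp add: ac_simps)
    hence "f dvd of_nat (2 * k + 1) * pderiv f * c" by (metis dvd_triv_left)
    also have "of_nat (2 * k + 1) * pderiv f * c = smult (of_nat (2 * k + 1)) (pderiv f * c)"
      by (simp only: of_nat_poly mult.assoc) simp
    finally have "f dvd pderiv f * c" using nz dvd_smult_cancel by blast
    hence "f dvd c" by (rule f_dvd_pderiv_mult)
    then obtain c' where c': "c = f * c'" ..
    have "f * (of_nat (2 * Suc k + 1) * pderiv f * c' + 2 * f * pderiv c') = 0"
      using c(2) unfolding c' by (simp add: pderiv_mult algebra_simps)
    hence "of_nat (2 * Suc k + 1) * pderiv f * c' + 2 * f * pderiv c' = 0" by simp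
    moreover have "b = f ^ Suc k * c'" using c(1) c' by (simp add: algebra_simps)
    ultimately show ?case by blast
  qed
  from this[of "(l - 1) div 2"] obtain c where c: "b = f ^ ((l - 1) div 2) * c"
    "of_nat (2 * ((l - 1) div 2) + 1) * pderiv f * c + 2 * f * pderiv c = 0" by blast
  have "2 * ((l - 1) div 2) + 1 = l" using odd_l by presburger
  hence "of_nat (2 * ((l - 1) div 2) + 1) = (0 :: 'a poly)"
    using of_nat_CHAR[where ?'a = "'a poly"] char by simp
  with c(2) have "2 * f * pderiv c = 0" by (simp only: mult_zero_left add_0)
  hence "pderiv c = 0" by (simp add: numeral_poly)
  thus ?thesis using c(1) by blast
qed

lemma hom_X: "hom (2 + i) ((- 1) ^ i * of_nat (fact (i + 1))) ((D ^^ i) x)"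
  using hom_D_iter[OF hom_x, of i] by (simp only: prod_neg_consecutive) simp

text \<open>By Wilson's theorem the leading coefficient is -(l-1)! = 1.\<close>

lemma hom_X_l_minus_2: "hom l 1 ((D ^^ (l - 2)) x)"
proof -
  have "of_nat (fact (l - 1)) = (- 1 :: 'a)" using fact_CHAR_minus_1 char prime_l by blast
  moreover have "odd (l - 2)" "Suc (l - 2) = l - 1" using odd_l l5 by auto
  ultimately show ?thesis using hom_X[of "l - 2"] l5 by simp
qed

definition \<epsilon> :: 'a where "\<epsilon> = (THE e. (D ^^ (l - 1)) x \<approx> [:[:e:]:])"

text \<open>D^(l-1) x is even in y, of degree at most (l+1)/2 < l in x, and killed by D; hence it is
  constant. Were it zero, D^(l-2) x = b y would be a D-constant, so that f^((l-1)/2) would divide b,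
  whose degree is too small.\<close>

lemma X_l_minus_1: "(D ^^ (l - 1)) x \<approx> [:[:\<epsilon>:]:]"
  and eps_nz: "\<epsilon> \<noteq> 0"
proof -
  have s: "Suc (l - 2) = l - 1" using l5 by simp
  have h: "hom (Suc l) 0 ((D ^^ (l - 1)) x)"
    using hom_D[OF hom_X_l_minus_2] l5 of_nat_eq_0[of l] unfolding s[symmetric] by simp
  have "\<exists>e. (D ^^ (l - 1)) x \<approx> [:[:e:]:]"
    using h
  proof (cases rule: homE)
    case (1 m a)
    have "D [:a, 0:] \<approx> D ((D ^^ (l - 1)) x)" using eqv_D[OF eqv_sym[OF 1(2)]] by simp
    also have "\<dots> = (D ^^ l) x" using l5 by (cases l) auto
    also have "\<dots> \<approx> [:0, 0:]" using D_l_x by simp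
    finally have "2 * pderiv a = 0" unfolding curve_deriv_reduced
      using eqv_reduced_iff[of 0 "2 * pderiv a" 0 0] by simp
    hence "pderiv a = 0" by (simp add: numeral_poly)
    moreover have "degree a < l" using 1 l5 by simp
    ultimately have "a = [:coeff a 0:]" by (rule pderiv_eq_0_const)
    hence "(D ^^ (l - 1)) x \<approx> [:[:coeff a 0:]:]" using 1(2) by (simp only:)
    thus ?thesis ..
  next
    case (2 m b)
    hence False using odd_l by presburger
    thus ?thesis ..
  qed
  then obtain e where e: "(D ^^ (l - 1)) x \<approx> [:[:e:]:]" by blast
  have uniq: "e' = e" if "(D ^^ (l - 1)) x \<approx> [:[:e':]:]" for e'
    using eqv_trans[OF eqv_sym[OF that] e] eqv_reduced_iff[of "[:e':]" 0 "[:e:]" 0] by simp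
  have eps: "\<epsilon> = e" unfolding \<epsilon>_def by (rule the_equality) (fact e, fact uniq)
  show "(D ^^ (l - 1)) x \<approx> [:[:\<epsilon>:]:]" unfolding eps by (rule e)
  show "\<epsilon> \<noteq> 0"
  proof
    assume "\<epsilon> = 0"
    with e eps have D0: "(D ^^ (l - 1)) x \<approx> 0" by simp
    from hom_X_l_minus_2 show False
    proof (cases rule: homE)
      case (1 m a)
      thus False using odd_l by simp
    next
      case (2 m b)
      have "D [:0, b:] \<approx> D ((D ^^ (l - 2)) x)" by (intro eqv_D eqv_sym[OF 2(2)])
      also have "\<dots> = (D ^^ (l - 1)) x" unfolding s[symmetric] by simp
      also have "\<dots> \<approx> 0" by (rule D0)
      finally have D1: "D [:0, b:] \<approx> 0" .
      have "D [:0, b:] = [:pderiv f * b:] + [:2 * pderiv b:] * (y * y)" by (simp add: curve_deriv_reduced y_def)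
      also have "\<dots> \<approx> [:pderiv f * b:] + [:2 * pderiv b:] * [:f:]" by (intro eqv_add eqv_mult y_sq eqv_refl)
      finally have "D [:0, b:] \<approx> [:pderiv f * b + 2 * f * pderiv b:]" by (simp add: algebra_simps)
      hence "[:pderiv f * b + 2 * f * pderiv b:] \<approx> 0" using D1 eqv_sym eqv_trans by blast
      hence "pderiv f * b + 2 * f * pderiv b = 0"
        using eqv_reduced_iff[of "pderiv f * b + 2 * f * pderiv b" 0 0 0] by simp
      then obtain c where c: "b = f ^ ((l - 1) div 2) * c" using pderiv_sqrt_f_multiple by blast
      have "b \<noteq> 0" using 2 by auto
      hence "c \<noteq> 0" using c by auto
      hence "degree b \<ge> 3 * ((l - 1) div 2)" using c by (simp add: degree_mult_eq degree_power_eq)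
      thus False using 2 l5 by linarith
    qed
  qed
qed

end

section \<open>The function with an l-fold zero at R\<close>

context weierstrass
begin

lemma ev_cong: assumes "p \<approx> q" "b ^ 2 = poly f a" shows "ev p a b = ev q a b"
proof -
  from assms(1) obtain r where "p - q = P * r" unfolding eqv_def by (auto simp: dvd_def)
  hence "ev p a b - ev q a b = ev P a b * ev r a b" by (metis ev_simps(4,6))
  moreover have "ev P a b = 0" using assms(2) by (simp add: ev_def P_def power2_eq_square)
  ultimately show ?thesis by simp
qed

end

context supersingular
begin

text \<open>The constants, the D^i x for i < l - 1, with pole orders 2, ..., l, and \<open>Y\<close>
  form a basis of the functions whose only pole is at O and of order at most l + 1.\<close>

definition Y :: "'a poly poly" where "Y = x ^ ((l + 1) div 2)"

lemma hom_Y: "hom (l + 1) 1 Y"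
proof -
  have "(l + 1) div 2 * 2 = l + 1" using odd_l by presburger
  thus ?thesis using hom_power[OF hom_x, of "(l + 1) div 2"] by (simp add: Y_def)
qed

text \<open>The factors l + 1 + j reduce to 1 + j, so the product is again (l-1)! = -1.\<close>

lemma hom_DY: "hom (2 * l) (- 1) ((D ^^ (l - 1)) Y)"
proof -
  have "(\<Prod>j<n. - (of_nat (l + 1 + j) :: 'a)) = (- 1) ^ n * of_nat (fact n)" for n
  proof (induction n)
    case (Suc n)
    have "of_nat (l + 1 + n) = (of_nat (Suc n) :: 'a)" using of_nat_eq_0[of l] by simp
    with Suc show ?case by (simp add: algebra_simps)
  qed simp
  moreover have "of_nat (fact (l - 1)) = (- 1 :: 'a)" using fact_CHAR_minus_1 char prime_l by blast
  moreover have "even (l - 1)" using odd_l by simp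
  moreover have "l + 1 + (l - 1) = 2 * l" using l5 by simp
  moreover note hom_D_iter[OF hom_Y, of "l - 1"]
  ultimately show ?thesis by (simp only: add_is_0 one_neq_zero simp_thms power_minus_even power_one mult_1)
qed

text \<open>The coefficients, as functions of a point \<open>R\<close>, of the function \<open>w\<^sub>R\<close> with divisor
  \<open>l(R) + (-Q) - (l+1)O\<close>: they are obtained by solving the triangular system that expresses the
  vanishing of \<open>D\<^sup>k w\<^sub>R\<close> at \<open>R\<close> for \<open>k < l\<close>.\<close>

fun T :: "nat \<Rightarrow> 'a poly poly" where
  "T j = smult [:- (1 / \<epsilon>):] ((D ^^ (l - 1 - j)) Y + (\<Sum>i<j. T i * (D ^^ (l - 1 - j + i)) x))"

declare T.simps [simp del]

text \<open>The constant term of the function: it is absent from the equations for D^k with k > 0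
  and is fixed by the vanishing at R itself.\<close>

definition T_end :: "'a poly poly" where
  "T_end = - (Y + (\<Sum>i<l - 1. T i * (D ^^ i) x))"

lemma T_rel: "smult [:\<epsilon>:] (T j) = - ((D ^^ (l - 1 - j)) Y + (\<Sum>i<j. T i * (D ^^ (l - 1 - j + i)) x))"
proof -
  have "smult [:\<epsilon>:] (smult [:- (1 / \<epsilon>):] p) = - p" for p :: "'a poly poly"
    by (rule poly_eqI) (simp add: eps_nz)
  thus ?thesis by (subst T.simps) (simp only:)
qed

lemma T_rel_eqv:
  "T j * (D ^^ (l - 1)) x \<approx> - ((D ^^ (l - 1 - j)) Y + (\<Sum>i<j. T i * (D ^^ (l - 1 - j + i)) x))"
proof -
  have "T j * (D ^^ (l - 1)) x \<approx> T j * [:[:\<epsilon>:]:]" by (intro eqv_mult X_l_minus_1 eqv_refl)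
  also have "\<dots> = smult [:\<epsilon>:] (T j)" by simp
  finally show ?thesis unfolding T_rel .
qed

text \<open>Differentiating the row that defines \<open>T j\<close> gives the row of
  \<open>T (j - 1)\<close>, which already holds; for j = 0 it gives D^l Y = 0.\<close>

lemma D_T: "j < l - 1 \<Longrightarrow> D (T j) \<approx> 0"
proof (induction j rule: less_induct)
  case (less j)
  let ?s = "(D ^^ (l - 1 - j)) Y + (\<Sum>i<j. T i * (D ^^ (l - 1 - j + i)) x)"
  have "D ?s = D ((D ^^ (l - 1 - j)) Y) + (\<Sum>i<j. D (T i) * (D ^^ (l - 1 - j + i)) x + T i * D ((D ^^ (l - 1 - j + i)) x))"
    by (simp add: curve_deriv_sum curve_deriv_mult)
  also have "\<dots> \<approx> D ((D ^^ (l - 1 - j)) Y) + (\<Sum>i<j. 0 * (D ^^ (l - 1 - j + i)) x + T i * D ((D ^^ (l - 1 - j + i)) x))"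
    using less by (intro eqv_add eqv_sum eqv_mult eqv_refl) auto
  also have "\<dots> = (D ^^ (Suc (l - 1 - j))) Y + (\<Sum>i<j. T i * (D ^^ (Suc (l - 1 - j) + i)) x)"
    by simp
  also have "\<dots> \<approx> 0"
  proof (cases j)
    case 0
    thus ?thesis using D_l_eqv_0[of Y] l5 by simp
  next
    case (Suc k)
    hence e: "Suc (l - 1 - j) = l - 1 - k" using less.prems by simp
    have e2: "l - 1 - k + k = l - 1" using Suc less.prems by simp
    have "(D ^^ (l - 1 - k)) Y + (\<Sum>i<j. T i * (D ^^ (l - 1 - k + i)) x) =
        ((D ^^ (l - 1 - k)) Y + (\<Sum>i<k. T i * (D ^^ (l - 1 - k + i)) x)) + T k * (D ^^ (l - 1)) x"
      using Suc e2 by (simp add: add.assoc)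
    also have "\<dots> \<approx> ((D ^^ (l - 1 - k)) Y + (\<Sum>i<k. T i * (D ^^ (l - 1 - k + i)) x)) +
        - ((D ^^ (l - 1 - k)) Y + (\<Sum>i<k. T i * (D ^^ (l - 1 - k + i)) x))"
      by (intro eqv_add eqv_refl T_rel_eqv)
    finally show ?thesis unfolding e by simp
  qed
  finally have "D ?s \<approx> 0" .
  hence "[:[:- (1 / \<epsilon>):]:] * D ?s \<approx> [:[:- (1 / \<epsilon>):]:] * 0" by (intro eqv_mult eqv_refl)
  moreover have "D (T j) = [:[:- (1 / \<epsilon>):]:] * D ?s" by (subst T.simps) (simp only: curve_deriv_smult, simp)
  ultimately show ?case by simp
qed

definition c where "c = 1 / \<epsilon>"

lemma c_nz: "c \<noteq> 0" using eps_nz by (simp add: c_def)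

text \<open>For j > 0 the pole order is attained only by the last summand T (j - 1) D^(l-2) x of the
  recursion; every other term falls short by a positive multiple of l + 1, which is even.\<close>

lemma hom_T: "j < l - 1 \<Longrightarrow> hom ((2 + j) * l) (c * (- c) ^ j) (T j)"
proof (induction j rule: less_induct)
  case (less j)
  show ?case
  proof (cases j)
    case 0
    have "hom (2 * l) (- c * (- 1)) (smult [:- c:] ((D ^^ (l - 1)) Y))"
      by (intro hom_smult hom_DY)
    moreover have "T 0 = smult [:- c:] ((D ^^ (l - 1)) Y)" by (simp add: T.simps[of 0] c_def)
    ultimately show ?thesis using 0 by simp
  next
    case (Suc k)
    have hY: "hom ((2 + j) * l) 0 ((D ^^ (l - 1 - j)) Y)"
    proof -
      have "\<exists>\<kappa>. hom (l + 1 + (l - 1 - j)) \<kappa> ((D ^^ (l - 1 - j)) Y)"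
        using hom_D_iter[OF hom_Y, of "l - 1 - j"] by auto
      then obtain \<kappa> where k: "hom (l + 1 + (l - 1 - j)) \<kappa> ((D ^^ (l - 1 - j)) Y)" ..
      have "(2 + j) * l = (l + 1 + (l - 1 - j)) + j * (l + 1)" using less.prems by (simp add: algebra_simps)
      thus ?thesis using k Suc odd_l by (intro hom_weaken[OF k]) auto
    qed
    have hs: "hom ((2 + j) * l) 0 (T i * (D ^^ (l - 1 - j + i)) x)" if "i < k" for i
    proof -
      have "hom ((2 + i) * l) (c * (- c) ^ i) (T i)" using less that Suc by simp
      from hom_mult[OF this hom_X[of "l - 1 - j + i"]]
      have h: "hom ((2 + i) * l + (2 + (l - 1 - j + i))) (c * (- c) ^ i * ((- 1) ^ (l - 1 - j + i) * of_nat (fact (l - 1 - j + i + 1))))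
         (T i * (D ^^ (l - 1 - j + i)) x)" .
      define n where "n = k - i"
      have n: "k = i + n" "n > 0" using that by (simp_all add: n_def)
      define r where "r = l - j - 2"
      have r: "l = r + j + 2" using less.prems by (simp add: r_def)
      have "(2 + j) * l = (2 + i) * l + (2 + (l - 1 - j + i)) + n * (l + 1)"
        using n Suc r by (simp add: algebra_simps)
      thus ?thesis using n odd_l by (intro hom_weaken[OF h]) auto
    qed
    have e: "l - 1 - j + k = l - 2" using less.prems Suc by simp
    have "hom ((2 + k) * l + l) (c * (- c) ^ k * 1) (T k * (D ^^ (l - 2)) x)"
      using less Suc by (intro hom_mult hom_X_l_minus_2) auto
    hence hk: "hom ((2 + j) * l) (c * (- c) ^ k) (T k * (D ^^ (l - 2)) x)"
      using Suc by (simp add: algebra_simps)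
    have n1: "(2 + j) * l \<noteq> 1" using l5 by simp
    have "hom ((2 + j) * l) (- c * (0 + ((\<Sum>i<k. 0) + c * (- c) ^ k)))
        (smult [:- c:] ((D ^^ (l - 1 - j)) Y + ((\<Sum>i<k. T i * (D ^^ (l - 1 - j + i)) x) + T k * (D ^^ (l - 2)) x)))"
      by (intro hom_smult hom_add hY hk hom_sum hs n1) auto
    also have "((\<Sum>i<k. T i * (D ^^ (l - 1 - j + i)) x) + T k * (D ^^ (l - 2)) x) = (\<Sum>i<j. T i * (D ^^ (l - 1 - j + i)) x)"
      using e Suc by simp
    finally show ?thesis using Suc T.simps[of j] by (simp add: c_def algebra_simps)
  qed
qed

definition W :: "'a \<Rightarrow> 'a \<Rightarrow> 'a poly poly" where
  "W a b = Y + (\<Sum>i<l - 1. smult [:ev (T i) a b:] ((D ^^ i) x)) + [:[:ev T_end a b:]:]"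

lemma W_vanishes:
  assumes R: "b ^ 2 = poly f a" and "k < l"
  shows "ev ((D ^^ k) (W a b)) a b = 0"
proof (cases "k = 0")
  case True
  thus ?thesis by (simp add: W_def T_end_def)
next
  case False
  \<comment> \<open>The k-th derivative is row j of the triangular system: the terms with k + i >= l
    vanish, and the one with k + i = l - 1 is the pivot.\<close>
  define j where "j = l - 1 - k"
  have j: "j < l - 1" "l - 1 - j = k" using False assms(2) by (auto simp: j_def)
  have "(D ^^ k) (W a b) = (D ^^ k) Y + (\<Sum>i<l - 1. smult [:ev (T i) a b:] ((D ^^ (k + i)) x))"
    using False by (simp add: W_def curve_deriv_iter_linear curve_deriv_iter_sum curve_deriv_iter_const funpow_add)
  hence "ev ((D ^^ k) (W a b)) a b = ev ((D ^^ k) Y) a b + (\<Sum>i<l - 1. ev (T i * (D ^^ (k + i)) x) a b)"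
    by simp
  also have "(\<Sum>i<l - 1. ev (T i * (D ^^ (k + i)) x) a b) = (\<Sum>i<Suc j. ev (T i * (D ^^ (k + i)) x) a b)"
  proof (rule sum.mono_neutral_right)
    show "\<forall>i\<in>{..<l - 1} - {..<Suc j}. ev (T i * (D ^^ (k + i)) x) a b = 0"
    proof
      fix i assume "i \<in> {..<l - 1} - {..<Suc j}"
      hence "k + i \<ge> l" using j by auto
      thus "ev (T i * (D ^^ (k + i)) x) a b = 0"
        using ev_cong[OF D_ge_l_eqv_0 R, of "k + i" x] by simp
    qed
  qed (use j in auto)
  also have "\<dots> = ev (\<Sum>i<j. T i * (D ^^ (k + i)) x) a b + ev (T j * (D ^^ (l - 1)) x) a b"
  proof -
    have "k + j = l - 1" using j by simp
    thus ?thesis by simp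
  qed
  also have "ev (T j * (D ^^ (l - 1)) x) a b = ev (- ((D ^^ k) Y + (\<Sum>i<j. T i * (D ^^ (k + i)) x))) a b"
    using ev_cong[OF T_rel_eqv[of j] R] j(2) by (simp only:)
  finally show ?thesis by simp
qed

end

section \<open>Order of vanishing at a point\<close>

context weierstrass
begin

text \<open>D is nonzero at every point of a smooth curve, so for n up to the characteristic this is
  a zero of order at least n.\<close>

definition van :: "nat \<Rightarrow> 'a \<Rightarrow> 'a \<Rightarrow> 'a poly poly \<Rightarrow> bool" where
  "van n a b p \<longleftrightarrow> (\<forall>k<n. ev ((D ^^ k) p) a b = 0)"

lemma van_0 [simp]: "van 0 a b p" by (simp add: van_def)

lemma van_mono: "van n a b p \<Longrightarrow> m \<le> n \<Longrightarrow> van m a b p" by (auto simp: van_def)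

lemma van_add: "van n a b p \<Longrightarrow> van n a b q \<Longrightarrow> van n a b (p + q)"
  by (simp add: van_def curve_deriv_iter_linear)

lemma van_diff: "van n a b p \<Longrightarrow> van n a b q \<Longrightarrow> van n a b (p - q)"
  by (simp add: van_def curve_deriv_iter_linear)

lemma van_smult: "van n a b p \<Longrightarrow> van n a b (smult [:k:] p)"
  by (simp add: van_def curve_deriv_iter_linear)

lemma van_mult: assumes "van m a b p" "van n a b q" shows "van (m + n) a b (p * q)"
  unfolding van_def
proof (intro allI impI)
  fix k assume k: "k < m + n"
  have "ev ((D ^^ i) p) a b * ev ((D ^^ (k - i)) q) a b = 0" if "i \<le> k" for i
  proof (cases "i < m")
    case False
    hence "k - i < n" using k that by linarith
    thus ?thesis using assms(2) by (simp add: van_def)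
  qed (use assms(1) in \<open>simp add: van_def\<close>)
  hence "ev (of_nat (k choose i) * ((D ^^ i) p * (D ^^ (k - i)) q)) a b = 0" if "i \<le> k" for i
    using that by (simp only: ev_simps mult_zero_right)
  thus "ev ((D ^^ k) (p * q)) a b = 0"
    unfolding curve_deriv_Leibniz ev_sum by (intro sum.neutral) auto
qed

lemma van_power: "van m a b p \<Longrightarrow> van (k * m) a b (p ^ k)"
  by (induction k) (auto intro: van_mult)

lemma van_cong: assumes "p \<approx> q" "b ^ 2 = poly f a" shows "van n a b p \<longleftrightarrow> van n a b q"
  unfolding van_def using ev_cong[OF eqv_D_iter[OF assms(1)] assms(2)] by simp

text \<open>In the Leibniz expansion of D^k (h p) at the point all terms but h D^k p vanish by
  induction.\<close>

lemma van_unit_cancel: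
  assumes "van n a b (h * p)" "ev h a b \<noteq> 0" shows "van n a b p"
proof -
  have "ev ((D ^^ k) p) a b = 0" if "k < n" for k
    using that
  proof (induction k rule: less_induct)
    case (less k)
    define t where "t i = of_nat (k choose i) * (ev ((D ^^ i) h) a b * ev ((D ^^ (k - i)) p) a b)" for i
    have "ev (of_nat m) a b = of_nat m" for m by (induction m) simp_all
    hence "0 = (\<Sum>i\<le>k. t i)"
      using assms(1) less.prems by (simp add: van_def curve_deriv_Leibniz t_def)
    also have "\<dots> = (\<Sum>i\<in>{0}. t i)"
      by (rule sum.mono_neutral_right) (use less in \<open>auto simp: t_def\<close>)
    finally show ?case using assms(2) by (simp add: t_def)
  qed
  thus ?thesis by (simp add: van_def)
qed

text \<open>At a zero of s only those terms survive in which each factor s is differentiated exactly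
  once. The induction carries n spare factors s.\<close>

lemma ev_D_iter_power_mult:
  assumes "ev s a b = 0"
  shows "ev ((D ^^ k) (s ^ k * h)) a b = of_nat (fact k) * ev (D s) a b ^ k * ev h a b"
proof -
  have "\<exists>g. (D ^^ j) (s ^ (n + j) * h) = s ^ n * g \<and>
      of_nat (fact n) * ev g a b = of_nat (fact (n + j)) * ev (D s) a b ^ j * ev h a b" for j n
  proof (induction j arbitrary: n)
    case 0 show ?case by (intro exI[of _ h]) simp
  next
    case (Suc j)
    from Suc[of "Suc n"] obtain g where g: "(D ^^ j) (s ^ (Suc n + j) * h) = s ^ Suc n * g"
      "of_nat (fact (Suc n)) * ev g a b = of_nat (fact (Suc n + j)) * ev (D s) a b ^ j * ev h a b"
      by blast
    have ev_nat: "ev (of_nat m) a b = of_nat m" for m by (induction m) simp_all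
    have "(D ^^ Suc j) (s ^ (n + Suc j) * h) = D (s ^ Suc n * g)" using g(1) by simp
    also have "\<dots> = s ^ n * (of_nat (Suc n) * D s * g + s * D g)"
      unfolding curve_deriv_mult curve_deriv_power by (simp add: algebra_simps)
    finally have "(D ^^ Suc j) (s ^ (n + Suc j) * h) = s ^ n * (of_nat (Suc n) * D s * g + s * D g)" .
    moreover have "of_nat (fact n) * ev (of_nat (Suc n) * D s * g + s * D g) a b =
        (of_nat (fact (Suc n)) * ev g a b) * ev (D s) a b"
      using assms by (simp only: ev_simps ev_nat fact_Suc of_nat_mult) (simp add: algebra_simps)
    ultimately show ?case
      unfolding g(2) by (intro exI[of _ "of_nat (Suc n) * D s * g + s * D g"]) (simp add: algebra_simps)
  qed
  from this[of k 0] show ?thesis by auto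
qed

end

section \<open>The logarithmic derivative and the residual zero\<close>

context supersingular
begin

lemma fact_nz: "k < l \<Longrightarrow> of_nat (fact k) \<noteq> (0::'a)"
  using prime_dvd_fact_iff[OF prime_l, of k] by (simp add: of_nat_eq_0 del: of_nat_fact)

text \<open>As b is nonzero, so is D(x - a) = 2b at the point, and x - a is a local parameter there;
  k! is invertible for k < l.\<close>

lemma van_imp_dvd:
  assumes "van n a b [:g:]" "n \<le> l" "b \<noteq> 0"
  shows "[:- a, 1:] ^ n dvd g"
proof (cases "g = 0")
  case False
  show ?thesis
  proof (rule ccontr)
    assume nd: "\<not> [:- a, 1:] ^ n dvd g"
    define k where "k = order a g"
    have k: "k < n" using nd False by (metis k_def order_divides not_less)
    obtain h where h: "g = [:- a, 1:] ^ k * h" "\<not> [:- a, 1:] dvd h"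
      using order_decomp[OF False, of a] k_def by blast
    have pw: "[:p:] ^ k = [:p ^ k:]" for p :: "'a poly" by (induction k) (simp_all add: one_pCons)
    have "[:g:] = [:[:- a, 1:]:] ^ k * [:h:]" unfolding h(1) pw by (simp add: mult.commute)
    moreover have "ev (D [:[:- a, 1:]:]) a b = 2 * b"
      using curve_deriv_reduced[of f "[:- a, 1:]" 0] by (simp add: pderiv_pCons)
    ultimately have "ev ((D ^^ k) [:g:]) a b = of_nat (fact k) * (2 * b) ^ k * poly h a"
      using ev_D_iter_power_mult[of "[:[:- a, 1:]:]" a b k "[:h:]"] by simp
    also have "\<dots> \<noteq> 0" using fact_nz[of k] k assms(2,3) h(2) by (simp add: poly_eq_0_iff_dvd)
    finally show False using assms(1) k by (simp add: van_def)
  qed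
qed simp

text \<open>In general D lowers the order of a zero by one, but here the missing derivative D^l p
  vanishes anyway.\<close>

lemma van_D: assumes "van l a b p" "b ^ 2 = poly f a" shows "van l a b (D p)"
  unfolding van_def
proof (intro allI impI)
  fix k assume "k < l"
  have e: "(D ^^ k) (D p) = (D ^^ Suc k) p" by (simp add: funpow_swap1)
  show "ev ((D ^^ k) (D p)) a b = 0"
  proof (cases "Suc k = l")
    case True
    thus ?thesis unfolding e using ev_cong[OF D_l_eqv_0 assms(2), of p] by simp
  next
    case False
    thus ?thesis unfolding e using assms(1) \<open>k < l\<close> by (simp add: van_def del: funpow.simps)
  qed
qed

text \<open>As l = 2q + 3, a function w0 + w1 y has pole order at most l + 1 when w0 has degree at
  most q + 2 and w1 degree at most q.\<close>

definition q where "q = (l - 3) div 2"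

lemma l_q: "l = 2 * q + 3" "q \<ge> 1"
  using odd_l l5 unfolding q_def by presburger+

lemma of_nat_q: "2 * of_nat q + 3 = (0::'a)"
proof -
  have "of_nat (2 * q + 3) = (0::'a)" unfolding l_q(1)[symmetric] using of_nat_eq_0[of l] by simp
  thus ?thesis by simp
qed

lemma linear_power_l: "[:- (a::'a), 1:] ^ l = monom 1 l + [:- (a ^ l):]"
proof -
  have "[:- a, 1:] = [:- a:] + monom 1 1" by (simp add: monom_altdef one_pCons)
  also have "\<dots> ^ l = [:- a:] ^ l + monom 1 1 ^ l"
    by (rule freshmans_dream) (simp_all add: char prime_l)
  also have "[:- a:] ^ l = [:(- a) ^ l:]" by (induction l) (simp_all add: one_pCons)
  finally show ?thesis using odd_l by (simp add: monom_power)
qed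

lemma pderiv_linear_power_l: "pderiv ([:- (a::'a), 1:] ^ l) = 0"
  using of_nat_eq_0[of l] by (simp add: linear_power_l pderiv_add pderiv_monom pderiv_pCons)

lemma coeff_f_mult: "coeff (f * w) (k + 3) = coeff w k + A * coeff w (k + 2) + B * coeff w (k + 3)"
  by (simp add: f_def numeral_3_eq_3 algebra_simps)

lemma coeff_pderiv_f_mult: "coeff (pderiv f * w) (k + 2) = 3 * coeff w k + A * coeff w (k + 2)"
  by (simp add: f_def pderiv_pCons numeral_2_eq_2 algebra_simps)

text \<open>The last two conclusions are the two components of (x - xQ) D w = (y + \<alpha> x +
  \<beta>) w for w = w0 + w1 y. R gives no pole of the quotient D w / w because D w, like w,
  vanishes there to order l. The formulas for xQ, \<alpha> and \<beta> result from comparing the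
  highest coefficients.\<close>

lemma residual_zero:
  fixes w0 w1 :: "'a poly" and a b :: 'a
  defines "b0 \<equiv> coeff w1 q" and "a1 \<equiv> coeff w0 (q + 1)"
  defines "xQ \<equiv> b0 ^ 2 - 2 * a1" and "\<alpha> \<equiv> - b0" and "\<beta> \<equiv> - 3 * coeff w1 (q - 1) + b0 * a1"
  assumes deg: "degree w0 \<le> q + 2" "coeff w0 (q + 2) = 1" "degree w1 \<le> q"
    and van: "van l a b [:w0, w1:]" and R: "b ^ 2 = poly f a" "b \<noteq> 0"
  shows "w0 ^ 2 - f * w1 ^ 2 = [:- a, 1:] ^ l * [:- xQ, 1:]" (is ?N)
    and "[:- xQ, 1:] * (2 * f * pderiv w1 + pderiv f * w1) = f * w1 + [:\<beta>, \<alpha>:] * w0" (is ?E)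
    and "[:- xQ, 1:] * (2 * pderiv w0) = w0 + [:\<beta>, \<alpha>:] * w1" (is ?F)
proof -
  define N where "N = w0 ^ 2 - f * w1 ^ 2"
  define E where "E = 2 * f * pderiv w1 + pderiv f * w1"
  define F where "F = 2 * pderiv w0"
  \<comment> \<open>u0 + u1 y is D w times the conjugate w0 - w1 y; its y-component u1 is the
    derivative of the norm N.\<close>
  define u0 where "u0 = E * w0 - f * F * w1"
  define u1 where "u1 = F * w0 - E * w1"
  define L where "L = [:- a, 1:] ^ l"
  have L_nz: "L \<noteq> 0" and degL: "degree L = l" and pL: "pderiv L = 0"
    by (simp_all add: L_def degree_linear_power pderiv_linear_power_l)
  have L': "L = monom 1 l + [:- (a ^ l):]" by (simp add: L_def linear_power_l)
  have red: "[:p0, p1:] * [:q0, q1:] \<approx> [:p0 * q0 + f * p1 * q1, p0 * q1 + p1 * q0:]" for p0 p1 q0 q1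
  proof -
    have "[:p0, p1:] * [:q0, q1:] = [:p0 * q0, p0 * q1 + p1 * q0:] + [:p1 * q1:] * (y * y)"
      by (simp add: y_def algebra_simps)
    also have "\<dots> \<approx> [:p0 * q0, p0 * q1 + p1 * q0:] + [:p1 * q1:] * [:f:]"
      by (intro eqv_add eqv_mult y_sq eqv_refl)
    finally show ?thesis by (simp add: algebra_simps)
  qed
  have Dw: "D [:w0, w1:] \<approx> [:E, F:]"
  proof -
    have "D [:w0, w1:] = [:pderiv f * w1, 2 * pderiv w0:] + [:2 * pderiv w1:] * (y * y)"
      by (simp add: curve_deriv_reduced y_def)
    also have "\<dots> \<approx> [:pderiv f * w1, 2 * pderiv w0:] + [:2 * pderiv w1:] * [:f:]"
      by (intro eqv_add eqv_mult y_sq eqv_refl)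
    finally show ?thesis by (simp add: E_def F_def algebra_simps)
  qed
  have "van (l + 0) a b ([:w0, w1:] * [:w0, - w1:])" by (intro van_mult van) simp
  moreover have "[:w0, w1:] * [:w0, - w1:] \<approx> [:N:]"
    using red[of w0 w1 w0 "- w1"] by (simp add: N_def power2_eq_square algebra_simps)
  ultimately have "van l a b [:N:]" using van_cong R by simp
  hence "L dvd N" unfolding L_def using R by (intro van_imp_dvd) auto
  then obtain h where h: "N = L * h" by (auto simp: dvd_def)
  define w0' where "w0' = w0 - monom 1 (q + 2)"
  have degw0': "degree w0' \<le> q + 1"
  proof (rule degree_le, intro allI impI)
    fix i assume "i > q + 1"
    thus "coeff w0' i = 0" using deg by (cases "i = q + 2") (auto simp: w0'_def coeff_eq_0)
  qed
  have w0: "w0 = monom 1 (q + 2) + w0'" by (simp add: w0'_def)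
  have a1: "a1 = coeff w0' (q + 1)" by (simp add: w0'_def a1_def)
  have degw1: "degree (w1 ^ 2) \<le> 2 * q" using deg(3) degree_power_le[of w1 2] by simp
  have w1sq: "coeff (w1 ^ 2) (2 * q) = b0 ^ 2"
    using coeff_mult_top[OF deg(3) deg(3)] by (simp add: power2_eq_square b0_def mult_2)
  have "monom (1::'a) (2 * q + 4) = monom 1 (q + 2) ^ 2"
    by (simp add: mult_monom eval_nat_numeral)
  hence w0sq: "w0 ^ 2 = monom 1 (2 * q + 4) + (2 * monom 1 (q + 2) * w0' + w0' ^ 2)"
    by (simp only: w0 power2_sum) (simp only: ac_simps)
  have c2: "coeff (2 * monom 1 (q + 2) * w0') (2 * q + 3) = 2 * a1"
    by (simp add: numeral_poly smult_monom a1 coeff_monom_mult mult.assoc)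
  have c3: "degree (w0' ^ 2) \<le> 2 * q + 2" using degree_power_le[of w0' 2] degw0' by simp
  have c4: "degree (2 * monom 1 (q + 2) * w0') \<le> 2 * q + 3"
    using degree_mult_le[of "monom 2 (q + 2)" w0'] degree_monom_le[of "2::'a" "q + 2"] degw0'
    by (simp add: numeral_poly smult_monom)
  have c5: "degree (f * w1 ^ 2) \<le> 2 * q + 3" using degree_mult_le[of f "w1 ^ 2"] degw1 by simp
  have cN: "coeff N (2 * q + 4) = 1" "coeff N (2 * q + 3) = - xQ" "degree N \<le> 2 * q + 4"
  proof -
    show "coeff N (2 * q + 4) = 1"
      using c3 c4 c5 by (simp add: N_def w0sq coeff_eq_0)
    have "coeff (w1 ^ 2) (2 * q + 2) = 0" "coeff (w1 ^ 2) (2 * q + 3) = 0" using degw1 by (auto intro: coeff_eq_0)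
    thus "coeff N (2 * q + 3) = - xQ"
      using c2 c3 w1sq coeff_f_mult[of "w1 ^ 2" "2 * q"] by (simp add: N_def w0sq coeff_eq_0 xQ_def)
    have "degree (w0 ^ 2) \<le> 2 * q + 4" using degree_power_le[of w0 2] deg(1) by simp
    thus "degree N \<le> 2 * q + 4" unfolding N_def using c5 by (intro degree_diff_le) auto
  qed
  have "h \<noteq> 0" using cN(1) h by auto
  hence degh: "degree h \<le> 1" using cN(3) h degL L_nz l_q by (simp add: degree_mult_eq)
  have hh: "h = [:coeff h 0, coeff h 1:]"
    by (rule poly_eqI) (use degh in \<open>auto simp: coeff_pCons coeff_eq_0 split: nat.splits\<close>)
  have "N = monom 1 l * h + smult (- (a ^ l)) h" by (simp add: h L' algebra_simps)
  hence cN': "coeff N (i + l) = coeff h i - a ^ l * coeff h (i + l)" for i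
    by (simp add: coeff_monom_mult)
  have "coeff h l = 0" "coeff h (1 + l) = 0" using degh l5 by (auto intro: coeff_eq_0)
  moreover have "2 * q + 3 = 0 + l" "2 * q + 4 = 1 + l" using l_q(1) by simp_all
  ultimately have "coeff h 0 = - xQ" "coeff h 1 = 1"
    using cN'[of 0] cN'[of 1] cN by (simp_all only: add_0 mult_zero_right diff_zero)
  hence hQ: "h = [:- xQ, 1:]" using hh by simp
  show ?N using h hQ by (simp add: N_def L_def)
  have "pderiv N = L"
    by (simp only: h hQ pderiv_mult pL) (simp add: pderiv_pCons)
  moreover have "pderiv N = u1"
    unfolding N_def u1_def E_def F_def pderiv_diff pderiv_mult power2_eq_square
    by (simp only: mult_2 mult_2_right algebra_simps)
  ultimately have u1L: "u1 = L" by simp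
  have "van (l + 0) a b (D [:w0, w1:] * [:w0, - w1:])" by (intro van_mult van_D van R) simp
  moreover have "D [:w0, w1:] * [:w0, - w1:] \<approx> [:u0, u1:]"
  proof -
    have "D [:w0, w1:] * [:w0, - w1:] \<approx> [:E, F:] * [:w0, - w1:]" by (intro eqv_mult Dw eqv_refl)
    also have "\<dots> \<approx> [:u0, u1:]"
      using red[of E F w0 "- w1"] by (simp add: u0_def u1_def algebra_simps)
    finally show ?thesis .
  qed
  ultimately have v1: "van l a b [:u0, u1:]" using van_cong R by simp
  have "van (l * 1) a b ([:[:- a, 1:]:] ^ l)" by (rule van_power) (simp add: van_def)
  hence "van (l + 0) a b ([:[:- a, 1:]:] ^ l * y)" by (intro van_mult) auto
  moreover have "[:p:] ^ k = [:p ^ k:]" for p :: "'a poly" and k by (induction k) (simp_all add: one_pCons)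
  hence "[:[:- a, 1:]:] ^ l * y = [:0, u1:]" by (simp add: u1L L_def y_def)
  ultimately have "van l a b [:0, u1:]" by simp
  from van_diff[OF v1 this] have "van l a b [:u0:]" by simp
  hence "L dvd u0" unfolding L_def using R by (intro van_imp_dvd) auto
  then obtain g where g: "u0 = L * g" by (auto simp: dvd_def)
  have "L * (h * E) = L * (f * w1 + g * w0)"
  proof -
    \<comment> \<open>Multiplying u0 + u1 y by w gives N D w; this is its component free of y, and
      the corresponding identity for F is the other one.\<close>
    have "N * E = f * w1 * u1 + w0 * u0"
      unfolding N_def u0_def u1_def power2_eq_square by (simp add: algebra_simps)
    thus ?thesis by (simp add: h u1L g algebra_simps)
  qed
  hence eE: "h * E = f * w1 + g * w0" using L_nz by simp
  have "L * (h * F) = L * (w0 + g * w1)"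
  proof -
    have "N * F = w0 * u1 + w1 * u0"
      unfolding N_def u0_def u1_def power2_eq_square by (simp add: algebra_simps)
    thus ?thesis by (simp add: h u1L g algebra_simps)
  qed
  hence eF: "h * F = w0 + g * w1" using L_nz by simp
  have degF: "degree F \<le> q + 1"
    unfolding F_def using degree_pderiv_le[of w0] deg(1) degree_smult_le[of 2 "pderiv w0"]
    by (simp add: numeral_poly)
  have degdw1: "degree (pderiv w1) \<le> q - 1" using degree_pderiv_le[of w1] deg(3) by simp
  have degpf: "degree (pderiv f) \<le> 2" by (simp add: f_def pderiv_pCons)
  have degE: "degree E \<le> q + 2"
  proof -
    have "degree (2 * f * pderiv w1) \<le> q + 2"
      using degree_mult_le[of f "pderiv w1"] degdw1 l_q(2) degree_smult_le[of 2 "f * pderiv w1"]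
      by (simp add: numeral_poly)
    moreover have "degree (pderiv f * w1) \<le> q + 2" using degree_mult_le[of "pderiv f" w1] degpf deg(3) by simp
    ultimately show ?thesis unfolding E_def by (intro degree_add_le) auto
  qed
  have "degree g \<le> 1"
  proof (cases "u0 = 0")
    case True thus ?thesis using g L_nz by simp
  next
    case False
    hence "g \<noteq> 0" using g by auto
    have "degree (E * w0) \<le> 2 * q + 4" using degree_mult_le[of E w0] degE deg(1) by simp
    moreover have "degree (f * F * w1) \<le> 2 * q + 4"
      using degree_mult_le[of "f * F" w1] degree_mult_le[of f F] degF deg(3) by simp
    ultimately have "degree u0 \<le> 2 * q + 4" unfolding u0_def by (intro degree_diff_le) auto
    thus ?thesis using g L_nz \<open>g \<noteq> 0\<close> degL l_q(1) by (simp add: degree_mult_eq)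
  qed
  hence gg: "g = [:coeff g 0, coeff g 1:]"
    by (intro poly_eqI) (auto simp: coeff_pCons coeff_eq_0 split: nat.splits)
  define g0 where "g0 = coeff g 0"
  define g1 where "g1 = coeff g 1"
  have g': "g = [:g0, g1:]" using gg by (simp add: g0_def g1_def)
  have gw0: "coeff (g * w0) (Suc i) = g0 * coeff w0 (Suc i) + g1 * coeff w0 i" for i
    by (simp add: g')
  have hE: "coeff (h * E) (Suc i) = coeff E i - xQ * coeff E (Suc i)" for i
    by (simp add: hQ)
  have z: "coeff w1 i = 0" if "i > q" for i using deg(3) that by (intro coeff_eq_0) simp
  have z0: "coeff w0 i = 0" if "i > q + 2" for i using deg(1) that by (intro coeff_eq_0) simp
  obtain r where r: "q = Suc r" using l_q(2) by (cases q) auto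
  have 2: "coeff (2 * f * p) i = 2 * coeff (f * p) i" for p i by (simp add: numeral_poly mult.assoc)
  note l0 = of_nat_q
  \<comment> \<open>The highest coefficient carries the factor 2q + 3 = l.\<close>
  have E1: "coeff E (q + 2) = 0"
  proof -
    have "coeff (2 * f * pderiv w1) (r + 3) = 2 * (of_nat q * b0)"
      unfolding 2 coeff_f_mult using z r by (simp add: coeff_pderiv b0_def)
    moreover have "coeff (pderiv f * w1) (q + 2) = 3 * b0"
      unfolding coeff_pderiv_f_mult using z by (simp add: b0_def)
    moreover have "r + 3 = q + 2" using r by simp
    ultimately have "coeff E (q + 2) = (2 * of_nat q + 3) * b0" by (simp add: E_def algebra_simps)
    thus ?thesis by (simp only: l0 mult_zero_left)
  qed
  have E2: "coeff E (q + 1) = - 2 * coeff w1 r"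
  proof -
    have "coeff (2 * f * pderiv w1) (q + 1) = 2 * (of_nat r * coeff w1 r)"
    proof (cases r)
      case 0
      have "coeff (f * pderiv w1) 2 = 0"
        using r 0 z by (simp add: f_def coeff_pderiv numeral_2_eq_2)
      thus ?thesis unfolding 2 using r 0 by (simp add: numeral_2_eq_2)
    next
      case (Suc t)
      have "coeff (f * pderiv w1) (t + 3) = of_nat r * coeff w1 r"
        unfolding coeff_f_mult using z r Suc by (simp add: coeff_pderiv)
      thus ?thesis unfolding 2 using r Suc by (simp add: numeral_3_eq_3)
    qed
    moreover have "coeff (pderiv f * w1) (r + 2) = 3 * coeff w1 r"
      unfolding coeff_pderiv_f_mult using z r by simp
    moreover have "r + 2 = q + 1" using r by simp
    ultimately have "coeff E (q + 1) = (2 * of_nat r + 3) * coeff w1 r" by (simp add: E_def algebra_simps)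
    also have "2 * of_nat r + 3 = (- 2 :: 'a)" using l0 r by (simp add: eq_neg_iff_add_eq_0 algebra_simps)
    finally show ?thesis by simp
  qed
  have g1: "g1 = \<alpha>"
  proof -
    have "coeff (h * E) (Suc (q + 2)) = 0" using hE[of "q + 2"] E1 degE by (simp add: coeff_eq_0)
    moreover have "coeff (f * w1) (q + 3) = b0" unfolding coeff_f_mult using z by (simp add: b0_def)
    moreover have "coeff (g * w0) (Suc (q + 2)) = g1" using gw0[of "q + 2"] z0 deg(2) by simp
    ultimately show ?thesis unfolding eE \<alpha>_def by (simp add: eq_neg_iff_add_eq_0 numeral_3_eq_3 add.commute)
  qed
  have g0: "g0 = \<beta>"
  proof -
    have "coeff (h * E) (Suc (q + 1)) = - 2 * coeff w1 r" using hE[of "q + 1"] E1 E2 by simp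
    moreover have "coeff (f * w1) (r + 3) = coeff w1 r" unfolding coeff_f_mult using z r by simp
    moreover have "coeff (g * w0) (Suc (q + 1)) = g0 + g1 * a1" using gw0[of "q + 1"] deg(2) by (simp add: a1_def)
    moreover have "r + 3 = Suc (q + 1)" using r by simp
    ultimately have "- 2 * coeff w1 r = coeff w1 r + (g0 + g1 * a1)" unfolding eE by simp
    hence "g0 + (a1 * g1 + 3 * coeff w1 r) = 0" by (simp add: algebra_simps)
    moreover have "g0 = (g0 + (a1 * g1 + 3 * coeff w1 r)) - 3 * coeff w1 r - g1 * a1" by (simp add: algebra_simps)
    ultimately have "g0 = - 3 * coeff w1 r - g1 * a1" by simp
    thus ?thesis unfolding g1 \<alpha>_def \<beta>_def using r by simp
  qed
  show ?E using eE g' g0 g1 hQ unfolding E_def by simp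
  show ?F using eF g' g0 g1 hQ unfolding F_def by simp
qed

end

section \<open>Uniqueness, and the coordinates of Q as functions of R\<close>

lemma poly_eq_0_alg_closed:
  fixes p :: "'a::alg_closed_field poly"
  assumes "\<And>z. poly p z = 0"
  shows "p = 0"
proof (cases "degree p = 0")
  case True
  then obtain k where "p = [:k:]" by (rule degree_eq_zeroE)
  thus ?thesis using assms[of 0] by simp
next
  case False
  hence "degree (p + 1) > 0" by (simp add: degree_add_eq_left)
  then obtain z where "poly (p + 1) z = 0" using alg_closed_imp_poly_has_root by blast
  thus ?thesis using assms[of z] by simp
qed

context supersingular
begin

text \<open>D preserves the l-fold zero and also the bound l on the pole order, because the
  coefficient of a pole of order l + 1 would carry the factor l. As D is nilpotent, induction
  reduces the claim to D d = 0, where d is a constant that vanishes at R.\<close>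

lemma unique_vanishing:
  assumes R: "b ^ 2 = poly f a" "b \<noteq> 0"
    and "van l a b [:d0, d1:]" "degree d0 \<le> q + 1" "degree d1 \<le> q"
  shows "d0 = 0 \<and> d1 = 0"
proof -
  have "d0 = 0 \<and> d1 = 0" if "(D ^^ k) [:d0, d1:] \<approx> 0" "van l a b [:d0, d1:]" "degree d0 \<le> q + 1" "degree d1 \<le> q" for k d0 d1
    using that
  proof (induction k arbitrary: d0 d1)
    case 0
    thus ?case using eqv_reduced_iff[of d0 d1 0 0] by simp
  next
    case (Suc k)
    define E where "E = pderiv f * d1 + 2 * f * pderiv d1"
    define F where "F = 2 * pderiv d0"
    have Dd: "D [:d0, d1:] \<approx> [:E, F:]"
    proof -
      have "D [:d0, d1:] = [:pderiv f * d1, 2 * pderiv d0:] + [:2 * pderiv d1:] * (y * y)"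
        by (simp add: curve_deriv_reduced y_def)
      also have "\<dots> \<approx> [:pderiv f * d1, 2 * pderiv d0:] + [:2 * pderiv d1:] * [:f:]"
        by (intro eqv_add eqv_mult y_sq eqv_refl)
      finally show ?thesis by (simp add: E_def F_def algebra_simps)
    qed
    have "(D ^^ k) [:E, F:] \<approx> (D ^^ k) (D [:d0, d1:])" by (intro eqv_D_iter eqv_sym[OF Dd])
    also have "\<dots> = (D ^^ Suc k) [:d0, d1:]" by (simp add: funpow_swap1)
    also have "\<dots> \<approx> 0" by (rule Suc.prems)
    finally have 1: "(D ^^ k) [:E, F:] \<approx> 0" .
    have 2: "van l a b [:E, F:]" using van_cong[OF Dd R(1)] van_D[OF Suc.prems(2) R(1)] by simp
    have 3: "degree F \<le> q"
      unfolding F_def using degree_pderiv_le[of d0] Suc.prems(3) degree_smult_le[of 2 "pderiv d0"]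
      by (simp add: numeral_poly)
    have z: "coeff d1 i = 0" if "i > q" for i using Suc.prems(4) that by (intro coeff_eq_0) simp
    have 4: "degree E \<le> q + 1"
    proof (rule degree_le, intro allI impI)
      fix i assume "i > q + 1"
      hence "i = q + (i - q - 2) + 2" by simp
      then obtain j where j: "i = q + j + 2" ..
      obtain r where r: "q = Suc r" using l_q(2) by (cases q) auto
      have "coeff E i = 2 * coeff (f * pderiv d1) (r + j + 3) + coeff (pderiv f * d1) (q + j + 2)"
        using r j by (simp add: E_def numeral_poly mult.assoc numeral_3_eq_3)
      also have "\<dots> = (2 * of_nat (q + j) + 3) * coeff d1 (q + j)"
        unfolding coeff_f_mult coeff_pderiv_f_mult using z r by (simp add: coeff_pderiv algebra_simps)
      also have "\<dots> = 0"
      proof (cases "j = 0")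
        case True
        thus ?thesis using of_nat_q by simp
      qed (use z in auto)
      finally show "coeff E i = 0" .
    qed
    have EF: "E = 0" "F = 0" using Suc.IH[OF 1 2 4 3] by auto
    have "pderiv d0 = 0" using EF(2) by (simp add: F_def numeral_poly)
    hence d0: "d0 = [:coeff d0 0:]" using Suc.prems(3) l_q by (intro pderiv_eq_0_const) auto
    obtain c where c: "d1 = f ^ ((l - 1) div 2) * c" using pderiv_sqrt_f_multiple[OF EF(1)[unfolded E_def]] by blast
    have d1: "d1 = 0"
    proof (rule ccontr)
      assume "d1 \<noteq> 0"
      hence "c \<noteq> 0" using c by auto
      hence "degree d1 \<ge> 3 * ((l - 1) div 2)" using c by (simp add: degree_mult_eq degree_power_eq)
      thus False using Suc.prems(4) l_q by simp
    qed
    have "ev [:d0, d1:] a b = 0" using Suc.prems(2) l5 by (auto simp: van_def dest!: spec[of _ 0])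
    hence "coeff d0 0 = 0" using d1 by (subst (asm) d0) simp
    thus ?case using d0 d1 by simp
  qed
  from this[of l] show ?thesis using assms D_l_eqv_0 by blast
qed

definition red :: "'a poly poly \<Rightarrow> 'a poly \<times> 'a poly" where
  "red p = (SOME ab. p \<approx> [:fst ab, snd ab:])"

lemma red_eqv: "p \<approx> [:fst (red p), snd (red p):]"
proof -
  obtain a b where "p \<approx> [:a, b:]" using reduced_exists by blast
  hence "p \<approx> [:fst (a, b), snd (a, b):]" by simp
  thus ?thesis unfolding red_def by (rule someI)
qed

lemma red_eqI: "p \<approx> [:a, b:] \<Longrightarrow> red p = (a, b)"
  using eqv_trans[OF eqv_sym[OF red_eqv]] eqv_reduced_iff by (metis prod.collapse)

definition r0 where "r0 i = fst (red ((D ^^ i) x))"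
definition r1 where "r1 i = snd (red ((D ^^ i) x))"

lemma X_red: "(D ^^ i) x \<approx> [:r0 i, r1 i:]"
  unfolding r0_def r1_def by (rule red_eqv)

lemma r0_r1:
  shows "odd i \<Longrightarrow> r0 i = 0" "even i \<Longrightarrow> r1 i = 0"
    and "i + 2 < 2 * k \<Longrightarrow> coeff (r0 i) k = 0" "i < 2 * k + 1 \<Longrightarrow> coeff (r1 i) k = 0"
proof -
  have "(odd i \<longrightarrow> r0 i = 0) \<and> (even i \<longrightarrow> r1 i = 0) \<and> (i + 2 < 2 * k \<longrightarrow> coeff (r0 i) k = 0) \<and>
    (i < 2 * k + 1 \<longrightarrow> coeff (r1 i) k = 0)"
    using hom_X[of i]
  proof (cases rule: homE)
    case (1 m a)
    hence "red ((D ^^ i) x) = (a, 0)" by (intro red_eqI) simp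
    moreover have "even i" using 1(1) by presburger
    ultimately show ?thesis using 1 by (auto simp: r0_def r1_def intro!: coeff_eq_0)
  next
    case (2 m b)
    hence "red ((D ^^ i) x) = (0, b)" by (intro red_eqI) simp
    moreover have "odd i" using 2(1) by presburger
    ultimately show ?thesis using 2 by (auto simp: r0_def r1_def intro!: coeff_eq_0)
  qed
  thus "odd i \<Longrightarrow> r0 i = 0" "even i \<Longrightarrow> r1 i = 0"
    "i + 2 < 2 * k \<Longrightarrow> coeff (r0 i) k = 0" "i < 2 * k + 1 \<Longrightarrow> coeff (r1 i) k = 0" by blast+
qed

lemma r1_top: "coeff (r1 (l - 2)) q = - 1"
  using hom_X_l_minus_2
proof (cases rule: homE)
  case (1 m a)
  thus ?thesis using odd_l by simp
next
  case (2 m b)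
  hence "red ((D ^^ (l - 2)) x) = (0, b)" by (intro red_eqI) simp
  hence "r1 (l - 2) = b" by (simp only: r1_def snd_conv)
  moreover have "m = q" using 2(1) l_q(1) by linarith
  ultimately show ?thesis using 2(4) by simp
qed

definition w0 where "w0 a b = monom 1 (q + 2) + (\<Sum>i<l - 1. smult (ev (T i) a b) (r0 i)) + [:ev T_end a b:]"
definition w1 where "w1 a b = (\<Sum>i<l - 1. smult (ev (T i) a b) (r1 i))"

lemma W_red: "W a b \<approx> [:w0 a b, w1 a b:]"
proof -
  have pw: "[:p:] ^ k = [:p ^ k:]" for p :: "'a poly" and k by (induction k) (simp_all add: one_pCons)
  have "(l + 1) div 2 = q + 2" using l_q(1) by simp
  moreover have "[:0, 1:] ^ k = monom (1::'a) k" for k by (simp add: monom_altdef)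
  ultimately have Y: "Y = [:monom 1 (q + 2):]" unfolding Y_def x_def pw by (simp only:)
  have s: "(\<Sum>i\<in>S. [:g i, h i:]) = [:sum g S, sum h S:]" for g h :: "nat \<Rightarrow> 'a poly" and S
    by (induction S rule: infinite_finite_induct) simp_all
  have "W a b = Y + (\<Sum>i<l - 1. [:[:ev (T i) a b:]:] * ((D ^^ i) x)) + [:[:ev T_end a b:]:]"
    by (simp add: W_def)
  also have "\<dots> \<approx> Y + (\<Sum>i<l - 1. [:[:ev (T i) a b:]:] * [:r0 i, r1 i:]) + [:[:ev T_end a b:]:]"
    by (intro eqv_add eqv_sum eqv_mult X_red eqv_refl)
  also have "\<dots> = [:w0 a b, w1 a b:]"
    by (simp add: Y w0_def w1_def s)
  finally show ?thesis .
qed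

lemma deg_w: "degree (w0 a b) \<le> q + 2" "coeff (w0 a b) (q + 2) = 1" "degree (w1 a b) \<le> q"
proof -
  have z: "coeff (r0 i) k = 0" if "i < l - 1" "k > q + 1" for i k
    using that l_q by (intro r0_r1) auto
  have z1: "coeff (r1 i) k = 0" if "i < l - 1" "k > q" for i k
    using that l_q by (intro r0_r1) auto
  show "degree (w0 a b) \<le> q + 2"
    by (rule degree_le) (auto simp: w0_def coeff_sum z coeff_pCons split: nat.splits)
  show "coeff (w0 a b) (q + 2) = 1"
    by (simp add: w0_def coeff_sum z coeff_pCons split: nat.splits)
  show "degree (w1 a b) \<le> q"
    by (rule degree_le) (auto simp: w1_def coeff_sum z1)
qed

text \<open>\<open>b0\<close>, \<open>b1\<close> and \<open>a1\<close> are the coefficients of w0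
  and w1 that enter xQ, \<alpha> and \<beta>, now as functions of R.\<close>

definition b0 where "b0 = (\<Sum>i<l - 1. smult [:coeff (r1 i) q:] (T i))"
definition b1 where "b1 = (\<Sum>i<l - 1. smult [:coeff (r1 i) (q - 1):] (T i))"
definition a1 where "a1 = (\<Sum>i<l - 1. smult [:coeff (r0 i) (q + 1):] (T i))"

lemma ev_b0: "ev b0 a b = coeff (w1 a b) q" and ev_b1: "ev b1 a b = coeff (w1 a b) (q - 1)"
  and ev_a1: "ev a1 a b = coeff (w0 a b) (q + 1)"
  by (simp_all add: b0_def b1_def a1_def w0_def w1_def coeff_sum mult.commute)

text \<open>This power of 1/\<epsilon> is the leading coefficient of \<open>b0\<close> at infinity;
  its square and cube lead the coordinates of Q.\<close>

definition C where "C = c ^ (l - 1)"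

lemma C_nz: "C \<noteq> 0" using c_nz by (simp add: C_def)

lemma hom_T_sum:
  assumes "n < l - 1" "\<And>i. even (i + n) \<or> k i = 0" "\<And>i. i < l - 1 \<Longrightarrow> i > n \<Longrightarrow> k i = 0"
  shows "hom ((2 + n) * l) (k n * (c * (- c) ^ n)) (\<Sum>i<l - 1. smult [:k i:] (T i))"
proof -
  have n1: "(2 + n) * l \<noteq> 1" using l5 by simp
  have "hom ((2 + n) * l) (if i = n then k n * (c * (- c) ^ n) else 0) (smult [:k i:] (T i))"
    if "i < l - 1" for i
  proof (cases "i = n")
    case True thus ?thesis using hom_smult[OF hom_T[OF assms(1)], of "k n"] by simp
  next
    case False
    show ?thesis
    proof (cases "k i = 0")
      case True
      thus ?thesis using False hom_0[OF n1] by simp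
    next
      case kn: False
      hence "\<not> n < i" "even (i + n)" using assms(2)[of i] assms(3)[OF that] by blast+
      hence "i < n" "even (i + n)" using False by auto
      moreover have "(2 + n) * l = (2 + i) * l + (n - i) * l" using \<open>i < n\<close> by (simp add: algebra_simps flip: add_mult_distrib)
      ultimately show ?thesis using False l5 hom_weaken[OF hom_smult[OF hom_T[OF that], of "k i"], of "(2 + n) * l"]
        by auto
    qed
  qed
  hence "hom ((2 + n) * l) (\<Sum>i<l - 1. if i = n then k n * (c * (- c) ^ n) else 0) (\<Sum>i<l - 1. smult [:k i:] (T i))"
    by (intro hom_sum n1) auto
  thus ?thesis using assms(1) by simp
qed

lemma hom_b0: "hom (l * l) C b0"
proof -
  have "hom ((2 + (l - 2)) * l) (coeff (r1 (l - 2)) q * (c * (- c) ^ (l - 2))) b0"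
    unfolding b0_def using l5 odd_l r0_r1(2) r0_r1(4)[of _ q] l_q(1)
    by (intro hom_T_sum) auto
  moreover have "c * (- c) ^ (l - 2) = - C"
  proof -
    have "odd (l - 2)" using odd_l l5 by simp
    moreover have "Suc (l - 2) = l - 1" using l5 by simp
    ultimately show ?thesis unfolding C_def by (metis mult_minus_right power_Suc power_minus_odd)
  qed
  moreover have "2 + (l - 2) = l" using l5 by simp
  ultimately show ?thesis using r1_top by (simp only: minus_mult_minus mult_1)
qed

lemma hom_b1: "\<exists>k. hom (l * l) k b1"
proof -
  have h: "hom ((2 + (l - 2)) * l) (coeff (r1 (l - 2)) (q - 1) * (c * (- c) ^ (l - 2))) b1"
    unfolding b1_def using l5 odd_l r0_r1(2) by (intro hom_T_sum) auto
  have e: "2 + (l - 2) = l" using l5 by simp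
  show ?thesis using h unfolding e by blast
qed

lemma hom_a1: "\<exists>k. hom ((l - 1) * l) k a1"
proof -
  have z: "coeff (r0 i) (q + 1) = 0" if "i < l - 1" "i > l - 3" for i
  proof -
    have "i = l - 2" using that by simp
    thus ?thesis using r0_r1(1)[of i] odd_l l5 by simp
  qed
  have h: "hom ((2 + (l - 3)) * l) (coeff (r0 (l - 3)) (q + 1) * (c * (- c) ^ (l - 3))) a1"
    unfolding a1_def
  proof (intro hom_T_sum z)
    fix i show "even (i + (l - 3)) \<or> coeff (r0 i) (q + 1) = 0"
      using odd_l l5 r0_r1(1)[of i] by (cases "odd i") auto
  qed (use l5 in auto)
  have e: "2 + (l - 3) = l - 1" using l5 by simp
  show ?thesis using h unfolding e by blast
qed

lemma D_T_sum: "D (\<Sum>i<l - 1. smult [:k i:] (T i)) \<approx> 0"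
proof -
  have "D (\<Sum>i<l - 1. smult [:k i:] (T i)) = (\<Sum>i<l - 1. [:[:k i:]:] * D (T i))"
    by (simp add: curve_deriv_sum)
  also have "\<dots> \<approx> (\<Sum>i<l - 1. [:[:k i:]:] * 0)" using D_T by (intro eqv_sum eqv_mult eqv_refl) auto
  finally show ?thesis by simp
qed

text \<open>The coordinates of \<open>Q\<close>: the coefficient of \<open>x\<^sup>l\<close> in the norm
  \<open>w\<^sub>0\<^sup>2 - f w\<^sub>1\<^sup>2 = (x\<^sup>l - a\<^sup>l)(x - x\<^sub>Q)\<close> gives \<open>x\<^sub>Q = Zt\<close>.\<close>

definition Zt where "Zt = b0 * b0 - smult [:2:] a1"
text \<open>This is the value of -(\<alpha> x + \<beta>) at x = xQ. Taking it as yQ makes y +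
  \<alpha> x + \<beta> vanish at Q, so that the pole of D w / w over xQ lies at -Q.\<close>

definition Vt where "Vt = b0 * Zt + smult [:3:] b1 - b0 * a1"

lemma D_const_mult: "D p \<approx> 0 \<Longrightarrow> D r \<approx> 0 \<Longrightarrow> D (p * r) \<approx> 0"
  using eqv_add[OF eqv_mult[of "D p" 0 r r] eqv_mult[of p p "D r" 0]] by (simp add: curve_deriv_mult)

lemma D_const_smult: "D p \<approx> 0 \<Longrightarrow> D (smult [:k:] p) \<approx> 0"
  using D_const_mult[of "[:[:k:]:]" p] by simp

lemma D_Zt: "D Zt \<approx> 0" and D_Vt: "D Vt \<approx> 0"
proof -
  have 1: "D b0 \<approx> 0" "D b1 \<approx> 0" "D a1 \<approx> 0" unfolding b0_def b1_def a1_def by (intro D_T_sum)+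
  show 2: "D Zt \<approx> 0"
    using eqv_diff[OF D_const_mult[OF 1(1) 1(1)] D_const_smult[OF 1(3), of 2]] by (simp add: Zt_def)
  show "D Vt \<approx> 0"
    using eqv_diff[OF eqv_add[OF D_const_mult[OF 1(1) 2] D_const_smult[OF 1(2), of 3]] D_const_mult[OF 1(1) 1(3)]]
    by (simp add: Vt_def)
qed

lemma hom_Zt: "hom (2 * (l * l)) (C ^ 2) Zt"
proof -
  obtain k where k: "hom ((l - 1) * l) k a1" using hom_a1 by blast
  have "2 * (l * l) = (l - 1) * l + (l + 1) * l" using l5 by (cases l) simp_all
  hence "hom (2 * (l * l)) 0 (smult [:2:] a1)" using odd_l l5 by (intro hom_weaken[OF hom_smult[OF k]]) auto
  from hom_diff[OF hom_mult[OF hom_b0 hom_b0, folded mult_2] this] show ?thesis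
    by (simp add: Zt_def power2_eq_square)
qed

lemma hom_Vt: "hom (3 * (l * l)) (C ^ 3) Vt"
proof -
  obtain k where k: "hom ((l - 1) * l) k a1" using hom_a1 by blast
  obtain k' where k': "hom (l * l) k' b1" using hom_b1 by blast
  have "3 * (l * l) = (l * l + (l - 1) * l) + (l + 1) * l" using l5 by (cases l) simp_all
  hence h1: "hom (3 * (l * l)) 0 (b0 * a1)" using odd_l l5 by (intro hom_weaken[OF hom_mult[OF hom_b0 k]]) auto
  have h2: "hom (3 * (l * l)) 0 (smult [:3:] b1)" using l5 by (intro hom_weaken[OF hom_smult[OF k']]) auto
  have "hom (l * l + 2 * (l * l)) (C * C ^ 2) (b0 * Zt)" by (intro hom_mult hom_b0 hom_Zt)
  hence h3: "hom (3 * (l * l)) (C ^ 3) (b0 * Zt)" by (simp add: power2_eq_square power3_eq_cube mult.assoc)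
  show ?thesis using hom_diff[OF hom_add[OF h3 h2] h1] by (simp add: Vt_def)
qed

text \<open>\<open>Zt\<close> is even and \<open>Vt\<close> odd in y, so that Q = (Z(a), b V(a)) for
  R = (a, b).\<close>

definition Z where "Z = fst (red Zt)"
definition V where "V = snd (red Vt)"

lemma Zt_eqv: "Zt \<approx> [:Z:]" and deg_Z: "degree Z \<le> l * l" and lead_Z: "coeff Z (l * l) = C ^ 2"
proof -
  have "Zt \<approx> [:Z:] \<and> degree Z \<le> l * l \<and> coeff Z (l * l) = C ^ 2"
    using hom_Zt
  proof (cases rule: homE)
    case (1 m a)
    hence "Z = a" using red_eqI[of Zt a 0] by (simp add: Z_def)
    thus ?thesis using 1 by auto
  next
    case (2 m b)
    hence False by presburger
    thus ?thesis ..
  qed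
  thus "Zt \<approx> [:Z:]" "degree Z \<le> l * l" "coeff Z (l * l) = C ^ 2" by auto
qed

lemma Vt_eqv: "Vt \<approx> [:0, V:]" and deg_V: "2 * degree V + 3 \<le> 3 * (l * l)"
  and lead_V: "2 * m + 3 = 3 * (l * l) \<Longrightarrow> coeff V m = - (C ^ 3)"
proof -
  have "Vt \<approx> [:0, V:] \<and> 2 * degree V + 3 \<le> 3 * (l * l) \<and> (2 * m + 3 = 3 * (l * l) \<longrightarrow> coeff V m = - (C ^ 3))"
    using hom_Vt
  proof (cases rule: homE)
    case (1 m a)
    hence "even (3 * (l * l))" by simp
    hence False using odd_l by simp
    thus ?thesis ..
  next
    case (2 m b)
    hence "V = b" using red_eqI[of Vt 0 b] by (simp add: V_def)
    thus ?thesis using 2 by auto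
  qed
  thus "Vt \<approx> [:0, V:]" "2 * degree V + 3 \<le> 3 * (l * l)" "2 * m + 3 = 3 * (l * l) \<Longrightarrow> coeff V m = - (C ^ 3)" by auto
qed

lemma pderiv_Z: "pderiv Z = 0"
proof -
  have "D [:Z, 0:] \<approx> D Zt" using eqv_D[OF eqv_sym[OF Zt_eqv]] by simp
  also have "\<dots> \<approx> [:0, 0:]" using D_Zt by simp
  finally have "[:0, 2 * pderiv Z:] \<approx> [:0, 0:]" unfolding curve_deriv_reduced by simp
  thus ?thesis unfolding eqv_reduced_iff by (simp add: numeral_poly)
qed

lemma pderiv_V: "pderiv f * V + 2 * f * pderiv V = 0"
proof -
  have "[:pderiv f * V:] + [:2 * pderiv V:] * [:f:] \<approx> [:pderiv f * V:] + [:2 * pderiv V:] * (y * y)"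
    by (intro eqv_add eqv_mult eqv_sym[OF y_sq] eqv_refl)
  also have "\<dots> = D [:0, V:]" by (simp add: curve_deriv_reduced y_def)
  also have "\<dots> \<approx> D Vt" using eqv_D[OF eqv_sym[OF Vt_eqv]] .
  also have "\<dots> \<approx> 0" by (rule D_Vt)
  finally have "[:pderiv f * V + 2 * f * pderiv V, 0:] \<approx> [:0, 0:]" by (simp add: algebra_simps)
  thus ?thesis unfolding eqv_reduced_iff by simp
qed

lemma residual_zero_W:
  fixes a b :: 'a
  defines "xQ \<equiv> poly Z a" and "yQ \<equiv> b * poly V a" and "\<alpha> \<equiv> - ev b0 a b"
  assumes R: "b ^ 2 = poly f a" "b \<noteq> 0"
  shows "w0 a b ^ 2 - f * w1 a b ^ 2 = [:- a, 1:] ^ l * [:- xQ, 1:]"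
    and "[:- xQ, 1:] * (2 * f * pderiv (w1 a b) + pderiv f * w1 a b) = f * w1 a b + [:- yQ - \<alpha> * xQ, \<alpha>:] * w0 a b"
    and "[:- xQ, 1:] * (2 * pderiv (w0 a b)) = w0 a b + [:- yQ - \<alpha> * xQ, \<alpha>:] * w1 a b"
proof -
  have "van l a b (W a b)" by (simp add: van_def W_vanishes[OF R(1)])
  hence van: "van l a b [:w0 a b, w1 a b:]" by (rule iffD1[OF van_cong[OF W_red R(1)]])
  note res = residual_zero[OF deg_w van R]
  have al: "\<alpha> = - coeff (w1 a b) q" by (simp add: \<alpha>_def ev_b0)
  have xQ: "xQ = coeff (w1 a b) q ^ 2 - 2 * coeff (w0 a b) (q + 1)"
    using ev_cong[OF Zt_eqv R(1)] by (simp add: xQ_def Zt_def ev_b0 ev_a1 power2_eq_square)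
  have "yQ = ev b0 a b * xQ + 3 * ev b1 a b - ev b0 a b * ev a1 a b"
    using ev_cong[OF Vt_eqv R(1)] ev_cong[OF Zt_eqv R(1)] by (simp add: xQ_def yQ_def Vt_def)
  hence yQ: "- yQ - \<alpha> * xQ = - 3 * coeff (w1 a b) (q - 1) + coeff (w1 a b) q * coeff (w0 a b) (q + 1)"
    by (simp add: \<alpha>_def ev_b0 ev_b1 ev_a1 algebra_simps)
  note res' = res[folded xQ yQ al]
  show "w0 a b ^ 2 - f * w1 a b ^ 2 = [:- a, 1:] ^ l * [:- xQ, 1:]" by (rule res'(1))
  show "[:- xQ, 1:] * (2 * f * pderiv (w1 a b) + pderiv f * w1 a b) = f * w1 a b + [:- yQ - \<alpha> * xQ, \<alpha>:] * w0 a b"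
    by (rule res'(2))
  show "[:- xQ, 1:] * (2 * pderiv (w0 a b)) = w0 a b + [:- yQ - \<alpha> * xQ, \<alpha>:] * w1 a b"
    by (rule res'(3))
qed

text \<open>At x = xQ the identities for the logarithmic derivative become f(xQ) p1 = yQ p0 and p0 =
  yQ p1. The factor f (Z - x) discards the points with b = 0 or xQ = a.\<close>

lemma Q_on_curve: "pcompose f Z = f * V ^ 2"
proof -
  have "poly ((pcompose f Z - f * V ^ 2) * (f * (Z - [:0, 1:]))) a = 0" for a
  proof (cases "poly f a = 0 \<or> poly Z a = a")
    case False
    obtain b where b: "b ^ 2 = poly f a" using nth_root_exists[of 2 "poly f a"] by auto
    with False have bnz: "b \<noteq> 0" by auto
    define xQ where "xQ = poly Z a"
    define yQ where "yQ = b * poly V a"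
    note res = residual_zero_W[OF b bnz, folded xQ_def yQ_def]
    define p0 where "p0 = poly (w0 a b) xQ"
    define p1 where "p1 = poly (w1 a b) xQ"
    have 1: "poly f xQ * p1 = yQ * p0" using arg_cong[OF res(2), of "\<lambda>p. poly p xQ"] by (simp add: p0_def p1_def algebra_simps)
    have 2: "p0 = yQ * p1" using arg_cong[OF res(3), of "\<lambda>p. poly p xQ"] by (simp add: p0_def p1_def algebra_simps)
    \<comment> \<open>Otherwise x - xQ divides both components of w, hence its norm twice, and xQ =
      a.\<close>
    have "p1 \<noteq> 0"
    proof
      assume "p1 = 0"
      hence "[:- xQ, 1:] dvd w0 a b" "[:- xQ, 1:] dvd w1 a b" using 2 by (auto simp: p0_def p1_def poly_eq_0_iff_dvd)
      then obtain s t where "w0 a b = [:- xQ, 1:] * s" "w1 a b = [:- xQ, 1:] * t" by (auto simp: dvd_def)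
      hence "w0 a b ^ 2 - f * w1 a b ^ 2 = [:- xQ, 1:] * ([:- xQ, 1:] * (s ^ 2 - f * t ^ 2))"
        by (simp only: power2_eq_square) (simp only: algebra_simps)
      hence "[:- xQ, 1:] * [:- a, 1:] ^ l = [:- xQ, 1:] * ([:- xQ, 1:] * (s ^ 2 - f * t ^ 2))"
        using res(1) by (simp only: mult.commute)
      hence "[:- a, 1:] ^ l = [:- xQ, 1:] * (s ^ 2 - f * t ^ 2)" by (subst (asm) mult_left_cancel) auto
      from arg_cong[OF this, of "\<lambda>p. poly p xQ"] have "(xQ - a) ^ l = 0" by simp
      thus False using False xQ_def by simp
    qed
    hence "poly f xQ = yQ ^ 2" using 1 2 by (simp add: power2_eq_square)
    thus ?thesis by (simp add: poly_pcompose xQ_def yQ_def power_mult_distrib b)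
  qed auto
  hence "(pcompose f Z - f * V ^ 2) * (f * (Z - [:0, 1:])) = 0" by (rule poly_eq_0_alg_closed)
  moreover have "Z \<noteq> [:0, 1:]"
  proof
    assume "Z = [:0, 1:]"
    moreover have "l * l > 1" using l5 mult_le_mono[of 2 l 2 l] by simp
    ultimately have "coeff Z (l * l) = 0" by (simp add: coeff_eq_0)
    thus False using lead_Z C_nz by simp
  qed
  ultimately show ?thesis by simp
qed

end

section \<open>The explicit form of multiplication by l\<close>

lemma cube_sum: "(a + b) ^ 3 = a ^ 3 + 3 * a ^ 2 * b + 3 * a * b ^ 2 + (b ^ 3 :: 'a::comm_ring_1)"
  by (simp add: power2_eq_square power3_eq_cube algebra_simps)

context supersingular
begin

lemma frobenius_add: "(p + r) ^ l = p ^ l + (r ^ l :: 'a poly)"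
  by (rule freshmans_dream) (simp_all add: char prime_l)

lemma frobenius_add_field: "(s + t) ^ l = s ^ l + (t ^ l :: 'a)"
  by (rule freshmans_dream) (simp_all add: char prime_l)

lemma frobenius_inj: "p ^ l = r ^ l \<Longrightarrow> p = (r :: 'a poly)"
proof -
  assume "p ^ l = r ^ l"
  moreover have "p ^ l = (p - r) ^ l + r ^ l" using frobenius_add[of "p - r" r] by simp
  ultimately have "(p - r) ^ l = 0" by simp
  thus ?thesis by simp
qed

lemma of_nat_power_l: "(of_nat n :: 'a) ^ l = of_nat n"
  using l5 by (induction n) (simp_all add: frobenius_add_field)

lemma root_l_exists: "\<exists>t::'a. t ^ l = s"
  using nth_root_exists[of l s] l5 by auto

text \<open>Only exponents divisible by l occur, and the coefficients have l-th roots.\<close>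

lemma pderiv_0_imp_power_l:
  assumes "pderiv p = (0 :: 'a poly)"
  shows "\<exists>r. p = r ^ l"
proof -
  obtain rt where rt: "rt s ^ l = (s::'a)" for s using root_l_exists by metis
  define r where "r = (\<Sum>i\<le>degree p. monom (rt (coeff p (l * i))) i)"
  have "r ^ l = (\<Sum>i\<le>degree p. monom (rt (coeff p (l * i))) i ^ l)"
    unfolding r_def by (rule freshmans_dream_sum) (simp_all add: char prime_l)
  also have "\<dots> = (\<Sum>i\<le>degree p. monom (coeff p (l * i)) (l * i))"
    by (simp add: monom_power rt mult.commute)
  finally have r: "r ^ l = (\<Sum>i\<le>degree p. monom (coeff p (l * i)) (l * i))" .
  have "p = r ^ l"
  proof (rule poly_eqI)
    fix n
    have "coeff (r ^ l) n = (\<Sum>i\<le>degree p. if l * i = n then coeff p n else 0)"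
      unfolding r coeff_sum by (intro sum.cong) auto
    also have "\<dots> = coeff p n"
    proof (cases "l dvd n")
      case True
      then obtain k where k: "n = l * k" by auto
      hence e: "(if l * i = n then coeff p n else 0) = (if i = k then coeff p n else 0)" for i using l5 by auto
      show ?thesis
      proof (cases "k \<le> degree p")
        case False
        hence "n > degree p" using k l5 by (metis le_less_trans less_le_trans mult_le_mono1 nat_mult_1 not_le one_le_numeral order_trans not_less)
        thus ?thesis using False by (simp add: e coeff_eq_0)
      qed (simp add: e)
    next
      case False
      hence "coeff p n = 0"
      proof (cases n)
        case (Suc m)
        have "of_nat (Suc m) * coeff p (Suc m) = 0" using assms by (metis coeff_pderiv coeff_0)
        thus ?thesis using False Suc of_nat_eq_0[of "Suc m"] by auto
      qed simp
      thus ?thesis by (simp cong: if_cong)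
    qed
    finally show "coeff p n = coeff (r ^ l) n" ..
  qed
  thus ?thesis by blast
qed

lemma degree_Z: "degree Z = l * l"
  using deg_Z lead_Z C_nz by (metis le_antisym le_degree zero_neq_one power_not_zero)

lemma pcompose_f: "pcompose f p = p ^ 3 + smult A p + [:B:]"
  by (simp add: f_def pcompose_pCons power3_eq_cube algebra_simps)

lemma V_nz: "V \<noteq> 0"
proof
  assume "V = 0"
  hence "pcompose f Z = 0" using Q_on_curve by simp
  moreover have "degree (pcompose f Z) = 3 * (l * l)" by (simp add: degree_pcompose degree_Z)
  ultimately show False using l5 by simp
qed

lemma degree_V: "2 * degree V + 3 = 3 * (l * l)"
proof -
  have "degree (f * V ^ 2) = 3 + 2 * degree V" using V_nz by (simp add: degree_mult_eq degree_power_eq)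
  moreover have "degree (pcompose f Z) = 3 * (l * l)" by (simp add: degree_pcompose degree_Z)
  ultimately show ?thesis using Q_on_curve by simp
qed

text \<open>Taking \<open>l\<close>-th roots in \<open>f(Z) = f V\<^sup>2\<close> gives \<open>g(\<zeta>) = f \<xi>\<^sup>2\<close> with \<open>Z = \<zeta>\<^sup>l\<close> and a separable cubic \<open>g\<close>.
  Then \<open>\<xi>\<close> divides \<open>\<zeta>'\<close> but has larger degree, so \<open>\<zeta>' = 0\<close>.\<close>

lemma Z_V_explicit:
  shows "\<exists>z. Z = monom (C ^ 2) (l * l) + [:z:]" and "V = smult (- (C ^ 3)) (f ^ ((l * l - 1) div 2))"
proof -
  define m where "m = (l - 1) div 2"
  have m: "l = 2 * m + 1" unfolding m_def using odd_l by presburger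
  obtain v where v: "V = f ^ m * v" "pderiv v = 0"
    using pderiv_sqrt_f_multiple[OF pderiv_V] unfolding m_def by blast
  obtain \<xi> where xi: "v = \<xi> ^ l" using pderiv_0_imp_power_l[OF v(2)] by blast
  obtain \<zeta> where ze: "Z = \<zeta> ^ l" using pderiv_0_imp_power_l[OF pderiv_Z] by blast
  obtain \<alpha> where al: "\<alpha> ^ l = A" using root_l_exists by blast
  obtain \<beta> where be: "\<beta> ^ l = B" using root_l_exists by blast
  have "(\<zeta> ^ 3 + smult \<alpha> \<zeta> + [:\<beta>:]) ^ l = (\<zeta> ^ 3) ^ l + smult \<alpha> \<zeta> ^ l + [:\<beta>:] ^ l"
    by (simp only: frobenius_add)
  also have "[:\<beta>:] ^ l = [:\<beta> ^ l:]" by (induction l) (simp_all add: one_pCons)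
  also have "(\<zeta> ^ 3) ^ l = Z ^ 3" by (simp only: ze power_mult[symmetric] mult.commute)
  also have "smult \<alpha> \<zeta> ^ l = smult A Z" by (simp add: smult_power ze al)
  finally have "(\<zeta> ^ 3 + smult \<alpha> \<zeta> + [:\<beta>:]) ^ l = f * V ^ 2"
    using Q_on_curve by (simp add: pcompose_f be)
  also have "\<dots> = (f * \<xi> ^ 2) ^ l"
  proof -
    have "f * V ^ 2 = (f * (f ^ m) ^ 2) * (\<xi> ^ l) ^ 2" by (simp add: v(1) xi power_mult_distrib algebra_simps)
    also have "f * (f ^ m) ^ 2 = f ^ l" unfolding m by (simp add: power_mult[symmetric] mult.commute)
    finally show ?thesis by (simp add: power_mult_distrib power_mult[symmetric] mult.commute)
  qed
  finally have g: "\<zeta> ^ 3 + smult \<alpha> \<zeta> + [:\<beta>:] = f * \<xi> ^ 2" by (rule frobenius_inj)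
  have \<zeta>nz: "\<zeta> \<noteq> 0" using degree_Z ze l5 by (auto simp: zero_power)
  have deg_ze: "degree \<zeta> = l"
    using degree_Z ze l5 \<zeta>nz by (simp add: degree_power_eq)
  have xi_nz: "\<xi> \<noteq> 0" using V_nz v(1) xi l5 by auto
  have vnz: "v \<noteq> 0" using V_nz v(1) by auto
  have deg_xi: "degree \<xi> = 3 * m"
  proof -
    have "degree V = 3 * m + l * degree \<xi>"
      using xi_nz by (simp add: v(1) xi degree_mult_eq degree_power_eq)
    hence "2 * (3 * m) + 2 * (l * degree \<xi>) + 3 = 3 * (l * l)" using degree_V by simp
    hence "l * (2 * degree \<xi> + 3) = l * (3 * l)" using m by (simp add: algebra_simps)
    hence "2 * degree \<xi> + 3 = 3 * l" using l5 by simp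
    thus ?thesis using m by simp
  qed
  have "pderiv \<zeta> = 0"
  proof (rule ccontr)
    assume nz: "pderiv \<zeta> \<noteq> 0"
    define g' where "g' = 3 * \<zeta> ^ 2 + [:\<alpha>:]"
    have "pderiv (\<zeta> ^ 3 + smult \<alpha> \<zeta> + [:\<beta>:]) = g' * pderiv \<zeta>"
      by (simp add: g'_def power3_eq_cube power2_eq_square pderiv_add pderiv_mult pderiv_smult pderiv_pCons algebra_simps)
    moreover have "pderiv (f * \<xi> ^ 2) = \<xi> * (pderiv f * \<xi> + 2 * f * pderiv \<xi>)"
      by (simp add: power2_eq_square pderiv_mult algebra_simps)
    ultimately have e1: "g' * pderiv \<zeta> = \<xi> * (pderiv f * \<xi> + 2 * f * pderiv \<xi>)" using g by simp
    define dd where "dd = 4 * \<alpha> ^ 3 + 27 * \<beta> ^ 2"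
    have "dd ^ l = 4 * A ^ 3 + 27 * B ^ 2"
    proof -
      have "dd ^ l = 4 ^ l * (\<alpha> ^ l) ^ 3 + 27 ^ l * (\<beta> ^ l) ^ 2"
        by (simp add: dd_def frobenius_add_field power_mult_distrib power_mult[symmetric] mult.commute)
      thus ?thesis using of_nat_power_l[of 4] of_nat_power_l[of 27] by (simp add: al be)
    qed
    hence ddnz: "dd \<noteq> 0" using disc l5 by (auto simp: zero_power)
    \<comment> \<open>The Bezout cofactors of \<open>f_dvd_pderiv_mult\<close> for the cubic with
      coefficients \<alpha> and \<beta>, evaluated at \<zeta>.\<close>
    define s where "s = [:27 * \<beta>:] - smult (18 * \<alpha>) \<zeta>"
    define t where "t = [:4 * \<alpha> ^ 2:] - smult (9 * \<beta>) \<zeta> + smult (6 * \<alpha>) (\<zeta> ^ 2)"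
    have bez: "[:dd:] = s * (\<zeta> ^ 3 + smult \<alpha> \<zeta> + [:\<beta>:]) + t * g'"
    proof -
      have dd1: "[:dd:] = [:27 * \<beta>, - 18 * \<alpha>:] * [:\<beta>, \<alpha>, 0, 1:] + [:4 * \<alpha> ^ 2, - 9 * \<beta>, 6 * \<alpha>:] * [:\<alpha>, 0, 3:]"
        by (simp add: dd_def power2_eq_square power3_eq_cube algebra_simps)
      have "[:dd:] = pcompose [:dd:] \<zeta>" by simp
      also have "\<dots> = s * (\<zeta> ^ 3 + smult \<alpha> \<zeta> + [:\<beta>:]) + t * g'"
      proof -
        have 1: "pcompose [:27 * \<beta>, - 18 * \<alpha>:] \<zeta> = s" by (simp add: s_def pcompose_pCons)
        have 2: "pcompose [:\<beta>, \<alpha>, 0, 1:] \<zeta> = \<zeta> ^ 3 + smult \<alpha> \<zeta> + [:\<beta>:]"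
          by (simp add: pcompose_pCons power3_eq_cube algebra_simps)
        have 3: "pcompose [:4 * \<alpha> ^ 2, - 9 * \<beta>, 6 * \<alpha>:] \<zeta> = t"
          by (simp add: t_def pcompose_pCons power2_eq_square algebra_simps)
        have 4: "pcompose [:\<alpha>, 0, 3:] \<zeta> = g'"
          by (simp add: g'_def pcompose_pCons power2_eq_square numeral_poly algebra_simps)
        show ?thesis unfolding dd1 pcompose_add pcompose_mult 1 2 3 4 ..
      qed
      finally show ?thesis .
    qed
    have "smult dd (pderiv \<zeta>) = [:dd:] * pderiv \<zeta>" by simp
    also have "\<dots> = s * (f * \<xi> ^ 2) * pderiv \<zeta> + t * (g' * pderiv \<zeta>)"
      unfolding bez g by (simp only: distrib_right mult.assoc)
    also have "\<dots> = \<xi> * (s * f * \<xi> * pderiv \<zeta> + t * (pderiv f * \<xi> + 2 * f * pderiv \<xi>))"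
      unfolding e1 by (simp only: power2_eq_square distrib_left ac_simps)
    finally have "\<xi> dvd smult dd (pderiv \<zeta>)" by (metis dvd_triv_left)
    hence "\<xi> dvd pderiv \<zeta>" using ddnz dvd_smult_cancel by blast
    hence "degree \<xi> \<le> degree (pderiv \<zeta>)" using nz by (intro dvd_imp_degree_le)
    also have "\<dots> \<le> l - 1" using degree_pderiv_le[of \<zeta>] deg_ze by simp
    finally show False using deg_xi m l5 by simp
  qed
  then obtain \<rho> where rho: "\<zeta> = \<rho> ^ l" using pderiv_0_imp_power_l by blast
  have rnz: "\<rho> \<noteq> 0" using \<zeta>nz rho l5 by auto
  have "degree \<rho> = 1" using deg_ze rho l5 rnz by (simp add: degree_power_eq)
  then obtain r0 r1 where r: "\<rho> = [:r0, r1:]" by (metis degree1_coeffs)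
  have "\<rho> = monom r1 1 + [:r0:]" using r by (simp add: monom_altdef)
  hence "\<zeta> = monom (r1 ^ l) l + [:r0 ^ l:]"
    using rho frobenius_add[of "monom r1 1" "[:r0:]"] by (simp add: monom_power poly_const_pow)
  hence "Z = monom ((r1 ^ l) ^ l) (l * l) + [:(r0 ^ l) ^ l:]"
    using ze frobenius_add[of "monom (r1 ^ l) l" "[:r0 ^ l:]"] by (simp add: monom_power poly_const_pow)
  moreover from this have "coeff Z (l * l) = (r1 ^ l) ^ l" using l5 by (simp add: coeff_pCons split: nat.splits)
  ultimately have "Z = monom (C ^ 2) (l * l) + [:(r0 ^ l) ^ l:]" using lead_Z by simp
  thus "\<exists>z. Z = monom (C ^ 2) (l * l) + [:z:]" ..
  \<comment> \<open>Because of this, y \<xi> is a D-constant too; so f^m divides \<xi>, and the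
    degrees leave only a constant cofactor.\<close>
  have "pderiv \<zeta> = 0" using rho by (simp add: pderiv_power of_nat_CHAR of_nat_poly) (use of_nat_eq_0[of l] in simp)
  hence "pderiv (f * \<xi> ^ 2) = 0"
    unfolding g[symmetric] by (simp add: power3_eq_cube pderiv_add pderiv_mult pderiv_smult pderiv_pCons)
  moreover have "pderiv (f * \<xi> ^ 2) = \<xi> * (pderiv f * \<xi> + 2 * f * pderiv \<xi>)"
    by (simp add: power2_eq_square pderiv_mult algebra_simps)
  ultimately have "pderiv f * \<xi> + 2 * f * pderiv \<xi> = 0" using xi_nz by simp
  then obtain k where k: "\<xi> = f ^ m * k" using pderiv_sqrt_f_multiple unfolding m_def by blast
  hence "k \<noteq> 0" using xi_nz by auto
  hence "degree k = 0" using deg_xi k by (simp add: degree_mult_eq degree_power_eq)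
  then obtain k0 where k0: "k = [:k0:]" by (rule degree_eq_zeroE)
  have mm: "(l * l - 1) div 2 = m + m * l" unfolding m by (simp add: algebra_simps)
  have "V = f ^ m * (f ^ m * [:k0:]) ^ l" by (simp add: v(1) xi k k0)
  also have "\<dots> = f ^ (m + m * l) * [:k0 ^ l:]"
    by (simp add: power_mult_distrib power_add power_mult poly_const_pow smult_power)
  finally have V: "V = smult (k0 ^ l) (f ^ ((l * l - 1) div 2))" unfolding mm by simp
  have "2 * (3 * ((l * l - 1) div 2)) + 3 = 3 * (l * l)" unfolding mm using m by (simp add: algebra_simps)
  hence "coeff V (3 * ((l * l - 1) div 2)) = - (C ^ 3)" by (rule lead_V)
  moreover have "coeff V (3 * ((l * l - 1) div 2)) = k0 ^ l * lead_coeff (f ^ ((l * l - 1) div 2))"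
    by (simp add: V degree_power_eq mult.commute)
  moreover have "lead_coeff f = 1" by simp
  hence "lead_coeff (f ^ ((l * l - 1) div 2)) = 1" by (simp only: lead_coeff_power power_one)
  ultimately show "V = smult (- (C ^ 3)) (f ^ ((l * l - 1) div 2))" using V by simp
qed

text \<open>Both sides of f(Z) = f V^2 are cubic polynomials in x^(l^2). The right-hand side C^6
  f^(l^2) has no quadratic term, which forces z = 0; the other coefficients give the relations for A
  and B.\<close>

lemma frobenius_scaling:
  shows "Z = monom (C ^ 2) (l * l)" and "A = C ^ 4 * A ^ (l * l)" and "B = C ^ 6 * B ^ (l * l)"
proof -
  obtain z where z: "Z = monom (C ^ 2) (l * l) + [:z:]" using Z_V_explicit(1) by blast
  define L where "L = l * l"
  have L: "L > 0" "odd L" using l5 odd_l by (auto simp: L_def)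
  have "f * V ^ 2 = smult (C ^ 6) (f ^ L)"
  proof -
    have "L = Suc (2 * ((L - 1) div 2))" using L by presburger
    hence "f ^ L = f * (f ^ ((L - 1) div 2)) ^ 2" by (metis power_Suc power_mult mult.commute)
    thus ?thesis unfolding Z_V_explicit(2) L_def[symmetric] by (simp add: smult_power power_mult[symmetric])
  qed
  also have "f ^ L = monom 1 (3 * L) + (monom (A ^ L) L + [:B ^ L:])"
  proof -
    have "f = monom 1 3 + (monom A 1 + [:B:])" by (simp add: f_def monom_altdef numeral_3_eq_3)
    hence "f ^ L = (monom 1 3 + (monom A 1 + [:B:])) ^ l ^ 2" by (simp add: L_def power2_eq_square)
    also have "\<dots> = monom 1 3 ^ L + (monom A 1 ^ L + [:B:] ^ L)"
      using freshmans_dream'[of "l ^ 2" 2 "monom 1 3 :: 'a poly" "monom A 1 + [:B:]"]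
        freshmans_dream'[of "l ^ 2" 2 "monom A 1" "[:B:]"]
      by (simp add: char prime_l L_def power2_eq_square)
    finally show ?thesis by (simp add: monom_power poly_const_pow)
  qed
  finally have fV: "pcompose f Z = smult (C ^ 6) (monom 1 (3 * L) + (monom (A ^ L) L + [:B ^ L:]))"
    using Q_on_curve by simp
  have "monom (C ^ 2) L ^ 2 = monom (C ^ 4) (2 * L)" "monom (C ^ 2) L ^ 3 = monom (C ^ 6) (3 * L)"
    by (simp_all add: monom_power power_mult[symmetric] mult.commute)
  hence "pcompose f Z = monom (C ^ 6) (3 * L) + 3 * (monom (C ^ 4) (2 * L)) * [:z:]
      + 3 * (monom (C ^ 2) L) * [:z:] ^ 2 + [:z:] ^ 3 + smult A (monom (C ^ 2) L) + [:A * z:] + [:B:]"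
    unfolding pcompose_f z L_def[symmetric] cube_sum smult_add_right by (simp add: add.assoc mult.assoc)
  also have "\<dots> = monom (C ^ 6) (3 * L) + monom (3 * C ^ 4 * z) (2 * L) + monom (3 * C ^ 2 * z ^ 2 + A * C ^ 2) L + [:z ^ 3 + A * z + B:]"
    by (simp add: poly_const_pow numeral_poly smult_monom mult_ac add_monom[symmetric])
  finally have pf: "pcompose f Z = monom (C ^ 6) (3 * L) + monom (3 * C ^ 4 * z) (2 * L) + monom (3 * C ^ 2 * z ^ 2 + A * C ^ 2) L + [:z ^ 3 + A * z + B:]" .
  note eq = trans[OF pf[symmetric] fV]
  have "3 * C ^ 4 * z = 0" using arg_cong[OF eq, of "\<lambda>p. coeff p (2 * L)"] L by (simp add: coeff_pCons split: nat.splits)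
  hence z0: "z = 0" using C_nz by simp
  show "Z = monom (C ^ 2) (l * l)" using z z0 by simp
  have "A * C ^ 2 = C ^ 6 * A ^ L" using arg_cong[OF eq, of "\<lambda>p. coeff p L"] L z0 by (simp add: coeff_pCons split: nat.splits)
  moreover have "C ^ 6 = C ^ 2 * C ^ 4" by (simp flip: power_add)
  ultimately have "C ^ 2 * A = C ^ 2 * (C ^ 4 * A ^ L)" by (simp only: mult_ac)
  thus "A = C ^ 4 * A ^ (l * l)" using C_nz unfolding L_def by (metis mult_left_cancel power_not_zero)
  show "B = C ^ 6 * B ^ (l * l)" using arg_cong[OF eq, of "\<lambda>p. coeff p 0"] L z0 by (simp add: L_def)
qed

text \<open>If \<open>w = w\<^sub>0 + w\<^sub>1 y\<close> has divisor \<open>l(R) + (-Q) - (l+1)O\<close> with \<open>R = (a, b)\<close>, then \<open>Q\<close>, which is \<open>[l]R\<close>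
  in the group law, is the image of \<open>R\<close> under the \<open>l\<^sup>2\<close>-Frobenius up to an isomorphism. The last clause covers the
  case in which \<open>w\<close> also vanishes at \<open>Q\<close>.\<close>

theorem multiplication_by_l:
  fixes a b :: 'a and p0 p1 :: "'a poly"
  defines "xQ \<equiv> C ^ 2 * a ^ (l * l)" and "yQ \<equiv> - (C ^ 3 * b ^ (l * l))"
  assumes R: "b ^ 2 = poly f a" "b \<noteq> 0"
    and deg: "degree p0 \<le> q + 2" "coeff p0 (q + 2) = 1" "degree p1 \<le> q"
    and van: "van l a b [:p0, p1:]"
  shows "p0 ^ 2 - f * p1 ^ 2 = [:- a, 1:] ^ l * [:- xQ, 1:]"
    and "poly p0 xQ = yQ * poly p1 xQ"
    and "\<And>s0 s1. p0 = [:- xQ, 1:] * s0 \<Longrightarrow> p1 = [:- xQ, 1:] * s1 \<Longrightarrow> poly s0 xQ + yQ * poly s1 xQ = 0"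
proof -
  have "van l a b (W a b)" by (simp add: van_def W_vanishes[OF R(1)])
  hence "van l a b [:w0 a b, w1 a b:]" by (rule iffD1[OF van_cong[OF W_red R(1)]])
  from van_diff[OF van this] have v: "van l a b [:p0 - w0 a b, p1 - w1 a b:]" by simp
  have "degree (p0 - w0 a b) \<le> q + 1"
  proof (rule degree_le, intro allI impI)
    fix i assume "q + 1 < i"
    thus "coeff (p0 - w0 a b) i = 0"
      using deg deg_w[of a b] by (cases "i = q + 2") (auto simp: coeff_eq_0)
  qed
  moreover have "degree (p1 - w1 a b) \<le> q" using deg deg_w by (intro degree_diff_le) auto
  ultimately have "p0 - w0 a b = 0 \<and> p1 - w1 a b = 0" using unique_vanishing[OF R v] by blast
  hence p: "w0 a b = p0" "w1 a b = p1" by auto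
  have xQ: "poly Z a = xQ" unfolding frobenius_scaling(1) xQ_def by (simp add: poly_monom)
  have "odd (l * l)" using odd_l by simp
  hence "l * l = Suc (2 * ((l * l - 1) div 2))" by presburger
  hence "b ^ (l * l) = b * (b ^ 2) ^ ((l * l - 1) div 2)" by (metis power_Suc power_mult)
  hence yQ: "b * poly V a = yQ" unfolding Z_V_explicit(2) yQ_def by (simp add: R(1))
  define \<alpha> where "\<alpha> = - ev b0 a b"
  note res = residual_zero_W[OF R, folded \<alpha>_def, unfolded p xQ yQ]
  show "p0 ^ 2 - f * p1 ^ 2 = [:- a, 1:] ^ l * [:- xQ, 1:]" by (rule res(1))
  show "poly p0 xQ = yQ * poly p1 xQ"
    using arg_cong[OF res(3), of "\<lambda>p. poly p xQ"] by (simp add: algebra_simps)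
  fix s0 s1 assume s: "p0 = [:- xQ, 1:] * s0" "p1 = [:- xQ, 1:] * s1"
  have "[:- xQ, 1:] * (2 * (s0 + [:- xQ, 1:] * pderiv s0)) = [:- xQ, 1:] * (s0 + [:- yQ - \<alpha> * xQ, \<alpha>:] * s1)"
  proof -
    have "pderiv p0 = s0 + [:- xQ, 1:] * pderiv s0"
      unfolding s(1) pderiv_mult by (simp add: pderiv_pCons)
    hence "[:- xQ, 1:] * (2 * (s0 + [:- xQ, 1:] * pderiv s0)) = p0 + [:- yQ - \<alpha> * xQ, \<alpha>:] * p1"
      using res(3) by simp
    also have "\<dots> = [:- xQ, 1:] * (s0 + [:- yQ - \<alpha> * xQ, \<alpha>:] * s1)"
      unfolding s by (simp only: distrib_left ac_simps)
    finally show ?thesis .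
  qed
  hence "2 * (s0 + [:- xQ, 1:] * pderiv s0) = s0 + [:- yQ - \<alpha> * xQ, \<alpha>:] * s1"
    by (subst (asm) mult_left_cancel) auto
  from arg_cong[OF this, of "\<lambda>p. poly p xQ"] show "poly s0 xQ + yQ * poly s1 xQ = 0"
    by (simp add: algebra_simps)
qed

end

section \<open>The constant C when the curve is isomorphic to its Frobenius twist\<close>

context supersingular
begin

text \<open>Frobenius on the coefficients followed by x -> r x. It is a ring endomorphism of K[x],
  and with r = 1/s^2 it maps f to a multiple of itself if s scales the twisted curve to the
  curve.\<close>

definition frob_scale :: "'a \<Rightarrow> 'a poly \<Rightarrow> 'a poly" where
  "frob_scale r g = pcompose (map_poly (\<lambda>t. t ^ l) g) [:0, r:]"

lemma map_frob_add: "map_poly (\<lambda>t. t ^ l) (g + h) = map_poly (\<lambda>t. t ^ l) g + map_poly (\<lambda>t. t ^ l) (h :: 'a poly)"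
  using l5 by (intro poly_eqI) (simp add: coeff_map_poly frobenius_add_field zero_power)

lemma map_frob_mult: "map_poly (\<lambda>t. t ^ l) (g * h) = map_poly (\<lambda>t. t ^ l) g * map_poly (\<lambda>t. t ^ l) (h :: 'a poly)"
proof (rule poly_eqI)
  fix n
  have "coeff (map_poly (\<lambda>t. t ^ l) (g * h)) n = (\<Sum>i\<le>n. coeff g i * coeff h (n - i)) ^ l"
    using l5 by (simp add: coeff_map_poly coeff_mult zero_power)
  also have "\<dots> = (\<Sum>i\<le>n. (coeff g i * coeff h (n - i)) ^ l)"
    by (rule freshmans_dream_sum) (simp_all add: char prime_l)
  also have "\<dots> = coeff (map_poly (\<lambda>t. t ^ l) g * map_poly (\<lambda>t. t ^ l) h) n"
    using l5 by (simp add: coeff_map_poly coeff_mult zero_power power_mult_distrib)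
  finally show "coeff (map_poly (\<lambda>t. t ^ l) (g * h)) n = coeff (map_poly (\<lambda>t. t ^ l) g * map_poly (\<lambda>t. t ^ l) h) n" .
qed

lemma frob_scale_add: "frob_scale r (g + h) = frob_scale r g + frob_scale r h"
  by (simp add: frob_scale_def map_frob_add pcompose_add)

lemma frob_scale_mult: "frob_scale r (g * h) = frob_scale r g * frob_scale r h"
  by (simp add: frob_scale_def map_frob_mult pcompose_mult)

lemma frob_scale_const: "frob_scale r [:k:] = [:k ^ l:]"
proof -
  have "map_poly (\<lambda>t. t ^ l) [:k:] = [:k ^ l:]"
    using l5 by (intro poly_eqI) (simp add: coeff_map_poly coeff_pCons zero_power split: nat.splits)
  thus ?thesis by (simp add: frob_scale_def)
qed

lemma coeff_pcompose_linear: "coeff (pcompose g [:0, r:]) n = r ^ n * coeff (g :: 'a poly) n"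
proof (induction g arbitrary: n)
  case (pCons a g)
  show ?case by (cases n) (simp_all add: pcompose_pCons pCons.IH coeff_pCons algebra_simps)
qed simp

lemma pderiv_frob_scale: "pderiv (frob_scale r g) = smult r (frob_scale r (pderiv g))"
proof (rule poly_eqI)
  fix n
  show "coeff (pderiv (frob_scale r g)) n = coeff (smult r (frob_scale r (pderiv g))) n"
    using l5 of_nat_power_l[of "Suc n"]
    by (simp add: frob_scale_def coeff_pderiv coeff_pcompose_linear coeff_map_poly zero_power power_mult_distrib del: of_nat_Suc)
qed

lemma frob_scale_f:
  assumes "s \<noteq> 0" "A = s ^ 4 * A ^ l" "B = s ^ 6 * B ^ l"
  shows "frob_scale (1 / s ^ 2) f = smult (1 / s ^ 6) f"
proof (rule poly_eqI)
  fix n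
  have A: "A ^ l = A / s ^ 4" and B: "B ^ l = B / s ^ 6"
    using assms by (metis nonzero_mult_div_cancel_left power_not_zero)+
  have "coeff (map_poly (\<lambda>t. t ^ l) f) n = coeff f n ^ l" using l5 by (simp add: coeff_map_poly zero_power)
  moreover have "(1 / s ^ 2) ^ n * coeff f n ^ l = 1 / s ^ 6 * coeff f n"
  proof -
    consider "n = 0" | "n = 1" | "n = 2" | "n = 3" | "n > 3" by linarith
    thus ?thesis
    proof cases
      case 1 thus ?thesis using assms(1) by (simp add: f_def B)
    next
      case 2 thus ?thesis using assms(1) by (simp add: f_def A flip: power_add)
    next
      case 3 thus ?thesis using l5 by (simp add: f_def numeral_2_eq_2 zero_power)
    next
      case 4 thus ?thesis using assms(1) by (simp add: power_divide flip: power_mult)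
    next
      case 5 thus ?thesis using l5 by (simp add: coeff_eq_0 zero_power)
    qed
  qed
  ultimately show "coeff (frob_scale (1 / s ^ 2) f) n = coeff (smult (1 / s ^ 6) f) n"
    by (simp add: frob_scale_def coeff_pcompose_linear)
qed

text \<open>The square of D on functions of x alone; unlike D it stays within K[x].\<close>

definition D2 :: "'a poly \<Rightarrow> 'a poly" where
  "D2 g = smult 2 (pderiv f * pderiv g) + smult 4 (f * pderiv (pderiv g))"

lemma D_D: "D (D [:g:]) \<approx> [:D2 g:]"
proof -
  have "D [:g:] = [:0, 2 * pderiv g:]" using curve_deriv_reduced[of f g 0] by simp
  hence "D (D [:g:]) = [:pderiv f * (2 * pderiv g), 0, 2 * pderiv (2 * pderiv g):]"
    by (simp add: curve_deriv_reduced)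
  also have "\<dots> = [:pderiv f * (2 * pderiv g):] + [:2 * pderiv (2 * pderiv g):] * (y * y)" by (simp add: y_def)
  also have "\<dots> \<approx> [:pderiv f * (2 * pderiv g):] + [:2 * pderiv (2 * pderiv g):] * [:f:]"
    by (intro eqv_add eqv_mult y_sq eqv_refl)
  also have "\<dots> = [:D2 g:]" by (simp add: D2_def numeral_poly pderiv_smult algebra_simps)
  finally show ?thesis .
qed

lemma D_D_iter: "(D ^^ (2 * k)) [:g:] \<approx> [:(D2 ^^ k) g:]"
proof (induction k)
  case (Suc k)
  have "(D ^^ (2 * Suc k)) [:g:] = D (D ((D ^^ (2 * k)) [:g:]))" by simp
  also have "\<dots> \<approx> D (D [:(D2 ^^ k) g:])" by (intro eqv_D Suc)
  also have "\<dots> \<approx> [:D2 ((D2 ^^ k) g):]" by (rule D_D)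
  finally show ?case by simp
qed simp

lemma D2_eps: "(D2 ^^ ((l - 1) div 2)) [:0, 1:] = [:\<epsilon>:]"
proof -
  have "2 * ((l - 1) div 2) = l - 1" using odd_l by presburger
  hence "[:(D2 ^^ ((l - 1) div 2)) [:0, 1:], 0:] \<approx> [:[:\<epsilon>:], 0:]"
    using eqv_trans[OF eqv_sym[OF D_D_iter[of "(l - 1) div 2" "[:0, 1:]"]]] X_l_minus_1 by (simp add: x_def)
  thus ?thesis unfolding eqv_reduced_iff by simp
qed

text \<open>The hypotheses say that the curve is isomorphic to its Frobenius twist.\<close>

lemma C_frobenius_scaling:
  assumes s: "s \<noteq> 0" "A = s ^ 4 * A ^ l" "B = s ^ 6 * B ^ l"
  shows "C = s ^ (l + 1)"
proof -
  define r where "r = 1 / s ^ 2"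
  define \<Theta> where "\<Theta> = frob_scale r"
  have r: "r \<noteq> 0" using s by (simp add: r_def)
  have num: "2 ^ l = (2::'a)" "4 ^ l = (4::'a)" using of_nat_power_l[of 2] of_nat_power_l[of 4] by simp_all
  have Tf: "\<Theta> f = smult (r ^ 3) f" unfolding \<Theta>_def r_def frob_scale_f[OF s] by (simp add: power_divide flip: power_mult)
  have "smult r (\<Theta> (pderiv f)) = smult (r ^ 3) (pderiv f)"
    using pderiv_frob_scale[of r f] Tf by (simp add: \<Theta>_def pderiv_smult)
  hence "smult (inverse r) (smult r (\<Theta> (pderiv f))) = smult (inverse r) (smult (r ^ 3) (pderiv f))" by simp
  hence Tf': "\<Theta> (pderiv f) = smult (r ^ 2) (pderiv f)" using r by (simp add: power3_eq_cube power2_eq_square mult.assoc[symmetric])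
  \<comment> \<open>\<Theta> commutes with \<open>D2\<close> up to the factor r, so applying (l-1)/2
    iterations of \<open>D2\<close> to x compares \<epsilon> with \<epsilon>^l.\<close>
  have step: "smult r (D2 (\<Theta> g)) = \<Theta> (D2 g)" for g
  proof -
    have c: "\<Theta> (smult k h) = smult (k ^ l) (\<Theta> h)" for k h
      using frob_scale_mult[of r "[:k:]" h] by (simp add: \<Theta>_def frob_scale_const)
    have "\<Theta> (D2 g) = smult 2 (\<Theta> (pderiv f) * \<Theta> (pderiv g)) + smult 4 (\<Theta> f * \<Theta> (pderiv (pderiv g)))"
      unfolding D2_def by (simp add: \<Theta>_def frob_scale_add frob_scale_mult c[unfolded \<Theta>_def] num)
    also have "\<dots> = smult 2 (smult (r ^ 2) (pderiv f) * \<Theta> (pderiv g)) + smult 4 (smult (r ^ 3) f * \<Theta> (pderiv (pderiv g)))"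
      by (simp only: Tf Tf')
    also have "\<dots> = smult r (smult 2 (pderiv f * smult r (\<Theta> (pderiv g))) + smult 4 (f * smult r (smult r (\<Theta> (pderiv (pderiv g))))))"
      by (simp add: smult_add_right power2_eq_square power3_eq_cube mult_ac)
    also have "\<dots> = smult r (D2 (\<Theta> g))"
      unfolding D2_def by (simp add: \<Theta>_def pderiv_frob_scale pderiv_smult)
    finally show ?thesis ..
  qed
  have D2s: "D2 (smult k g) = smult k (D2 g)" for k g
    by (simp add: D2_def pderiv_smult smult_add_right mult_ac)
  have D2si: "(D2 ^^ n) (smult k g) = smult k ((D2 ^^ n) g)" for n k g
    by (induction n) (simp_all add: D2s)
  have it: "smult (r ^ n) ((D2 ^^ n) (\<Theta> g)) = \<Theta> ((D2 ^^ n) g)" for n g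
  proof (induction n)
    case (Suc n)
    have "smult (r ^ Suc n) ((D2 ^^ Suc n) (\<Theta> g)) = smult r (D2 (smult (r ^ n) ((D2 ^^ n) (\<Theta> g))))"
      by (simp add: D2s)
    thus ?case using Suc step by simp
  qed simp
  define m where "m = (l - 1) div 2"
  have m: "l = 2 * m + 1" unfolding m_def using odd_l by presburger
  have "\<Theta> [:0, 1:] = smult r [:0, 1:]"
    using l5 by (simp add: \<Theta>_def frob_scale_def map_poly_pCons zero_power pcompose_pCons)
  hence "smult (r ^ m) (smult r [:\<epsilon>:]) = \<Theta> [:\<epsilon>:]"
    using it[of m "[:0, 1:]"] D2_eps by (simp only: m_def D2si)
  hence "r ^ Suc m * \<epsilon> = \<epsilon> ^ l" by (simp add: \<Theta>_def frob_scale_const mult_ac)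
  moreover have "r ^ Suc m = 1 / s ^ (l + 1)" 
  proof -
    have "l + 1 = 2 * Suc m" using m by simp
    thus ?thesis by (simp only: r_def power_divide power_one power_mult[symmetric])
  qed
  moreover have "\<epsilon> ^ l = \<epsilon> ^ (l - 1) * \<epsilon>" using l5 by (cases l) simp_all
  ultimately have "1 / s ^ (l + 1) = \<epsilon> ^ (l - 1)" using eps_nz by simp
  thus ?thesis using eps_nz s(1) by (simp add: C_def c_def power_divide divide_simps mult.commute)
qed

end

section \<open>Leading terms of functions of mixed parity\<close>

context weierstrass
begin

text \<open>\<open>hom\<close> demands a definite parity in y, which the functions on the Tate curve
  lack. Here u carries the term of order n, and v, of the other parity, has a smaller pole. The case
  v = 0 is listed separately because nothing satisfies \<open>hom\<close> with pole order 1.\<close>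

definition mtop :: "nat \<Rightarrow> 'a \<Rightarrow> 'a poly poly \<Rightarrow> bool" where
  "mtop n k p \<longleftrightarrow> (\<exists>u v k'. p \<approx> u + v \<and> hom n k u \<and> (v = 0 \<or> hom (n - 1) k' v))"

lemma mtopI: "p \<approx> u + v \<Longrightarrow> hom n k u \<Longrightarrow> hom (n - 1) k' v \<Longrightarrow> mtop n k p"
  unfolding mtop_def by blast

lemma hom_imp_mtop: "hom n k p \<Longrightarrow> mtop n k p"
  unfolding mtop_def by (intro exI[of _ p] exI[of _ 0]) simp

lemma mtop_mult:
  assumes "mtop n k p" "mtop n' k' r" "n \<ge> 2" "n' \<ge> 2"
  shows "mtop (n + n') (k * k') (p * r)"
proof -
  obtain u v j where p: "p \<approx> u + v" "hom n k u" "v = 0 \<or> hom (n - 1) j v"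
    using assms(1) unfolding mtop_def by blast
  obtain u' v' j' where r: "r \<approx> u' + v'" "hom n' k' u'" "v' = 0 \<or> hom (n' - 1) j' v'"
    using assms(2) unfolding mtop_def by blast
  have n1: "n + n' - 1 \<noteq> 1" "n + n' \<noteq> 1" using assms(3,4) by auto
  have vv: "hom (n + n') 0 (v * v')"
  proof (cases "v = 0 \<or> v' = 0")
    case True thus ?thesis using hom_0[OF n1(2)] by auto
  next
    case False
    hence "hom ((n - 1) + (n' - 1)) (j * j') (v * v')" using p(3) r(3) by (intro hom_mult) auto
    thus ?thesis using assms(3,4) by (rule_tac hom_weaken) auto
  qed
  have uv: "\<exists>i. hom (n + n' - 1) i (u * v')"
  proof (cases "v' = 0")
    case True thus ?thesis using hom_0[OF n1(1)] by auto
  next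
    case False
    hence "hom (n + (n' - 1)) (k * j') (u * v')" using p(2) r(3) by (intro hom_mult) auto
    thus ?thesis using assms(4) by (metis Nat.add_diff_assoc le_trans one_le_numeral)
  qed
  have vu: "\<exists>i. hom (n + n' - 1) i (v * u')"
  proof (cases "v = 0")
    case True thus ?thesis using hom_0[OF n1(1)] by auto
  next
    case False
    hence h: "hom ((n - 1) + n') (j * k') (v * u')" using r(2) p(3) by (intro hom_mult) auto
    have "(n - 1) + n' = n + n' - 1" using assms(3) by simp
    thus ?thesis using h by metis
  qed
  from uv vu obtain i i' where "hom (n + n' - 1) i (u * v')" "hom (n + n' - 1) i' (v * u')" by blast
  hence h2: "hom (n + n' - 1) (i + i') (u * v' + v * u')" by (rule hom_add)
  have h1: "hom (n + n') (k * k' + 0) (u * u' + v * v')" by (intro hom_add hom_mult p r vv)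
  have "p * r \<approx> (u + v) * (u' + v')" by (intro eqv_mult p r)
  also have "\<dots> = (u * u' + v * v') + (u * v' + v * u')" by (simp add: algebra_simps)
  finally show ?thesis using mtopI h1 h2 by (metis add.right_neutral)
qed

lemma mtop_add: assumes "mtop n k p" "mtop n k' r" "n \<ge> 2" shows "mtop n (k + k') (p + r)"
proof -
  obtain u v j where p: "p \<approx> u + v" "hom n k u" "v = 0 \<or> hom (n - 1) j v"
    using assms(1) unfolding mtop_def by blast
  obtain u' v' j' where r: "r \<approx> u' + v'" "hom n k' u'" "v' = 0 \<or> hom (n - 1) j' v'"
    using assms(2) unfolding mtop_def by blast
  have "p + r \<approx> (u + v) + (u' + v')" by (intro eqv_add p r)
  also have "\<dots> = (u + u') + (v + v')" by (simp add: algebra_simps)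
  finally have e: "p + r \<approx> (u + u') + (v + v')" .
  have h: "hom n (k + k') (u + u')" by (intro hom_add p r)
  have "v + v' = 0 \<or> (\<exists>i. hom (n - 1) i (v + v'))"
    using p(3) r(3) hom_add by (metis add.left_neutral add.right_neutral)
  thus ?thesis using e h unfolding mtop_def by blast
qed

lemma mtop_Suc: assumes "mtop n k p" "n \<ge> 2" shows "mtop (Suc n) 0 p"
proof -
  obtain u v j where p: "p \<approx> u + v" "hom n k u" "v = 0 \<or> hom (n - 1) j v"
    using assms(1) unfolding mtop_def by blast
  have "hom (Suc n) 0 v"
  proof (cases "v = 0")
    case True thus ?thesis using hom_0[of "Suc n"] assms(2) by simp
  next
    case False
    hence "hom (n - 1) j v" using p(3) by simp
    thus ?thesis using assms(2) by (rule_tac hom_weaken) auto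
  qed
  thus ?thesis using p by (intro mtopI[of _ v u "Suc n" 0 k]) (auto simp: add.commute)
qed

lemma mtop_smult: assumes "mtop n k p" shows "mtop n (s * k) (smult [:s:] p)"
proof -
  obtain u v j where p: "p \<approx> u + v" "hom n k u" "v = 0 \<or> hom (n - 1) j v"
    using assms(1) unfolding mtop_def by blast
  have "[:[:s:]:] * p \<approx> [:[:s:]:] * (u + v)" by (intro eqv_mult p eqv_refl)
  hence e: "smult [:s:] p \<approx> smult [:s:] u + smult [:s:] v" by (simp add: smult_add_right)
  show ?thesis
  proof (cases "v = 0")
    case True
    thus ?thesis using e hom_smult[OF p(2), of s] unfolding mtop_def by (metis add.right_neutral smult_0_right)
  next
    case False
    thus ?thesis using p(3) e hom_smult[OF p(2), of s] by (intro mtopI[OF e]) (auto intro: hom_smult)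
  qed
qed

lemma mtop_power: assumes "mtop n k p" "n \<ge> 2" "j > 0" shows "mtop (j * n) (k ^ j) (p ^ j)"
  using assms(3)
proof (induction j rule: nat_induct_non_zero)
  case 1 thus ?case using assms(1) by simp
next
  case (Suc j)
  have "2 \<le> j * n" using assms(2) Suc.hyps by (cases j) auto
  thus ?case using mtop_mult[OF assms(1) Suc.IH assms(2)] by simp
qed

end

section \<open>The Tate normal form and functions supported at multiples of P\<close>

text \<open>In standard notation \<open>ta1\<close> is a_1, \<open>te\<close> is a_2 = a_3, and
  \<open>tx\<close> = 3 b_2 is the abscissa of P.\<close>

definition ta1 :: "'a::field \<Rightarrow> 'a" where "ta1 d = 1 + d - d ^ 2"
definition te :: "'a::field \<Rightarrow> 'a" where "te d = d ^ 2 - d ^ 3"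
definition tx :: "'a::field \<Rightarrow> 'a" where "tx d = 3 * (ta1 d ^ 2 + 4 * te d)"

text \<open>The Tate normal form \<open>E\<^sub>7(d)\<close> in the coordinates \<open>x = 36 X + 3 b\<^sub>2\<close>, \<open>y = 108 (2 Y + a\<^sub>1 X + a\<^sub>3)\<close>.\<close>

definition tA :: "'a::field \<Rightarrow> 'a" where "tA d = - 27 * (poly p_a d * poly p_b d)"
definition tB :: "'a::field \<Rightarrow> 'a" where "tB d = 54 * poly f2 d"

text \<open>The product of \<open>p_a\<close> and \<open>p_b\<close> is c_4 = b_2^2 - 24 b_4 with
  b_4 = a_1 a_3; in \<open>tB_altdef\<close>, \<open>f2\<close> is -c_6.\<close>

lemma tA_altdef: "tA d = - 27 * ((ta1 d ^ 2 + 4 * te d) ^ 2 - 24 * ta1 d * te d)"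
  by (simp add: tA_def ta1_def te_def p_a_def p_b_def eval_nat_numeral algebra_simps)

lemma tB_altdef: "tB d = 54 * ((ta1 d ^ 2 + 4 * te d) ^ 3 - 36 * (ta1 d ^ 2 + 4 * te d) * ta1 d * te d + 216 * te d ^ 2)"
  by (simp add: tB_def ta1_def te_def f2_def eval_nat_numeral algebra_simps)

lemma tate_cubic:
  "xx ^ 3 + tA d * xx + tB d =
     (xx - tx d) ^ 3 + 36 * te d * (xx - tx d) ^ 2 + (3 * ta1 d * (xx - tx d) + 108 * te d) ^ 2"
  unfolding tA_altdef tB_altdef tx_def by Groebner_Basis.algebra

text \<open>The functions \<open>X\<close>, \<open>Y\<close>, \<open>g\<^sub>3\<close>, \<open>g\<^sub>4\<close>, \<open>g\<^sub>5\<close>, \<open>\<Phi>\<close> have divisors \<open>i(P) + (-iP) - (i+1)O\<close> for \<open>i = 1, \<dots>, 6\<close>,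
  where \<open>P = (0, 0)\<close> is the point of order 7; the following identities hold modulo the equation of the curve.\<close>

definition g3 :: "'a::idom \<Rightarrow> 'a \<Rightarrow> 'a" where "g3 u v = 6 * v - u ^ 2"
definition g4 :: "'a::idom \<Rightarrow> 'a \<Rightarrow> 'a \<Rightarrow> 'a" where "g4 d u v = u * v + 6 * d * g3 u v"
definition g5 :: "'a::idom \<Rightarrow> 'a \<Rightarrow> 'a \<Rightarrow> 'a" where "g5 d u v = v ^ 2 - 6 * d ^ 2 * g4 d u v"
definition Phi :: "'a::idom \<Rightarrow> 'a \<Rightarrow> 'a \<Rightarrow> 'a" where "Phi d u v = d * u * g4 d u v + v * g3 u v"
text \<open>With u = 36 X and v = 216 Y this is 216^2 times the equation of the curve.\<close>

definition tate_eq :: "'a::idom \<Rightarrow> 'a \<Rightarrow> 'a \<Rightarrow> 'a" where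
  "tate_eq d u v = v ^ 2 + 6 * (1 + d - d ^ 2) * u * v + 216 * (d ^ 2 - d ^ 3) * v - u ^ 3 - 36 * (d ^ 2 - d ^ 3) * u ^ 2"

lemmas tate_defs = g3_def g4_def g5_def Phi_def tate_eq_def

text \<open>Each identity expresses a function, times a constant that is nonzero for d other than 0
  and 1, by products whose zero at P has an order one higher than known so far. Together they
  bootstrap the orders at P.\<close>

lemma tate_identities:
  fixes d u v :: "'a::idom"
  shows "216 * (d ^ 2 - d ^ 3) * v = u ^ 3 + 36 * (d ^ 2 - d ^ 3) * u ^ 2 - v ^ 2 - 6 * (1 + d - d ^ 2) * u * v + tate_eq d u v"
    and "36 * (d ^ 2 - d ^ 3) * g3 u v = u ^ 3 - 6 * (1 + d - d ^ 2) * u * v - v ^ 2 + tate_eq d u v"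
    and "6 * (d ^ 2 - d) * g4 d u v = u * g3 u v + v ^ 2 - tate_eq d u v"
    and "6 * (d ^ 2 - d) * g5 d u v = - d * (u * g4 d u v + v * g3 u v) + 6 * d ^ 2 * tate_eq d u v"
    and "6 * Phi d u v = g3 u v ^ 2 - u * g5 d u v + u * tate_eq d u v"
    and "36 * (d ^ 2 - d) * Phi d u v = (d - 1) * g3 u v * g4 d u v + u * Phi d u v - 6 * d * u * tate_eq d u v"
  unfolding tate_defs by Groebner_Basis.algebra+

text \<open>\<alpha> + \<beta> v is \<open>Phi\<close> reduced to degree one in v. Its norm under
  the conjugation v -> -v - \<gamma> is -(d - 1)^2 u^7, so all zeros of \<open>Phi\<close> lie over
  u = 0.\<close>

lemma Phi_norm:
  fixes d u v :: "'a::idom"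
  assumes "tate_eq d u v = 0" "Phi d u v = 0"
  shows "(d - 1) ^ 2 * u ^ 7 = 0"
proof -
  define \<alpha> where "\<alpha> = 6 * (1 - d ^ 2) * u ^ 3 + 216 * (d ^ 2 - d ^ 3) * u ^ 2"
  define \<beta> where "\<beta> = (d - 1) * u ^ 2 + 36 * (2 * d ^ 2 - d - 1) * u - 1296 * (d ^ 2 - d ^ 3)"
  define \<gamma> where "\<gamma> = 6 * (1 + d - d ^ 2) * u + 216 * (d ^ 2 - d ^ 3)"
  have 1: "\<alpha> + \<beta> * v = Phi d u v - 6 * tate_eq d u v"
    unfolding \<alpha>_def \<beta>_def tate_defs by Groebner_Basis.algebra
  have "(\<alpha> + \<beta> * v) * (\<alpha> - \<beta> * (v + \<gamma>)) = \<alpha> ^ 2 - \<alpha> * \<beta> * \<gamma> - \<beta> ^ 2 * (v ^ 2 + v * \<gamma>)"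
    by Groebner_Basis.algebra
  also have "v ^ 2 + v * \<gamma> = tate_eq d u v + u ^ 3 + 36 * (d ^ 2 - d ^ 3) * u ^ 2"
    unfolding \<gamma>_def tate_defs by Groebner_Basis.algebra
  finally have "0 = \<alpha> ^ 2 - \<alpha> * \<beta> * \<gamma> - \<beta> ^ 2 * (u ^ 3 + 36 * (d ^ 2 - d ^ 3) * u ^ 2)"
    using 1 assms by simp
  also have "\<dots> = - ((d - 1) ^ 2 * u ^ 7)"
    unfolding \<alpha>_def \<beta>_def \<gamma>_def by Groebner_Basis.algebra
  finally show ?thesis by simp
qed

locale tate_supersingular = supersingular "tA d" "tB d" l for d :: "'a::alg_closed_field" and l +
  assumes d0: "d \<noteq> 0" and d1: "d \<noteq> 1"
begin

definition dd :: "'a poly poly" where "dd = [:[:d:]:]"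
definition Xt :: "'a poly poly" where "Xt = [:[:- tx d, 1:]:]"
definition Yt :: "'a poly poly" where "Yt = [:[:3 * ta1 d * tx d - 108 * te d, - 3 * ta1 d:], 1:]"

lemma six_nz: "(6::'a) \<noteq> 0"
  using numeral_nz by (metis mult_eq_0_iff numeral_times_numeral semiring_norm(12,14))

lemma te_nz: "d ^ 2 - d ^ 3 \<noteq> 0" and tc_nz: "d ^ 2 - d \<noteq> 0"
proof -
  have "d ^ 2 - d ^ 3 = d ^ 2 * (1 - d)" "d ^ 2 - d = d * (d - 1)"
    by (simp_all add: power2_eq_square power3_eq_cube algebra_simps)
  thus "d ^ 2 - d ^ 3 \<noteq> 0" "d ^ 2 - d \<noteq> 0" using d0 d1 by simp_all
qed

lemma ev_numeral [simp]: "ev (numeral n) a b = (numeral n :: 'a)"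
  by (simp add: ev_def)

lemma ev_dd [simp]: "ev dd a b = d" and ev_X [simp]: "ev Xt a b = a - tx d"
  and ev_Yt [simp]: "ev Yt a b = b - 3 * ta1 d * (a - tx d) - 108 * te d"
  by (simp_all add: dd_def Xt_def Yt_def algebra_simps)

lemma poly_f: "poly f a = a ^ 3 + tA d * a + tB d"
  by (simp add: f_def power3_eq_cube algebra_simps)

lemma poly_f_tate: "poly f a = (a - tx d) ^ 3 + 36 * te d * (a - tx d) ^ 2 + (3 * ta1 d * (a - tx d) + 108 * te d) ^ 2"
  unfolding poly_f by (rule tate_cubic)

lemma tate_eq_ev: "b ^ 2 = poly f a \<Longrightarrow> tate_eq d (ev Xt a b) (ev Yt a b) = 0"
  unfolding poly_f_tate by (simp add: tate_eq_def ta1_def[symmetric] te_def[symmetric]) (simp add: power2_eq_square algebra_simps)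

lemma tate_eq_P: "tate_eq dd Xt Yt = P"
proof -
  define g where "g = [:- tx d, 1:]"
  define h where "h = smult (3 * ta1 d) g + [:108 * te d:]"
  have Y: "Yt = [:- h:] + y" by (simp add: Yt_def h_def g_def y_def algebra_simps)
  have f: "f = g ^ 3 + smult (36 * te d) (g ^ 2) + h ^ 2"
  proof -
    have "poly (f - (g ^ 3 + smult (36 * te d) (g ^ 2) + h ^ 2)) a = 0" for a
      using poly_f_tate[of a] by (simp add: g_def h_def algebra_simps)
    from poly_eq_0_alg_closed[OF this] show ?thesis by simp
  qed
  have a: "1 + dd - dd ^ 2 = [:[:ta1 d:]:]" and e: "dd ^ 2 - dd ^ 3 = [:[:te d:]:]"
    by (simp_all add: dd_def ta1_def te_def one_pCons power2_eq_square power3_eq_cube algebra_simps)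
  have "tate_eq dd Xt Yt = Yt ^ 2 + 2 * [:h:] * Yt - [:g ^ 3 + smult (36 * te d) (g ^ 2):]"
    unfolding tate_eq_def a e
    by (simp add: Xt_def h_def g_def numeral_poly power2_eq_square power3_eq_cube algebra_simps)
       (simp add: algebra_simps flip: smult_add_left)
  also have "\<dots> = y ^ 2 - [:h ^ 2 + (g ^ 3 + smult (36 * te d) (g ^ 2)):]"
    unfolding Y by (simp add: numeral_poly power2_eq_square y_def algebra_simps)
  also have "\<dots> = P" by (simp add: P_def f y_def power2_eq_square algebra_simps)
  finally show ?thesis .
qed

end

section \<open>Zeros of a function with an l-fold zero at R\<close>

context supersingular
begin

text \<open>\<open>multiplication_by_l\<close> for a function known only through its leading term
  and its zero at R. The last clause is for functions divisible by x - xQ: these vanish at both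
  points over xQ, and the zero of the cofactor tells Q from -Q.\<close>

lemma vanishing_function:
  fixes a b :: 'a
  defines "xQ \<equiv> C ^ 2 * a ^ (l * l)" and "yQ \<equiv> - (C ^ 3 * b ^ (l * l))"
  assumes R: "b ^ 2 = poly f a" "b \<noteq> 0"
    and top: "mtop (l + 1) k w" "k \<noteq> 0" and van: "van l a b w"
  shows "yQ ^ 2 = poly f xQ" and "ev w xQ (- yQ) = 0"
    and "\<And>a' b'. b' ^ 2 = poly f a' \<Longrightarrow> ev w a' b' = 0 \<Longrightarrow> a' = a \<or> a' = xQ"
    and "\<And>s. w \<approx> [:[:- xQ, 1:]:] * s \<Longrightarrow> ev s xQ yQ = 0"
proof -
  have "poly Z a = xQ" unfolding frobenius_scaling(1) xQ_def by (simp add: poly_monom)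
  moreover have "b * poly V a = yQ"
  proof -
    have "odd (l * l)" using odd_l by simp
    hence "l * l = Suc (2 * ((l * l - 1) div 2))" by presburger
    hence "b ^ (l * l) = b * (b ^ 2) ^ ((l * l - 1) div 2)" by (metis power_Suc power_mult)
    thus ?thesis unfolding Z_V_explicit(2) yQ_def by (simp add: R(1))
  qed
  moreover have "poly f (poly Z a) = (b * poly V a) ^ 2"
    using arg_cong[OF Q_on_curve, of "\<lambda>p. poly p a"] by (simp add: poly_pcompose power_mult_distrib R(1))
  ultimately show curve: "yQ ^ 2 = poly f xQ" by simp
  obtain u v k' where uv: "w \<approx> u + v" "hom (l + 1) k u" "v = 0 \<or> hom (l + 1 - 1) k' v"
    using top(1) unfolding mtop_def by blast
  obtain g where g: "u \<approx> [:g:]" "degree g \<le> q + 2" "coeff g (q + 2) = k"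
    using uv(2)
  proof (cases rule: homE)
    case (1 m a)
    have "m = q + 2" using 1(1) l_q(1) by linarith
    thus ?thesis using 1 by (intro that[of a]) simp_all
  next
    case (2 m b)
    hence False using odd_l by presburger
    thus ?thesis ..
  qed
  obtain h where h: "v \<approx> [:0, h:]" "degree h \<le> q"
  proof (cases "v = 0")
    case True
    hence "v \<approx> [:0, 0:]" by simp
    thus ?thesis using that[of 0] by simp
  next
    case False
    hence "hom l k' v" using uv(3) by simp
    thus ?thesis
    proof (cases rule: homE)
      case (1 m a)
      hence False using odd_l by simp
      thus ?thesis ..
    next
      case (2 m b)
      have "m = q" using 2(1) l_q(1) by linarith
      thus ?thesis using 2 by (intro that[of b]) simp_all
    qed
  qed
  define p0 where "p0 = smult (1 / k) g"
  define p1 where "p1 = smult (1 / k) h"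
  have "w \<approx> [:g:] + [:0, h:]" using eqv_trans[OF uv(1) eqv_add[OF g(1) h(1)]] .
  hence w: "w \<approx> [:g, h:]" by simp
  have "[:[:1 / k:]:] * w \<approx> [:[:1 / k:]:] * [:g, h:]" by (intro eqv_mult w eqv_refl)
  hence wp: "smult [:1 / k:] w \<approx> [:p0, p1:]" by (simp add: p0_def p1_def)
  have deg: "degree p0 \<le> q + 2" "coeff p0 (q + 2) = 1" "degree p1 \<le> q"
    using g h top(2) by (simp_all add: p0_def p1_def)
  have "van l a b [:p0, p1:]"
    using iffD1[OF van_cong[OF wp R(1)]] van_smult[OF van] by blast
  note main = multiplication_by_l[OF R deg this, folded xQ_def yQ_def]
  have ev_w: "ev w a' b' = k * (poly p0 a' + b' * poly p1 a')" if "b' ^ 2 = poly f a'" for a' b'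
    using ev_cong[OF w that] top(2) by (simp add: p0_def p1_def algebra_simps)
  have "(- yQ) ^ 2 = poly f xQ" using curve by simp
  from ev_w[OF this] show "ev w xQ (- yQ) = 0" using main(2) by simp
  show "a' = a \<or> a' = xQ" if c: "b' ^ 2 = poly f a'" and e: "ev w a' b' = 0" for a' b'
  proof -
    have "poly p0 a' = - (b' * poly p1 a')"
      using ev_w[OF c] e top(2) by (simp add: eq_neg_iff_add_eq_0)
    hence "poly p0 a' ^ 2 = poly f a' * poly p1 a' ^ 2" by (simp add: power_mult_distrib c)
    hence "poly ([:- a, 1:] ^ l * [:- xQ, 1:]) a' = 0" unfolding main(1)[symmetric] by simp
    hence "(a' - a) ^ l * (a' - xQ) = 0" by simp
    thus ?thesis by auto
  qed
  show "ev s xQ yQ = 0" if s: "w \<approx> [:[:- xQ, 1:]:] * s" for s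
  proof -
    obtain s0 s1 where s01: "s \<approx> [:s0, s1:]" using reduced_exists by blast
    have "[:p0, p1:] \<approx> [:[:1 / k:]:] * w" using eqv_sym[OF wp] by simp
    also have "\<dots> \<approx> [:[:1 / k:]:] * ([:[:- xQ, 1:]:] * s)" by (intro eqv_mult s eqv_refl)
    also have "\<dots> \<approx> [:[:1 / k:]:] * ([:[:- xQ, 1:]:] * [:s0, s1:])" by (intro eqv_mult s01 eqv_refl)
    also have "\<dots> = [:[:- xQ, 1:] * smult (1 / k) s0, [:- xQ, 1:] * smult (1 / k) s1:]" by simp
    finally have "p0 = [:- xQ, 1:] * smult (1 / k) s0" "p1 = [:- xQ, 1:] * smult (1 / k) s1"
      unfolding eqv_reduced_iff by blast+
    from main(3)[OF this] have "poly s0 xQ + yQ * poly s1 xQ = 0"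
      using top(2) by (simp add: field_simps)
    thus ?thesis using ev_cong[OF s01 curve] by simp
  qed
qed

end

section \<open>The multiple [l]P\<close>

context tate_supersingular
begin

abbreviation "P1x \<equiv> tx d"
abbreviation "P1y \<equiv> 108 * te d"

lemma P1_curve: "P1y ^ 2 = poly f P1x" and P1y_nz: "P1y \<noteq> 0"
proof -
  show "P1y ^ 2 = poly f P1x" unfolding poly_f_tate by simp
  have "(108::'a) = 6 * 6 * 3" by simp
  thus "P1y \<noteq> 0" using six_nz numeral_nz te_nz by (simp only: te_def mult_eq_0_iff simp_thms)
qed

lemma nz216: "(216::'a) \<noteq> 0" and nz36: "(36::'a) \<noteq> 0"
proof -
  have "(216::'a) = 6 * 6 * 6" "(36::'a) = 6 * 6" by simp_all
  thus "(216::'a) \<noteq> 0" "(36::'a) \<noteq> 0" using six_nz by (simp_all only: mult_eq_0_iff simp_thms)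
qed

abbreviation "vanP n p \<equiv> van n P1x P1y p"

lemma van_multI: "vanP m p \<Longrightarrow> vanP n r \<Longrightarrow> k \<le> m + n \<Longrightarrow> vanP k (p * r)"
  using van_mult van_mono by blast

lemma van_multR: "vanP n r \<Longrightarrow> vanP n (p * r)"
  using van_multI[of 0 p n r n] by simp

lemma van_powerI: "vanP m p \<Longrightarrow> k \<le> j * m \<Longrightarrow> vanP k (p ^ j)"
  using van_power van_mono by blast

lemma van_unit:
  assumes "h * p = r + m * tate_eq dd Xt Yt" "ev h P1x P1y \<noteq> 0" "vanP n r"
  shows "vanP n p"
proof -
  have "eqv (h * p) r" unfolding eqv_def assms(1) tate_eq_P by simp
  hence "vanP n (h * p)" using van_cong[OF _ P1_curve] assms(3) by blast
  thus ?thesis using assms(2) by (rule van_unit_cancel)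
qed

lemma van_Xt: "vanP 1 Xt" and van_Yt: "vanP 2 Yt" and van_g3: "vanP 3 (g3 Xt Yt)" and van_g4: "vanP 4 (g4 dd Xt Yt)"
  and van_g5: "vanP 5 (g5 dd Xt Yt)" and van_Phi: "vanP 7 (Phi dd Xt Yt)"
proof -
  show x: "vanP 1 Xt" by (simp add: van_def)
  have y1: "vanP 1 Yt" by (simp add: van_def)
  show y: "vanP 2 Yt"
  proof (rule van_unit[where m = 1])
    show "216 * (dd ^ 2 - dd ^ 3) * Yt = (Xt ^ 3 + 36 * (dd ^ 2 - dd ^ 3) * Xt ^ 2 - Yt ^ 2 - 6 * (1 + dd - dd ^ 2) * Xt * Yt) + 1 * tate_eq dd Xt Yt"
      using tate_identities(1)[of dd Yt Xt] by simp
    show "ev (216 * (dd ^ 2 - dd ^ 3)) P1x P1y \<noteq> 0" using nz216 te_nz by simp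
    show "vanP 2 (Xt ^ 3 + 36 * (dd ^ 2 - dd ^ 3) * Xt ^ 2 - Yt ^ 2 - 6 * (1 + dd - dd ^ 2) * Xt * Yt)"
      by (intro van_add van_diff van_powerI[OF x] van_powerI[OF y1] van_multR van_multI[OF van_multR[OF x] y1]) simp_all
  qed
  show g3: "vanP 3 (g3 Xt Yt)"
  proof (rule van_unit[where m = 1])
    show "36 * (dd ^ 2 - dd ^ 3) * g3 Xt Yt = (Xt ^ 3 - 6 * (1 + dd - dd ^ 2) * Xt * Yt - Yt ^ 2) + 1 * tate_eq dd Xt Yt"
      using tate_identities(2)[of dd Xt Yt] by simp
    show "ev (36 * (dd ^ 2 - dd ^ 3)) P1x P1y \<noteq> 0" using nz36 te_nz by simp
    show "vanP 3 (Xt ^ 3 - 6 * (1 + dd - dd ^ 2) * Xt * Yt - Yt ^ 2)"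
      by (intro van_add van_diff van_powerI[OF x] van_powerI[OF y] van_multI[OF van_multR[OF x] y]) simp_all
  qed
  show g4: "vanP 4 (g4 dd Xt Yt)"
  proof (rule van_unit[where m = "- 1"])
    show "6 * (dd ^ 2 - dd) * g4 dd Xt Yt = (Xt * g3 Xt Yt + Yt ^ 2) + - 1 * tate_eq dd Xt Yt"
      using tate_identities(3)[of dd Xt Yt] by simp
    show "ev (6 * (dd ^ 2 - dd)) P1x P1y \<noteq> 0" using six_nz tc_nz by simp
    show "vanP 4 (Xt * g3 Xt Yt + Yt ^ 2)"
      by (intro van_add van_powerI[OF y] van_multI[OF x g3]) simp_all
  qed
  show g5: "vanP 5 (g5 dd Xt Yt)"
  proof (rule van_unit[where m = "6 * dd ^ 2"])
    show "6 * (dd ^ 2 - dd) * g5 dd Xt Yt = (- dd * (Xt * g4 dd Xt Yt + Yt * g3 Xt Yt)) + 6 * dd ^ 2 * tate_eq dd Xt Yt"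
      using tate_identities(4)[of dd Xt Yt] .
    show "ev (6 * (dd ^ 2 - dd)) P1x P1y \<noteq> 0" using six_nz tc_nz by simp
    show "vanP 5 (- dd * (Xt * g4 dd Xt Yt + Yt * g3 Xt Yt))"
      by (intro van_multR van_add van_multI[OF x g4] van_multI[OF y g3]) simp_all
  qed
  \<comment> \<open>The last identity contains u times \<open>Phi\<close> on its right-hand side, so
    order 6 has to be known before order 7.\<close>
  have Phi6: "vanP 6 (Phi dd Xt Yt)"
  proof (rule van_unit[where m = Xt])
    show "6 * Phi dd Xt Yt = (g3 Xt Yt ^ 2 - Xt * g5 dd Xt Yt) + Xt * tate_eq dd Xt Yt"
      using tate_identities(5)[of dd Xt Yt] .
    show "ev 6 P1x P1y \<noteq> 0" using six_nz by simp
    show "vanP 6 (g3 Xt Yt ^ 2 - Xt * g5 dd Xt Yt)"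
      by (intro van_diff van_powerI[OF g3] van_multI[OF x g5]) simp_all
  qed
  show "vanP 7 (Phi dd Xt Yt)"
  proof (rule van_unit[where m = "- (6 * dd * Xt)"])
    show "36 * (dd ^ 2 - dd) * Phi dd Xt Yt = ((dd - 1) * g3 Xt Yt * g4 dd Xt Yt + Xt * Phi dd Xt Yt) + - (6 * dd * Xt) * tate_eq dd Xt Yt"
      using tate_identities(6)[of dd Xt Yt] by simp
    show "ev (36 * (dd ^ 2 - dd)) P1x P1y \<noteq> 0" using nz36 tc_nz by simp
    show "vanP 7 ((dd - 1) * g3 Xt Yt * g4 dd Xt Yt + Xt * Phi dd Xt Yt)"
      by (intro van_add van_multI[OF van_multR[OF g3] g4] van_multI[OF x Phi6]) simp_all
  qed
qed

lemma mtop_numeral: "mtop n k p \<Longrightarrow> mtop n (numeral j * k) (numeral j * p)"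
  using mtop_smult[of n k p "numeral j"] by (simp add: numeral_poly)

lemma mtop_dd: "mtop n k p \<Longrightarrow> mtop n (d * k) (dd * p)"
  using mtop_smult[of n k p d] by (simp add: dd_def)

lemma mtop_minus: "mtop n k p \<Longrightarrow> mtop n (- k) (- p)"
proof -
  have "smult [:- 1:] p = - p" by (rule poly_eqI) simp
  thus "mtop n k p \<Longrightarrow> mtop n (- k) (- p)" using mtop_smult[of n k p "- 1"] by simp
qed

lemma mtop_add_low: "mtop (Suc n) k p \<Longrightarrow> mtop n k' r \<Longrightarrow> n \<ge> 2 \<Longrightarrow> mtop (Suc n) k (p + r)"
  using mtop_add[of "Suc n" k p 0 r] mtop_Suc[of n k' r] by simp

lemma mtop_Xt: "mtop 2 1 Xt" and mtop_Yt: "mtop 3 (- 1) Yt" and mtop_g3: "mtop 4 (- 1) (g3 Xt Yt)"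
  and mtop_g4: "mtop 5 (- 1) (g4 dd Xt Yt)" and mtop_g5: "mtop 6 1 (g5 dd Xt Yt)" and mtop_Phi: "mtop 7 (1 - d) (Phi dd Xt Yt)"
proof -
  show x: "mtop 2 1 Xt"
    by (rule hom_imp_mtop, rule hom_evenI[of _ 1 _ "[:- tx d, 1:]"]) (simp_all add: Xt_def)
  show y: "mtop 3 (- 1) Yt"
  proof (rule mtopI[of _ y "[:[:3 * ta1 d * tx d - 108 * te d, - 3 * ta1 d:]:]"])
    show "eqv Yt (y + [:[:3 * ta1 d * tx d - 108 * te d, - 3 * ta1 d:]:])" by (simp add: Yt_def y_def)
    show "hom (3 - 1) (- 3 * ta1 d) [:[:3 * ta1 d * tx d - 108 * te d, - 3 * ta1 d:]:]"
      by (rule hom_evenI[of _ 1 _ "[:3 * ta1 d * tx d - 108 * te d, - 3 * ta1 d:]"]) simp_all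
  qed (rule hom_y)
  have xx: "mtop 4 1 (Xt * Xt)" using mtop_mult[OF x x] by simp
  have "mtop (Suc 3) (- 1) (- (Xt * Xt) + 6 * Yt)"
    by (rule mtop_add_low[OF _ mtop_numeral[OF y]]) (use mtop_minus[OF xx] in simp_all)
  thus g3: "mtop 4 (- 1) (g3 Xt Yt)" by (simp add: g3_def power2_eq_square)
  have xy: "mtop 5 (- 1) (Xt * Yt)" using mtop_mult[OF x y] by simp
  have "mtop (Suc 4) (- 1) (Xt * Yt + 6 * (dd * g3 Xt Yt))"
    by (rule mtop_add_low[OF _ mtop_numeral[OF mtop_dd[OF g3]]]) (use xy in simp_all)
  thus g4: "mtop 5 (- 1) (g4 dd Xt Yt)" by (simp add: g4_def mult.assoc)
  have yy: "mtop 6 1 (Yt * Yt)" using mtop_mult[OF y y] by simp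
  have "mtop (Suc 5) 1 (Yt * Yt + - (6 * (dd * (dd * g4 dd Xt Yt))))"
    by (rule mtop_add_low[OF _ mtop_minus[OF mtop_numeral[OF mtop_dd[OF mtop_dd[OF g4]]]]]) (use yy in simp_all)
  thus "mtop 6 1 (g5 dd Xt Yt)" by (simp add: g5_def mult.assoc power2_eq_square)
  have "mtop 7 (d * (1 * - 1)) (dd * (Xt * g4 dd Xt Yt))" using mtop_dd[OF mtop_mult[OF x g4]] by simp
  moreover have "mtop 7 (- 1 * - 1) (Yt * g3 Xt Yt)" using mtop_mult[OF y g3] by simp
  ultimately show "mtop 7 (1 - d) (Phi dd Xt Yt)"
    using mtop_add[of 7 "- d" "dd * (Xt * g4 dd Xt Yt)" 1 "Yt * g3 Xt Yt"] by (simp add: Phi_def mult.assoc)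
qed

text \<open>\<open>Phi\<close> serves as the case i = 6 because -6P = P: its divisor is 7P -
  7O.\<close>

definition G :: "nat \<Rightarrow> 'a poly poly" where
  "G i = (if i = 1 then Xt else if i = 2 then Yt else if i = 3 then g3 Xt Yt else if i = 4 then g4 dd Xt Yt
          else if i = 5 then g5 dd Xt Yt else Phi dd Xt Yt)"

lemma van_mtop_G:
  assumes "i \<in> {1..6}"
  shows "vanP i (G i)" and "\<exists>k. k \<noteq> 0 \<and> mtop (i + 1) k (G i)"
proof -
  have i: "i = 1 \<or> i = 2 \<or> i = 3 \<or> i = 4 \<or> i = 5 \<or> i = 6" using assms by auto
  show "vanP i (G i)"
    using i van_Xt van_Yt van_g3 van_g4 van_g5 van_mono[OF van_Phi, of 6] by (auto simp: G_def)
  have "1 - d \<noteq> 0" using d1 by simp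
  thus "\<exists>k. k \<noteq> 0 \<and> mtop (i + 1) k (G i)"
    using i mtop_Xt mtop_Yt mtop_g3 mtop_g4 mtop_g5 mtop_Phi
    by (auto simp: G_def eval_nat_numeral intro: exI[of _ 1] exI[of _ "- 1"] exI[of _ "1 - d"])
qed

lemma ev_tate [simp]:
  "ev (g3 Xt Yt) a b = g3 (ev Xt a b) (ev Yt a b)"
  "ev (g4 dd Xt Yt) a b = g4 d (ev Xt a b) (ev Yt a b)"
  "ev (g5 dd Xt Yt) a b = g5 d (ev Xt a b) (ev Yt a b)"
  "ev (Phi dd Xt Yt) a b = Phi d (ev Xt a b) (ev Yt a b)"
  by (simp_all only: tate_defs ev_simps ev_numeral ev_dd)

lemma Phi_zero:
  assumes "b ^ 2 = poly f a" "ev (Phi dd Xt Yt) a b = 0"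
  shows "ev Xt a b = 0" "ev Yt a b = 0"
proof -
  have "(d - 1) ^ 2 * ev Xt a b ^ 7 = 0"
    using assms by (intro Phi_norm[OF tate_eq_ev]) (simp_all only: ev_tate)
  thus x: "ev Xt a b = 0" using d1 by simp
  have "Phi d 0 v = 6 * v ^ 2" for v by (simp add: tate_defs power2_eq_square)
  hence "6 * ev Yt a b ^ 2 = 0" using assms(2) x by (simp only: ev_tate)
  thus "ev Yt a b = 0" using six_nz by simp
qed

lemma tate_eq_curve: "tate_eq d (ev Xt a b) (ev Yt a b) = 0 \<Longrightarrow> b ^ 2 = poly f a"
  unfolding poly_f_tate by (simp add: tate_eq_def ta1_def[symmetric] te_def[symmetric]) (simp add: power2_eq_square algebra_simps)

text \<open>For l = 7m + i the function Phi^m G_i has the divisor l(P) + (-iP) - (l+1)O, so Q = iP.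
  The right-hand sides are the coordinates of iP, with X(2P) = b and X(3P) = tc; the residues i and
  7 - i differ in the sign of yQ.\<close>

theorem tate_multiplication_by_l:
  defines "xQ \<equiv> C ^ 2 * tx d ^ (l * l)" and "yQ \<equiv> - (C ^ 3 * (108 * te d) ^ (l * l))"
  defines "b \<equiv> d ^ 3 - d ^ 2" and "tc \<equiv> d ^ 2 - d"
  shows "l mod 7 = 1 \<Longrightarrow> xQ = tx d \<and> yQ = 108 * te d"
    and "l mod 7 = 2 \<Longrightarrow> xQ = tx d + 36 * b \<and> yQ = 108 * (b * tc)"
    and "l mod 7 = 3 \<Longrightarrow> xQ = tx d + 36 * tc \<and> yQ = - 108 * (tc * (d - 1) ^ 2)"
    and "l mod 7 = 4 \<Longrightarrow> xQ = tx d + 36 * tc \<and> yQ = 108 * (tc * (d - 1) ^ 2)"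
    and "l mod 7 = 5 \<Longrightarrow> xQ = tx d + 36 * b \<and> yQ = - 108 * (b * tc)"
    and "l mod 7 = 6 \<Longrightarrow> xQ = tx d \<and> yQ = - 108 * te d"
proof -
  define m where "m = l div 7"
  define w where "w i = Phi dd Xt Yt ^ m * G i" for i
  have eq: "l = m * 7 + i" if "l mod 7 = i" for i
    using div_mult_mod_eq[of l 7] that by (simp add: m_def)
  have vf: "vanP l (w i)" "\<exists>k. k \<noteq> 0 \<and> mtop (l + 1) k (w i)" if i: "l mod 7 = i" "i \<in> {1..6}" for i
  proof -
    show "vanP l (w i)" unfolding w_def
      by (rule van_multI[OF van_power[OF van_Phi] van_mtop_G(1)[OF i(2)]]) (use eq[OF i(1)] in simp)
    obtain k where k: "k \<noteq> 0" "mtop (i + 1) k (G i)" using van_mtop_G(2)[OF i(2)] by blast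
    show "\<exists>k. k \<noteq> 0 \<and> mtop (l + 1) k (w i)"
    proof (cases "m = 0")
      case True
      hence "l + 1 = i + 1" "w i = G i" using eq[OF i(1)] by (simp_all add: w_def)
      thus ?thesis using k by auto
    next
      case False
      have "mtop (m * 7 + (i + 1)) ((1 - d) ^ m * k) (w i)"
        unfolding w_def using False i(2) by (intro mtop_mult mtop_power mtop_Phi k(2)) auto
      moreover have "m * 7 + (i + 1) = l + 1" using eq[OF i(1)] by simp
      moreover have "(1 - d) ^ m * k \<noteq> 0" using d1 k(1) by simp
      ultimately show ?thesis by metis
    qed
  qed
  note vanishing = vanishing_function[OF P1_curve P1y_nz, folded xQ_def yQ_def]
  have curve: "yQ ^ 2 = poly f xQ" if "l mod 7 = i" "i \<in> {1..6}" for i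
    using vf[OF that] vanishing(1) by blast
  have zero: "ev (Phi dd Xt Yt) xQ (- yQ) = 0 \<or> ev (G i) xQ (- yQ) = 0" if "l mod 7 = i" "i \<in> {1..6}" for i
    using vf[OF that] vanishing(2)[of _ "w i"] by (auto simp: w_def simp del: ev_tate)
  \<comment> \<open>A zero of G_i that does not lie over the abscissa of P must lie over xQ.\<close>
  have abscissa: "xQ = tx d + 36 * u"
    if i: "l mod 7 = i" "i \<in> {1..6}" and u: "u \<noteq> 0" and t: "tate_eq d (36 * u) v = 0"
      and g: "\<And>a b. ev Xt a b = 36 * u \<Longrightarrow> ev Yt a b = v \<Longrightarrow> ev (G i) a b = 0" for i u v
  proof -
    define a' where "a' = tx d + 36 * u"
    define b' where "b' = v + 3 * ta1 d * (36 * u) + 108 * te d"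
    have e: "ev Xt a' b' = 36 * u" "ev Yt a' b' = v" by (simp_all add: a'_def b'_def)
    have "b' ^ 2 = poly f a'" using tate_eq_curve[of a' b'] t unfolding e by simp
    moreover have "ev (w i) a' b' = 0" using g[OF e] by (simp add: w_def)
    ultimately have "a' = tx d \<or> a' = xQ" using vf[OF i] vanishing(3)[of _ "w i" b' a'] by blast
    thus ?thesis using u nz36 by (auto simp: a'_def)
  qed
  \<comment> \<open>As -Q does not lie over the abscissa of P, \<open>Phi\<close> is nonzero there,
    and the zero of w at -Q comes from G_i.\<close>
  have ordinate: "ev (G i) xQ (- yQ) = 0"
    if i: "l mod 7 = i" "i \<in> {1..6}" and u: "u \<noteq> 0" "xQ = tx d + 36 * u" for i u
  proof -
    have "ev Xt xQ (- yQ) \<noteq> 0" using u nz36 by simp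
    moreover have "(- yQ) ^ 2 = poly f xQ" using curve[OF i] by simp
    ultimately show ?thesis using zero[OF i] Phi_zero(1)[of "- yQ" xQ] by blast
  qed
  have b_nz: "b \<noteq> 0" and c_nz: "tc \<noteq> 0" using te_nz tc_nz by (auto simp: b_def tc_def)
  have bcd: "b = d * tc" by (simp add: b_def tc_def power2_eq_square power3_eq_cube algebra_simps)
  have te: "te d = - b" by (simp add: te_def b_def)
  have ta: "ta1 d = 1 - tc" by (simp add: ta1_def tc_def)
  define v where "v = ev Yt xQ (- yQ)"
  have yQ: "yQ = - (v + 3 * (1 - tc) * (xQ - tx d) - 108 * b)"
    unfolding v_def by (simp add: ta te algebra_simps)
  have num: "(36::'a) = 6 * 6" "(216::'a) = 6 * 36" by simp_all
  have tate_b: "tate_eq d (36 * b) v = v * (v - 216 * (b * tc))" for v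
    unfolding tate_eq_def b_def tc_def by Groebner_Basis.algebra
  have tate_c: "tate_eq d (36 * tc) v = (v - 216 * tc ^ 2) * (v - 216 * (tc * (d - 1)))" for v
    unfolding tate_eq_def tc_def by Groebner_Basis.algebra
  have g4_c: "g4 d (36 * tc) v = 36 * d ^ 2 * v - 36 * d ^ 2 * (216 * (tc * (d - 1)))" for v
    unfolding g4_def g3_def tc_def by Groebner_Basis.algebra
  have g5_b: "g5 d (36 * b) v = (v - 216 * (b * tc)) * (v - 216 * d ^ 4)" for v
    unfolding g5_def g4_def g3_def b_def tc_def by Groebner_Basis.algebra
  {
    assume i: "l mod 7 = 1"
    have "ev Xt xQ (- yQ) = 0"
      using zero[of 1] i Phi_zero(1)[of "- yQ" xQ] curve[of 1] by (auto simp: G_def simp del: ev_tate ev_X)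
    hence x: "xQ = tx d" by simp
    \<comment> \<open>X vanishes at P and -P alike, but its cofactor, a power of \<open>Phi\<close>,
      vanishes only at P; this selects Q = P.\<close>
    have "w 1 = [:[:- xQ, 1:]:] * Phi dd Xt Yt ^ m" by (simp add: w_def G_def Xt_def x)
    hence e: "eqv (w 1) ([:[:- xQ, 1:]:] * Phi dd Xt Yt ^ m)" by simp
    obtain k where k: "k \<noteq> 0" "mtop (l + 1) k (w 1)" using vf(2)[of 1] i by auto
    have "vanP l (w 1)" using vf(1)[of 1] i by simp
    hence "ev (Phi dd Xt Yt ^ m) xQ yQ = 0" by (rule vanishing(4)[OF k(2,1) _ e])
    hence "ev (Phi dd Xt Yt) xQ yQ = 0" by (simp del: ev_tate)
    hence "ev Yt xQ yQ = 0" using Phi_zero(2)[of yQ xQ] curve[of 1] i by simp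
    thus "xQ = tx d \<and> yQ = 108 * te d" using x by simp
  }
  {
    assume i: "l mod 7 = 6"
    have z: "ev (Phi dd Xt Yt) xQ (- yQ) = 0" using zero[of 6] i by (auto simp: G_def)
    have "(- yQ) ^ 2 = poly f xQ" using curve[of 6] i by simp
    hence "ev Xt xQ (- yQ) = 0" "ev Yt xQ (- yQ) = 0" using Phi_zero z by blast+
    hence x: "xQ = tx d" and "- yQ - 3 * ta1 d * (xQ - tx d) - 108 * te d = 0" by simp_all
    hence "- yQ - 108 * te d = 0" by simp
    hence "- yQ = 108 * te d" by simp
    hence "yQ = - (108 * te d)" by (metis minus_minus)
    hence "yQ = - 108 * te d" by simp
    thus "xQ = tx d \<and> yQ = - 108 * te d" using x by simp
  }
  {
    assume i: "l mod 7 = 2"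
    have x: "xQ = tx d + 36 * b"
    proof (rule abscissa[of 2 b 0])
      show "tate_eq d (36 * b) 0 = 0" by (simp add: tate_b)
    qed (use i b_nz in \<open>simp_all add: G_def\<close>)
    have "v = 0" using ordinate[of 2 b] i b_nz x by (simp add: G_def v_def)
    hence "yQ = 108 * (b * tc)" unfolding yQ x by (simp add: algebra_simps)
    thus "xQ = tx d + 36 * b \<and> yQ = 108 * (b * tc)" using x by simp
  }
  {
    assume i: "l mod 7 = 3"
    have x: "xQ = tx d + 36 * tc"
    proof (rule abscissa[of 3 tc "216 * tc ^ 2"])
      show "tate_eq d (36 * tc) (216 * tc ^ 2) = 0" by (simp add: tate_c)
      show "ev (G 3) a b = 0" if "ev Xt a b = 36 * tc" "ev Yt a b = 216 * tc ^ 2" for a b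
        unfolding G_def using that by (simp del: ev_X ev_Yt add: g3_def power2_eq_square)
    qed (use i c_nz in simp_all)
    have "g3 (36 * tc) v = 0" using ordinate[of 3 tc] i c_nz x by (simp add: G_def v_def del: ev_Yt)
    hence "6 * v = 6 * (216 * tc ^ 2)" by (simp add: g3_def power2_eq_square)
    hence v: "v = 216 * tc ^ 2" using six_nz by (subst (asm) mult_left_cancel) auto
    have "yQ = - 108 * (tc * (d - 1) ^ 2)" unfolding yQ x v bcd unfolding tc_def by Groebner_Basis.algebra
    thus "xQ = tx d + 36 * tc \<and> yQ = - 108 * (tc * (d - 1) ^ 2)" using x by simp
  }
  {
    assume i: "l mod 7 = 4"
    have x: "xQ = tx d + 36 * tc"
    proof (rule abscissa[of 4 tc "216 * (tc * (d - 1))"])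
      show "tate_eq d (36 * tc) (216 * (tc * (d - 1))) = 0" by (simp add: tate_c)
      have "g4 d (36 * tc) (216 * (tc * (d - 1))) = 0" by (simp add: g4_c)
      thus "ev (G 4) a b = 0" if "ev Xt a b = 36 * tc" "ev Yt a b = 216 * (tc * (d - 1))" for a b
        unfolding G_def using that by (simp del: ev_X ev_Yt)
    qed (use i c_nz in simp_all)
    have "g4 d (36 * tc) v = 0" using ordinate[of 4 tc] i c_nz x by (simp add: G_def v_def del: ev_Yt)
    hence "36 * d ^ 2 * v = 36 * d ^ 2 * (216 * (tc * (d - 1)))" by (simp only: g4_c right_minus_eq)
    hence v: "v = 216 * (tc * (d - 1))" using nz36 d0 by (subst (asm) mult_left_cancel) auto
    have "yQ = 108 * (tc * (d - 1) ^ 2)" unfolding yQ x v bcd unfolding tc_def by Groebner_Basis.algebra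
    thus "xQ = tx d + 36 * tc \<and> yQ = 108 * (tc * (d - 1) ^ 2)" using x by simp
  }
  {
    assume i: "l mod 7 = 5"
    have x: "xQ = tx d + 36 * b"
    proof (rule abscissa[of 5 b "216 * (b * tc)"])
      show "tate_eq d (36 * b) (216 * (b * tc)) = 0" by (simp add: tate_b)
      have "g5 d (36 * b) (216 * (b * tc)) = 0" by (simp add: g5_b)
      thus "ev (G 5) a b' = 0" if "ev Xt a b' = 36 * b" "ev Yt a b' = 216 * (b * tc)" for a b'
        unfolding G_def using that by (simp del: ev_X ev_Yt)
    qed (use i b_nz in simp_all)
    \<comment> \<open>\<open>g5\<close> is quadratic in v over this abscissa, so the equation of the
      curve is needed to single out the right root.\<close>
    have g: "g5 d (36 * b) v = 0" using ordinate[of 5 b] i b_nz x by (simp add: G_def v_def del: ev_Yt)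
    have "(- yQ) ^ 2 = poly f xQ" using curve[of 5] i by simp
    from tate_eq_ev[OF this] have "tate_eq d (36 * b) v = 0" using x by (simp add: v_def)
    hence "v = 0 \<or> v = 216 * (b * tc)" by (simp add: tate_b)
    moreover have "v \<noteq> 0"
    proof
      assume "v = 0"
      hence "(0 - 216 * (b * tc)) * (0 - 216 * d ^ 4) = 0" using g by (simp only: g5_b)
      hence "216 * (b * tc) = 0 \<or> 216 * d ^ 4 = 0" by (simp only: mult_eq_0_iff diff_0 neg_equal_0_iff_equal)
      thus False using nz216 b_nz c_nz d0 by simp
    qed
    ultimately have v: "v = 216 * (b * tc)" by simp
    have "yQ = - 108 * (b * tc)" unfolding yQ x v by (simp add: algebra_simps)
    thus "xQ = tx d + 36 * b \<and> yQ = - 108 * (b * tc)" using x by simp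
  }
qed

end

section \<open>The parameter d and its image under the l^2-Frobenius\<close>

text \<open>The left-hand side is the derivative of the cubic at P, hence 2 y_P times the slope 3
  a_1 of the tangent Y = 0. It recovers a_1 from the Weierstrass data.\<close>

lemma tate_slope: "3 * tx d ^ 2 + tA d = 648 * ta1 d * te (d :: 'a::field)"
  unfolding tA_altdef tx_def by Groebner_Basis.algebra

text \<open>The derivative of the cubic at P scales by v^4 and y_P by v^3, so a_1 scales by v. Then
  12 a_2 = tx - 3 a_1^2 scales by v^2 but a_3 by v^3, and a_2 = a_3 is nonzero; hence v = 1.\<close>

lemma tate_parameter_unique:
  fixes d d' :: "'a::field"
  assumes "tA d' = v ^ 4 * tA d" "tx d' = v ^ 2 * tx d" "te d' = v ^ 3 * te d"
    and "te d' \<noteq> 0" and "(2::'a) \<noteq> 0" "(3::'a) \<noteq> 0"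
  shows "d' = d" and "v = 1"
proof -
  have nz: "(648::'a) \<noteq> 0" "(12::'a) \<noteq> 0"
  proof -
    have "(648::'a) = 2 * 2 * 2 * 3 * 3 * 3 * 3" "(12::'a) = 2 * 2 * 3" by simp_all
    thus "(648::'a) \<noteq> 0" "(12::'a) \<noteq> 0" using assms(5,6) by (simp_all only: mult_eq_0_iff simp_thms)
  qed
  have v: "v \<noteq> 0" and te: "te d \<noteq> 0" using assms(3,4) by auto
  have "648 * ta1 d' * te d' = v ^ 4 * (648 * ta1 d * te d)"
    unfolding tate_slope[symmetric] assms(1,2) by Groebner_Basis.algebra
  hence "(648 * (v ^ 3 * te d)) * ta1 d' = (648 * (v ^ 3 * te d)) * (v * ta1 d)"
    unfolding assms(3) by (simp add: eval_nat_numeral algebra_simps)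
  hence a: "ta1 d' = v * ta1 d" using nz v te by (subst (asm) mult_left_cancel) auto
  have "12 * te d' = tx d' - 3 * ta1 d' ^ 2" unfolding tx_def by Groebner_Basis.algebra
  also have "\<dots> = v ^ 2 * (tx d - 3 * ta1 d ^ 2)" unfolding assms(2) a by Groebner_Basis.algebra
  also have "\<dots> = v ^ 2 * (12 * te d)" unfolding tx_def by Groebner_Basis.algebra
  finally have "(12 * (v ^ 2 * te d)) * v = (12 * (v ^ 2 * te d)) * 1"
    unfolding assms(3) by (simp add: eval_nat_numeral algebra_simps)
  thus v1: "v = 1" using nz v te by (subst (asm) mult_left_cancel) auto
  have t: "d' - d' ^ 2 = d - d ^ 2" using a v1 by (simp add: ta1_def algebra_simps)
  have "te d' = d' * (d' - d' ^ 2)" "te d = d * (d - d ^ 2)"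
    by (simp_all add: te_def eval_nat_numeral algebra_simps)
  with t assms(3,4) v1 show "d' = d" by auto
qed

text \<open>Scaling by v = d^2 carries the curve with parameter (d - 1)/d and its point P to the
  curve with parameter d and its point 2P: the powers of d are v^4, v^6, v^2 and v^3.\<close>

lemma tate_double:
  fixes d :: "'a::field"
  assumes "d \<noteq> 0"
  shows "d ^ 8 * tA ((d - 1) / d) = tA d"
    and "d ^ 12 * tB ((d - 1) / d) = tB d"
    and "d ^ 4 * tx ((d - 1) / d) = tx d + 36 * (d ^ 3 - d ^ 2)"
    and "d ^ 6 * te ((d - 1) / d) = (d ^ 3 - d ^ 2) * (d ^ 2 - d)"
proof -
  define s where "s = (d - 1) / d"
  have s: "d * s = d - 1" using assms by (simp add: s_def)
  have a: "d ^ 2 * ta1 s = d ^ 2 + d * (d - 1) - (d - 1) ^ 2"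
    unfolding ta1_def s[symmetric] by Groebner_Basis.algebra
  have e: "d ^ 3 * te s = d * (d - 1) ^ 2 - (d - 1) ^ 3"
    unfolding te_def s[symmetric] by Groebner_Basis.algebra
  have b: "d ^ 4 * (ta1 s ^ 2 + 4 * te s) = (d ^ 2 * ta1 s) ^ 2 + 4 * d * (d ^ 3 * te s)"
    by Groebner_Basis.algebra
  have "d ^ 8 * tA s = - 27 * ((d ^ 4 * (ta1 s ^ 2 + 4 * te s)) ^ 2 - 24 * d ^ 3 * (d ^ 2 * ta1 s) * (d ^ 3 * te s))"
    unfolding tA_altdef by Groebner_Basis.algebra
  also have "\<dots> = tA d" unfolding b unfolding a e unfolding tA_altdef ta1_def te_def by Groebner_Basis.algebra
  finally show "d ^ 8 * tA ((d - 1) / d) = tA d" unfolding s_def .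
  have "d ^ 12 * tB s = 54 * ((d ^ 4 * (ta1 s ^ 2 + 4 * te s)) ^ 3
      - 36 * d ^ 3 * (d ^ 4 * (ta1 s ^ 2 + 4 * te s)) * (d ^ 2 * ta1 s) * (d ^ 3 * te s) + 216 * d ^ 6 * (d ^ 3 * te s) ^ 2)"
    unfolding tB_altdef by Groebner_Basis.algebra
  also have "\<dots> = tB d" unfolding b unfolding a e unfolding tB_altdef ta1_def te_def by Groebner_Basis.algebra
  finally show "d ^ 12 * tB ((d - 1) / d) = tB d" unfolding s_def .
  have "d ^ 4 * tx s = 3 * (d ^ 4 * (ta1 s ^ 2 + 4 * te s))" unfolding tx_def by Groebner_Basis.algebra
  also have "\<dots> = tx d + 36 * (d ^ 3 - d ^ 2)" unfolding b unfolding a e unfolding tx_def ta1_def te_def by Groebner_Basis.algebra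
  finally show "d ^ 4 * tx ((d - 1) / d) = tx d + 36 * (d ^ 3 - d ^ 2)" unfolding s_def .
  have "d ^ 6 * te s = d ^ 3 * (d ^ 3 * te s)" by Groebner_Basis.algebra
  also have "\<dots> = (d ^ 3 - d ^ 2) * (d ^ 2 - d)" unfolding e by Groebner_Basis.algebra
  finally show "d ^ 6 * te ((d - 1) / d) = (d ^ 3 - d ^ 2) * (d ^ 2 - d)" unfolding s_def .
qed

text \<open>The same for the point 4P, with the scaling v = (1 - d)^2.\<close>

lemma tate_quadruple:
  fixes d :: "'a::field"
  assumes "d \<noteq> 1"
  shows "(1 - d) ^ 8 * tA (1 / (1 - d)) = tA d"
    and "(1 - d) ^ 12 * tB (1 / (1 - d)) = tB d"
    and "(1 - d) ^ 4 * tx (1 / (1 - d)) = tx d + 36 * (d ^ 2 - d)"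
    and "(1 - d) ^ 6 * te (1 / (1 - d)) = (d ^ 2 - d) * (d - 1) ^ 2"
proof -
  define s where "s = 1 / (1 - d)"
  define k where "k = 1 - d"
  have s: "k * s = 1" using assms by (simp add: s_def k_def)
  have a: "k ^ 2 * ta1 s = k ^ 2 + k - 1"
  proof -
    have "k ^ 2 * ta1 s = k ^ 2 + k * (k * s) - (k * s) ^ 2" unfolding ta1_def by Groebner_Basis.algebra
    thus ?thesis unfolding s by simp
  qed
  have e: "k ^ 3 * te s = k - 1"
  proof -
    have "k ^ 3 * te s = k * (k * s) ^ 2 - (k * s) ^ 3" unfolding te_def by Groebner_Basis.algebra
    thus ?thesis unfolding s by simp
  qed
  have b: "k ^ 4 * (ta1 s ^ 2 + 4 * te s) = (k ^ 2 * ta1 s) ^ 2 + 4 * k * (k ^ 3 * te s)"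
    by Groebner_Basis.algebra
  have "k ^ 8 * tA s = - 27 * ((k ^ 4 * (ta1 s ^ 2 + 4 * te s)) ^ 2 - 24 * k ^ 3 * (k ^ 2 * ta1 s) * (k ^ 3 * te s))"
    unfolding tA_altdef by Groebner_Basis.algebra
  also have "\<dots> = tA d" unfolding b unfolding a e unfolding tA_altdef ta1_def te_def k_def by Groebner_Basis.algebra
  finally show "(1 - d) ^ 8 * tA (1 / (1 - d)) = tA d" unfolding s_def k_def .
  have "k ^ 12 * tB s = 54 * ((k ^ 4 * (ta1 s ^ 2 + 4 * te s)) ^ 3
      - 36 * k ^ 3 * (k ^ 4 * (ta1 s ^ 2 + 4 * te s)) * (k ^ 2 * ta1 s) * (k ^ 3 * te s) + 216 * k ^ 6 * (k ^ 3 * te s) ^ 2)"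
    unfolding tB_altdef by Groebner_Basis.algebra
  also have "\<dots> = tB d" unfolding b unfolding a e unfolding tB_altdef ta1_def te_def k_def by Groebner_Basis.algebra
  finally show "(1 - d) ^ 12 * tB (1 / (1 - d)) = tB d" unfolding s_def k_def .
  have "k ^ 4 * tx s = 3 * (k ^ 4 * (ta1 s ^ 2 + 4 * te s))" unfolding tx_def by Groebner_Basis.algebra
  also have "\<dots> = tx d + 36 * (d ^ 2 - d)" unfolding b unfolding a e unfolding tx_def ta1_def te_def k_def by Groebner_Basis.algebra
  finally show "(1 - d) ^ 4 * tx (1 / (1 - d)) = tx d + 36 * (d ^ 2 - d)" unfolding s_def k_def .
  have "k ^ 6 * te s = k ^ 3 * (k ^ 3 * te s)" by Groebner_Basis.algebra
  also have "\<dots> = (d ^ 2 - d) * (d - 1) ^ 2" unfolding e unfolding k_def by Groebner_Basis.algebra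
  finally show "(1 - d) ^ 6 * te (1 / (1 - d)) = (d ^ 2 - d) * (d - 1) ^ 2" unfolding s_def k_def .
qed

context tate_supersingular
begin

lemma frob_simps:
  "(z + w) ^ (l ^ k) = z ^ (l ^ k) + (w ^ (l ^ k) :: 'a)"
  "(z - w) ^ (l ^ k) = z ^ (l ^ k) - (w ^ (l ^ k) :: 'a)"
  "(numeral j :: 'a) ^ (l ^ k) = numeral j"
proof -
  show add: "(z + w) ^ (l ^ k) = z ^ (l ^ k) + (w ^ (l ^ k) :: 'a)" for z w
    by (rule freshmans_dream'[where n = k]) (simp_all add: char prime_l)
  show "(z - w) ^ (l ^ k) = z ^ (l ^ k) - (w ^ (l ^ k) :: 'a)"
    using add[of "z - w" w] by simp
  have "(of_nat n :: 'a) ^ (l ^ k) = of_nat n" for n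
    by (induction k) (simp_all add: power_mult of_nat_power_l mult.commute)
  from this[of "numeral j"] show "(numeral j :: 'a) ^ (l ^ k) = numeral j" by simp
qed

lemma frob_power: "(z ^ n) ^ (l ^ k) = (z ^ (l ^ k)) ^ n" for z :: 'a
  by (simp add: power_mult[symmetric] mult.commute)

lemma frob_tate:
  fixes z :: 'a
  shows "ta1 z ^ (l ^ k) = ta1 (z ^ (l ^ k))" "te z ^ (l ^ k) = te (z ^ (l ^ k))" "tx z ^ (l ^ k) = tx (z ^ (l ^ k))"
    "tA z ^ (l ^ k) = tA (z ^ (l ^ k))" "tB z ^ (l ^ k) = tB (z ^ (l ^ k))"
proof -
  show a: "ta1 z ^ (l ^ k) = ta1 (z ^ (l ^ k))" and e: "te z ^ (l ^ k) = te (z ^ (l ^ k))"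
    by (simp_all only: ta1_def te_def frob_simps frob_power power_one)
  show "tx z ^ (l ^ k) = tx (z ^ (l ^ k))"
    by (simp only: tx_def frob_simps frob_power power_mult_distrib a e)
  have m: "(- t) ^ (l ^ k) = - (t ^ (l ^ k))" for t :: 'a using odd_l by simp
  show "tA z ^ (l ^ k) = tA (z ^ (l ^ k))"
    by (simp only: tA_altdef frob_simps frob_power power_mult_distrib a e m)
  show "tB z ^ (l ^ k) = tB (z ^ (l ^ k))"
    by (simp only: tB_altdef frob_simps frob_power power_mult_distrib a e m)
qed

abbreviation "d2 \<equiv> d ^ (l ^ 2)"

lemma te_d2_nz: "te d2 \<noteq> 0"
  using te_nz frob_tate(2)[of d 2] by (metis te_def power_eq_0_iff)

text \<open>The curve with the point [l]P arises from the parameter d^(l^2) with its point P by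
  scaling with -C, and by assumption from the parameter s with \<sigma> P by scaling with v.
  Uniqueness of the parameter identifies the two and gives -C = \<sigma> v.\<close>

lemma parameter_eq:
  assumes "v \<noteq> 0" "v ^ 4 * tA s = tA d" "C ^ 2 * tx d ^ (l * l) = v ^ 2 * tx s"
    and "- (C ^ 3 * (108 * te d) ^ (l * l)) = 108 * (\<sigma> * (v ^ 3 * te s))" "\<sigma> = 1 \<or> \<sigma> = - 1"
  shows "d2 = s \<and> C = - \<sigma> * v"
proof -
  have ll: "l * l = l ^ 2" by (simp add: power2_eq_square)
  have nz108: "(108::'a) \<noteq> 0" using P1y_nz by auto
  have "tA s = (- \<sigma> * C / v) ^ 4 * tA d2"
  proof -
    have "v ^ 4 * tA s = C ^ 4 * tA d2" using assms(2) frobenius_scaling(2) frob_tate(4)[of d 2] ll by simp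
    thus ?thesis using assms(1,5) by (auto simp: field_simps power_divide)
  qed
  moreover have "tx s = (- \<sigma> * C / v) ^ 2 * tx d2"
  proof -
    have "v ^ 2 * tx s = C ^ 2 * tx d2" using assms(3) frob_tate(3)[of d 2] ll by simp
    thus ?thesis using assms(1,5) by (auto simp: field_simps power_divide)
  qed
  moreover have te: "te s = (- \<sigma> * C / v) ^ 3 * te d2"
  proof -
    have "(108 * te d) ^ (l * l) = 108 * te d2"
      unfolding ll power_mult_distrib frob_simps frob_tate(2) ..
    hence "108 * (\<sigma> * (v ^ 3 * te s)) = - (C ^ 3 * (108 * te d2))" using assms(4) by (simp only:)
    also have "\<dots> = 108 * (- (C ^ 3 * te d2))" by (simp add: mult_ac)
    finally have "108 * (\<sigma> * (v ^ 3 * te s)) = 108 * (- (C ^ 3 * te d2))" .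
    hence "\<sigma> * (v ^ 3 * te s) = - (C ^ 3 * te d2)" using nz108 by (subst (asm) mult_left_cancel) auto
    thus ?thesis using assms(1,5) by (auto simp: field_simps power_divide)
  qed
  moreover have "te s \<noteq> 0"
    using te te_d2_nz C_nz assms(1,5) by auto
  ultimately have "s = d2" "- \<sigma> * C / v = 1"
    using tate_parameter_unique[of s "- \<sigma> * C / v" d2] numeral_nz by blast+
  moreover have "- \<sigma> * C = v"
  proof -
    have "- \<sigma> * C / v * v = v" using calculation(2) by simp
    thus ?thesis using assms(1) by simp
  qed
  ultimately show ?thesis using assms(5) by auto
qed

text \<open>The residues 6, 5 and 3 are the negatives of 1, 2 and 4: the parameter is the same and C
  changes its sign.\<close>

lemma frobenius_square:
  shows "l mod 7 = 1 \<Longrightarrow> d2 = d \<and> C = - 1"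
    and "l mod 7 = 6 \<Longrightarrow> d2 = d \<and> C = 1"
    and "l mod 7 = 2 \<Longrightarrow> d2 = (d - 1) / d \<and> C = - (d ^ 2)"
    and "l mod 7 = 5 \<Longrightarrow> d2 = (d - 1) / d \<and> C = d ^ 2"
    and "l mod 7 = 4 \<Longrightarrow> d2 = 1 / (1 - d) \<and> C = - ((1 - d) ^ 2)"
    and "l mod 7 = 3 \<Longrightarrow> d2 = 1 / (1 - d) \<and> C = (1 - d) ^ 2"
proof -
  note T = tate_multiplication_by_l
  note dbl = tate_double[OF d0] and quad = tate_quadruple[OF d1]
  have dnz: "d ^ 2 \<noteq> 0" "(1 - d) ^ 2 \<noteq> 0" using d0 d1 by auto
  have pw: "(z ^ 2) ^ 4 = z ^ 8" "(z ^ 2) ^ 2 = z ^ 4" "(z ^ 2) ^ 3 = z ^ 6" for z :: 'a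
    by (simp_all flip: power_mult)
  show "d2 = d \<and> C = - 1" if "l mod 7 = 1"
    using T(1)[OF that] parameter_eq[of 1 d 1] by simp
  show "d2 = d \<and> C = 1" if "l mod 7 = 6"
    using T(6)[OF that] parameter_eq[of 1 d "- 1"] by simp
  show "d2 = (d - 1) / d \<and> C = - (d ^ 2)" if "l mod 7 = 2"
    using T(2)[OF that] parameter_eq[OF dnz(1), of "(d - 1) / d" 1] by (simp only: pw dbl) simp
  show "d2 = (d - 1) / d \<and> C = d ^ 2" if "l mod 7 = 5"
    using T(5)[OF that] parameter_eq[OF dnz(1), of "(d - 1) / d" "- 1"] by (simp only: pw dbl) simp
  show "d2 = 1 / (1 - d) \<and> C = - ((1 - d) ^ 2)" if "l mod 7 = 4"
    using T(4)[OF that] parameter_eq[OF dnz(2), of "1 / (1 - d)" 1] by (simp only: pw quad) simp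
  show "d2 = 1 / (1 - d) \<and> C = (1 - d) ^ 2" if "l mod 7 = 3"
    using T(3)[OF that] parameter_eq[OF dnz(2), of "1 / (1 - d)" "- 1"] by (simp only: pw quad) simp
qed

text \<open>If Frobenius fixes d, the curve is its own twist and C = 1. This contradicts
  \<open>frobenius_square\<close> for the residues 1 to 5; for 2 to 5 the relation d^2 - d + 1 = 0,
  which d^(l^2) = d imposes there, is used as well.\<close>

lemma no_linear:
  assumes "d ^ l = d"
  shows "l mod 7 = 6 \<or> l mod 7 = 0"
proof -
  have "tA d = 1 ^ 4 * tA d ^ l" "tB d = 1 ^ 6 * tB d ^ l"
    using frob_tate(4,5)[of d 1] assms by simp_all
  hence C1: "C = 1" using C_frobenius_scaling[of 1] by simp
  have "d2 = d" using assms by (simp add: power2_eq_square power_mult)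
  have two: "(2::'a) \<noteq> 0" and three: "(3::'a) \<noteq> 0" by simp_all
  have n1: "\<not> l mod 7 = 1"
  proof
    assume "l mod 7 = 1"
    hence "(1::'a) = - 1" using frobenius_square(1) C1 by simp
    hence "(1::'a) + 1 = 0" by (simp only: eq_neg_iff_add_eq_0)
    thus False using two by simp
  qed
  have pa: "d ^ 2 = d - 1" if "l mod 7 = 2 \<or> l mod 7 = 5"
  proof -
    have "d = (d - 1) / d" using that frobenius_square(3,4) \<open>d2 = d\<close> by auto
    thus ?thesis using d0 by (simp add: field_simps power2_eq_square)
  qed
  have n2: "\<not> l mod 7 = 2"
  proof
    assume l: "l mod 7 = 2"
    have "1 = - (d ^ 2)" using frobenius_square(3)[OF l] C1 by simp
    also have "\<dots> = 1 - d" using pa l by simp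
    finally show False using d0 by simp
  qed
  have n5: "\<not> l mod 7 = 5"
  proof
    assume l: "l mod 7 = 5"
    have "d ^ 2 = 1" using frobenius_square(4)[OF l] C1 by simp
    moreover from this have "d = 2" using pa l by (simp add: eq_diff_eq)
    ultimately have "(4::'a) = 1" by simp
    hence "(4::'a) - 1 = 0" by (simp only: right_minus_eq)
    thus False using three by simp
  qed
  have pa': "(1 - d) ^ 2 = - d" if "l mod 7 = 3 \<or> l mod 7 = 4"
  proof -
    have "d = 1 / (1 - d)" using that frobenius_square(5,6) \<open>d2 = d\<close> by auto
    hence "d * (1 - d) = 1" using d1 by (simp add: field_simps)
    moreover have "(1 - d) ^ 2 = 1 - d - d * (1 - d)" by (simp add: power2_eq_square algebra_simps)
    ultimately show ?thesis by simp
  qed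
  have n4: "\<not> l mod 7 = 4"
  proof
    assume l: "l mod 7 = 4"
    have "1 = - ((1 - d) ^ 2)" using frobenius_square(5)[OF l] C1 by simp
    also have "\<dots> = d" using pa' l by simp
    finally show False using d1 by simp
  qed
  have n3: "\<not> l mod 7 = 3"
  proof
    assume l: "l mod 7 = 3"
    have e: "1 = (1 - d) ^ 2" using frobenius_square(6)[OF l] C1 by simp
    hence "1 = - d" using pa' l by simp
    hence "d = - 1" by (metis minus_minus)
    hence "(4::'a) = 1" using e by simp
    hence "(4::'a) - 1 = 0" by (simp only: right_minus_eq)
    thus False using three by simp
  qed
  show ?thesis using n1 n2 n3 n4 n5 by presburger
qed

text \<open>The l^2-Frobenius acts on d by a Moebius map, so under the hypothesis d^l is the image
  of d under the inverse map. The curve is then isomorphic to its twist, with scaling d^2 or (1 -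
  d)^2, and the resulting C is the negative of the one in \<open>frobenius_square\<close>.\<close>

lemma no_cubic:
  assumes "d ^ (l ^ 3) = d" "l mod 7 = 2 \<or> l mod 7 = 4"
  shows False
proof -
  define \<delta> where "\<delta> = d ^ l"
  have \<delta>0: "\<delta> \<noteq> 0" using d0 by (simp add: \<delta>_def)
  have frob1: "(1 - z) ^ l = 1 - z ^ l" for z :: 'a using frob_simps(2)[of 1 z 1] by simp
  have "\<delta> \<noteq> 1"
  proof
    assume "\<delta> = 1"
    hence "(1 - d) ^ l = 0" by (simp add: frob1 \<delta>_def)
    thus False using d1 by simp
  qed
  have d3: "d2 ^ l = d" using assms(1) by (simp add: power_mult[symmetric] power3_eq_cube power2_eq_square)
  have AB: "tA d ^ l = tA \<delta>" "tB d ^ l = tB \<delta>" using frob_tate(4,5)[of d 1] by (simp_all add: \<delta>_def)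
  have two: "(2::'a) \<noteq> 0" by simp
  show False
  proof (cases "l mod 7 = 4")
    case True
    note F = frobenius_square(5)[OF True]
    have "d = 1 / (1 - \<delta>)" using d3 F by (simp add: power_divide frob1 \<delta>_def)
    hence "d * (1 - \<delta>) = 1" using \<open>\<delta> \<noteq> 1\<close> by (simp add: field_simps)
    hence de: "\<delta> = (d - 1) / d" using d0 by (simp add: field_simps)
    have "tA d = (d ^ 2) ^ 4 * tA d ^ l" "tB d = (d ^ 2) ^ 6 * tB d ^ l"
      using tate_double(1,2)[OF d0] by (simp_all add: AB de flip: power_mult)
    hence "C = (d ^ 2) ^ (l + 1)" using d0 by (intro C_frobenius_scaling) auto
    also have "\<dots> = (d * \<delta>) ^ 2" by (simp add: \<delta>_def power_mult_distrib power_mult[symmetric] mult.commute)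
    also have "d * \<delta> = d - 1" using d0 by (simp add: de)
    also have "(d - 1) ^ 2 = (1 - d) ^ 2" by (simp add: power2_eq_square algebra_simps)
    finally have "(1 - d) ^ 2 = - ((1 - d) ^ 2)" using F by simp
    hence "(1 - d) ^ 2 + (1 - d) ^ 2 = 0" by (simp only: eq_neg_iff_add_eq_0)
    hence "2 * (1 - d) ^ 2 = 0" by simp
    thus False using two d1 by simp
  next
    case False
    hence True: "l mod 7 = 2" using assms(2) by simp
    note F = frobenius_square(3)[OF True]
    have sub1: "(d - 1) ^ l = \<delta> - 1" using frob_simps(2)[of d 1 1] by (simp add: \<delta>_def)
    have "d = (\<delta> - 1) / \<delta>" using d3 F by (simp add: power_divide sub1) (simp add: \<delta>_def)
    hence "\<delta> * (1 - d) = 1" using \<delta>0 by (simp add: field_simps)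
    hence de: "\<delta> = 1 / (1 - d)" using d1 by (simp add: field_simps)
    have "tA d = ((1 - d) ^ 2) ^ 4 * tA d ^ l" "tB d = ((1 - d) ^ 2) ^ 6 * tB d ^ l"
      using tate_quadruple(1,2)[OF d1] by (simp_all add: AB de flip: power_mult)
    hence "C = ((1 - d) ^ 2) ^ (l + 1)" using d1 by (intro C_frobenius_scaling) auto
    also have "\<dots> = ((1 - d) * (1 - d) ^ l) ^ 2" by (simp add: power_mult_distrib power_mult[symmetric] mult.commute)
    also have "(1 - d) * (1 - d) ^ l = - d"
    proof -
      have "(1 - d) * (1 - d) ^ l = (1 - d) * (1 - \<delta>)" by (simp add: frob1 \<delta>_def)
      also have "\<dots> = (1 - d) - \<delta> * (1 - d)" by (simp add: algebra_simps)
      finally show ?thesis using \<open>\<delta> * (1 - d) = 1\<close> by simp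
    qed
    finally have "d ^ 2 = - (d ^ 2)" using F by simp
    hence "d ^ 2 + d ^ 2 = 0" by (simp only: eq_neg_iff_add_eq_0)
    hence "2 * d ^ 2 = 0" by simp
    thus False using two d0 by simp
  qed
qed

end

section \<open>The exponents r and s\<close>

lemma Legendre_cong_imp_eq:
  assumes "prime l" "l > 2" "[Legendre a (int l) = e] (mod int l)" "e = 1 \<or> e = - 1"
  shows "Legendre a (int l) = e"
proof (rule ccontr)
  assume ne: "Legendre a (int l) \<noteq> e"
  have "Legendre a (int l) \<in> {-1, 0, 1}" by (simp add: Legendre_def)
  hence "\<bar>Legendre a (int l) - e\<bar> \<le> 2" using assms(4) by auto
  moreover have "int l dvd Legendre a (int l) - e" using assms(3) by (simp add: cong_iff_dvd_diff)
  hence "int l dvd \<bar>Legendre a (int l) - e\<bar>" by simp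
  ultimately have "int l \<le> 2" using ne zdvd_imp_le[of "int l" "\<bar>Legendre a (int l) - e\<bar>"] by auto
  thus False using assms(2) by simp
qed

text \<open>Euler's criterion with (-4)^m = (-1)^m 2^(l-1), where the last factor is 1 modulo l by
  Fermat.\<close>

lemma sl_eq:
  assumes "prime l" "l > 3"
  shows "sl l = (if l mod 4 = 1 then 0 else 1)"
proof -
  define m where "m = (l - 1) div 2"
  have odd: "odd l" using assms prime_odd_nat by auto
  have ml: "l = 2 * m + 1" unfolding m_def using odd by presburger
  have "coprime 2 (int l)" using odd by simp
  hence cop: "[int 2 ^ (l - 1) = 1] (mod int l)"
    using fermat_theorem[OF assms(1), of 2] odd assms
    by (metis cong_int_iff dvd_imp_le even_Suc even_zero nat_dvd_not_less of_nat_1 of_nat_power pos2 primes_dvd_imp_eq two_is_prime_nat)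
  have "[Legendre (- 4) (int l) = (- 4) ^ m] (mod int l)"
    unfolding m_def by (rule euler_criterion) (use assms in auto)
  also have "(- 4 :: int) ^ m = (- 1) ^ m * int 2 ^ (l - 1)"
    using ml by (simp add: power_mult power_minus[of 4])
  also have "[(- 1) ^ m * int 2 ^ (l - 1) = (- 1) ^ m * 1] (mod int l)"
    by (intro cong_mult cop cong_refl)
  finally have "Legendre (- 4) (int l) = (- 1) ^ m"
    by (intro Legendre_cong_imp_eq) (use assms in \<open>auto simp: minus_one_power_iff\<close>)
  moreover have "even m \<longleftrightarrow> l mod 4 = 1" using ml by presburger
  ultimately show ?thesis by (auto simp: sl_def minus_one_power_iff)
qed

text \<open>By quadratic reciprocity the symbol is that of l modulo 3.\<close>

lemma rl_eq:
  assumes "prime l" "l > 3"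
  shows "rl l = (if l mod 3 = 1 then 0 else 1)"
proof -
  define m where "m = (l - 1) div 2"
  have "[Legendre (- 3) (int l) = (- 3) ^ m] (mod int l)"
    unfolding m_def by (rule euler_criterion) (use assms in auto)
  also have "(- 3 :: int) ^ m = (- 1) ^ m * 3 ^ m" by (simp add: power_minus[of 3])
  also have "[(- 1) ^ m * 3 ^ m = (- 1) ^ m * Legendre 3 (int l)] (mod int l)"
    unfolding m_def by (intro cong_mult cong_refl cong_sym[OF euler_criterion]) (use assms in auto)
  finally have c1: "[Legendre (- 3) (int l) = (- 1) ^ m * Legendre 3 (int l)] (mod int l)" .
  have l3: "\<not> 3 dvd l" using assms primes_dvd_imp_eq[of 3 l] by auto
  have leg: "Legendre (int l) 3 = (if l mod 3 = 1 then 1 else - 1)"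
  proof -
    have "\<not> [int l = 0] (mod 3)" using l3 by (simp add: cong_0_iff int_dvd_int_iff[of 3, simplified])
    moreover have "QuadRes 3 (int l) \<longleftrightarrow> l mod 3 = 1"
    proof
      assume "QuadRes 3 (int l)"
      then obtain z where z: "[z ^ 2 = int l] (mod 3)" by (auto simp: QuadRes_def)
      have "z mod 3 = 0 \<or> z mod 3 = 1 \<or> z mod 3 = 2" by presburger
      hence "z ^ 2 mod 3 = 0 \<or> z ^ 2 mod 3 = 1"
        by (auto simp: power_mod[symmetric, of z])
      hence "int l mod 3 = 0 \<or> int l mod 3 = 1" using z by (simp add: cong_def)
      thus "l mod 3 = 1" using l3 by presburger
    next
      assume "l mod 3 = 1"
      hence "[1 ^ 2 = int l] (mod 3)" unfolding cong_def by simp presburger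
      thus "QuadRes 3 (int l)" unfolding QuadRes_def by blast
    qed
    ultimately show ?thesis by (simp add: Legendre_def)
  qed
  have "Legendre 3 (int l) * Legendre (int l) 3 = (- 1) ^ ((3 - 1) div 2 * ((l - 1) div 2))"
    using Quadratic_Reciprocity[of 3 l] assms by simp
  hence "Legendre 3 (int l) * Legendre (int l) 3 = (- 1) ^ m" by (simp add: m_def)
  hence "(- 1) ^ m * Legendre 3 (int l) = Legendre (int l) 3"
    unfolding leg by (auto simp: minus_one_power_iff split: if_splits)
  hence "Legendre (- 3) (int l) = Legendre (int l) 3"
    using c1 by (intro Legendre_cong_imp_eq) (use assms leg in auto)
  thus ?thesis unfolding rl_def leg by simp
qed

text \<open>With N = 2 n_l + s this reads (l - 1)/2 = 3N + 2r, the shape in which the power of the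
  cubic is expanded.\<close>

lemma l_decomposition:
  assumes "prime l" "l > 3"
  shows "l = 6 * (2 * nl l + sl l) + 4 * rl l + 1" and "rl l \<le> 1" and "sl l \<le> 1"
proof -
  have "odd l" using assms prime_odd_nat by auto
  moreover have "\<not> 3 dvd l" using assms primes_dvd_imp_eq[of 3 l] by auto
  ultimately have t: "l mod 12 = 1 \<or> l mod 12 = 5 \<or> l mod 12 = 7 \<or> l mod 12 = 11" by presburger
  have m: "l mod 4 = l mod 12 mod 4" "l mod 3 = l mod 12 mod 3" by (simp_all add: mod_mod_cancel)
  have "12 * q + t = 6 * (2 * q + (if t mod 4 = 1 then 0 else 1)) + 4 * (if t mod 3 = 1 then 0 else 1) + 1"
    if "t = 1 \<or> t = 5 \<or> t = 7 \<or> t = 11" for q t :: nat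
    using that by (elim disjE) simp_all
  from this[OF t, of "l div 12"] show "l = 6 * (2 * nl l + sl l) + 4 * rl l + 1"
    unfolding sl_eq[OF assms] rl_eq[OF assms] nl_def m by (simp only: mult_div_mod_eq)
  show "rl l \<le> 1" "sl l \<le> 1" using sl_eq[OF assms] rl_eq[OF assms] by auto
qed

section \<open>\<open>H7\<close> and the Hasse invariant\<close>

lemma homog_comp_add: "homog_comp (p + r) n N D = homog_comp p n N D + homog_comp r n N D"
  by (simp add: homog_comp_def smult_add_left sum.distrib)

lemma homog_comp_smult: "homog_comp (smult k p) n N D = smult k (homog_comp p n N D)"
  by (simp add: homog_comp_def smult_sum2)

lemma homog_comp_sum: "homog_comp (sum g S) n N D = (\<Sum>i\<in>S. homog_comp (g i) n N D)"
  by (induction S rule: infinite_finite_induct) (simp_all add: homog_comp_add, simp_all add: homog_comp_def)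

lemma homog_comp_linear_power:
  fixes N D :: "'a::field poly"
  assumes "k \<le> n"
  shows "homog_comp ([:a, 1:] ^ k) n N D = (N + smult a D) ^ k * D ^ (n - k)"
  using assms
proof (induction k arbitrary: n)
  case 0
  have "homog_comp 1 n N D = (\<Sum>i\<in>{0}. smult (coeff 1 i) (N ^ i * D ^ (n - i)))"
    unfolding homog_comp_def by (rule sum.mono_neutral_right) (auto simp: coeff_1)
  thus ?case by simp
next
  case (Suc k)
  then obtain n' where n: "n = Suc n'" "k \<le> n'" by (cases n) auto
  define J where "J = [:a, 1:] ^ k"
  have J: "coeff J (Suc n') = 0" using n by (simp add: J_def coeff_eq_0 degree_linear_power)
  have 1: "homog_comp J n N D = D * homog_comp J n' N D"
    unfolding homog_comp_def n(1) by (simp add: J sum_distrib_left Suc_diff_le mult_ac)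
  have 2: "homog_comp (pCons 0 J) n N D = N * homog_comp J n' N D"
  proof -
    have "homog_comp (pCons 0 J) n N D = (\<Sum>i=Suc 0..Suc n'. smult (coeff (pCons 0 J) i) (N ^ i * D ^ (n - i)))"
      unfolding homog_comp_def n(1) by (subst sum.atLeast_Suc_atMost) simp_all
    also have "\<dots> = (\<Sum>i=0..n'. smult (coeff J i) (N ^ Suc i * D ^ (n' - i)))"
      unfolding sum.shift_bounds_cl_Suc_ivl by (simp add: n(1))
    finally show ?thesis by (simp add: homog_comp_def sum_distrib_left mult_ac)
  qed
  have "[:a, 1:] ^ Suc k = smult a J + pCons 0 J" by (simp add: J_def)
  hence "homog_comp ([:a, 1:] ^ Suc k) n N D = (N + smult a D) * homog_comp J n' N D"
    by (simp only: homog_comp_add homog_comp_smult 1 2) (simp add: algebra_simps)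
  also have "homog_comp J n' N D = (N + smult a D) ^ k * D ^ (n' - k)"
    unfolding J_def using Suc.IH n(2) by blast
  finally show ?case by (simp add: n mult_ac)
qed

text \<open>This is 1728 \<Delta> = c_4^3 - c_6^2, with \<open>den7\<close> as the discriminant
  \<Delta>.\<close>

lemma discriminant_identity:
  fixes d :: "'a::field"
  shows "poly num7 d - 1728 * poly den7 d = poly f2 d ^ 2"
proof -
  have "poly num7 d - 1728 * poly den7 d = (poly p_a d * poly p_b d) ^ 3 - 1728 * (d ^ 7 * (d - 1) ^ 7 * poly p_c d)"
    by (simp add: num7_def den7_def power_mult_distrib)
  also have "\<dots> = poly f2 d ^ 2"
    by (simp add: p_a_def p_b_def p_c_def f2_def) Groebner_Basis.algebra
  finally show ?thesis .
qed

text \<open>As j - 1728 = f2^2 / den7, clearing denominators leaves only powers of f2(d) and of -432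
  den7(d).\<close>

lemma poly_H7:
  fixes d :: "'a::field" and l :: nat
  defines "n \<equiv> nl l" and "s \<equiv> sl l"
  shows "poly (H7 l) d = (poly p_a d * poly p_b d) ^ rl l *
    (\<Sum>k=0..n. of_nat ((2 * n + s) choose (2 * k + s)) * of_nat ((2 * n - 2 * k) choose (n - k))
        * (- 432 * poly den7 d) ^ (n - k) * poly f2 d ^ (2 * k + s))"
proof -
  have "homog_comp (J_poly l) n num7 den7 =
     (\<Sum>k=0..n. smult (of_int (int ((2*n + s) choose (2*k + s)) * int ((2*n - 2*k) choose (n - k)) * (-432) ^ (n - k)))
        (homog_comp ([:-1728, 1:] ^ k) n num7 den7 :: 'a poly))"
    unfolding J_poly_def Let_def n_def s_def by (simp only: homog_comp_sum homog_comp_smult)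
  also have "\<dots> = (\<Sum>k=0..n. smult (of_int (int ((2*n + s) choose (2*k + s)) * int ((2*n - 2*k) choose (n - k)) * (-432) ^ (n - k)))
        ((num7 + smult (- 1728) den7) ^ k * den7 ^ (n - k)))"
    by (intro sum.cong refl) (simp add: homog_comp_linear_power)
  finally have h: "poly (homog_comp (J_poly l) n num7 den7) d = (\<Sum>k=0..n. of_nat ((2 * n + s) choose (2 * k + s)) * of_nat ((2 * n - 2 * k) choose (n - k))
        * (- 432) ^ (n - k) * ((poly num7 d - 1728 * poly den7 d) ^ k * poly den7 d ^ (n - k)))"
    by (simp add: poly_sum)
  have "poly f2 d ^ s * poly (homog_comp (J_poly l) n num7 den7) d = 
    (\<Sum>k=0..n. of_nat ((2 * n + s) choose (2 * k + s)) * of_nat ((2 * n - 2 * k) choose (n - k))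
        * (- 432 * poly den7 d) ^ (n - k) * poly f2 d ^ (2 * k + s))"
    unfolding h discriminant_identity sum_distrib_left
    by (intro sum.cong refl) (simp only: power_mult_distrib power_add power_mult[symmetric] ac_simps)
  thus ?thesis unfolding H7_def n_def[symmetric] s_def[symmetric]
    by (simp add: power_mult_distrib mult.assoc)
qed

lemma coeff_pure_quadratic_power:
  "coeff ([:S, 0, 1:] ^ n) n = (if even n then of_nat (n choose (n div 2)) * S ^ (n div 2) else (0::'a::comm_ring_1))"
proof -
  have "[:S, 0, 1:] = monom 1 2 + [:S:]" by (simp add: monom_altdef numeral_2_eq_2)
  hence "coeff ([:S, 0, 1:] ^ n) n = (\<Sum>k\<le>n. of_nat (n choose k) * (S ^ (n - k) * (if 2 * k = n then 1 else 0)))"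
    by (simp add: binomial_ring coeff_sum of_nat_poly monom_power poly_const_pow mult_ac)
  also have "\<dots> = (if even n then of_nat (n choose (n div 2)) * S ^ (n div 2) else 0)"
  proof (cases "even n")
    case True
    then obtain j where j: "n = 2 * j" by auto
    have "(\<Sum>k\<le>n. of_nat (n choose k) * (S ^ (n - k) * (if 2 * k = n then 1 else 0)))
        = (\<Sum>k\<in>{j}. of_nat (n choose k) * (S ^ (n - k) * (if 2 * k = n then 1 else (0::'a))))"
      by (rule sum.mono_neutral_right) (auto simp: j)
    thus ?thesis by (simp add: j)
  next
    case False
    hence "2 * k \<noteq> n" for k by auto
    thus ?thesis using False by simp
  qed
  finally show ?thesis .
qed

text \<open>The right-hand side is the sum in \<open>poly_H7\<close>, with F = f2(d) and S = -432
  den7(d).\<close>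

lemma coeff_quadratic_power:
  fixes S F :: "'a::comm_ring_1"
  assumes "s \<le> 1"
  shows "coeff ([:S, F, 1:] ^ (2 * n + s)) (2 * n + s) =
    (\<Sum>k=0..n. of_nat ((2 * n + s) choose (2 * k + s)) * of_nat ((2 * n - 2 * k) choose (n - k)) * S ^ (n - k) * F ^ (2 * k + s))"
proof -
  define N where "N = 2 * n + s"
  have q: "[:S, F, 1:] = monom F (Suc 0) + [:S, 0, 1:]" by (simp add: monom_altdef)
  define t where "t j = of_nat (N choose j) * (F ^ j * coeff ([:S, 0, 1:] ^ (N - j)) (N - j))" for j
  have cm: "coeff (monom F (Suc 0) ^ j * p) N = F ^ j * coeff p (N - j)" if "j \<le> N" for j p
    using that by (simp add: monom_power coeff_monom_mult)
  have "coeff ([:S, F, 1:] ^ N) N = (\<Sum>j\<le>N. t j)"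
    unfolding q binomial_ring coeff_sum t_def
    by (intro sum.cong refl) (simp add: of_nat_poly mult.assoc cm)
  also have "\<dots> = (\<Sum>j\<in>(\<lambda>k. 2 * k + s) ` {0..n}. t j)"
  proof (rule sum.mono_neutral_right)
    show "\<forall>j\<in>{..N} - (\<lambda>k. 2 * k + s) ` {0..n}. t j = 0"
    proof
      fix j assume j: "j \<in> {..N} - (\<lambda>k. 2 * k + s) ` {0..n}"
      have "odd (N - j)"
      proof
        assume "even (N - j)"
        then obtain i where "N - j = 2 * i" by (rule evenE)
        hence "j = 2 * (n - i) + s" "i \<le> n" using j assms by (auto simp: N_def)
        thus False using j by auto
      qed
      thus "t j = 0" by (simp add: t_def coeff_pure_quadratic_power)
    qed
  qed (auto simp: N_def)
  also have "\<dots> = (\<Sum>k=0..n. t (2 * k + s))"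
    by (subst sum.reindex) (auto simp: inj_on_def)
  also have "\<dots> = (\<Sum>k=0..n. of_nat (N choose (2 * k + s)) * of_nat ((2 * n - 2 * k) choose (n - k)) * S ^ (n - k) * F ^ (2 * k + s))"
  proof (intro sum.cong refl)
    fix k assume "k \<in> {0..n}"
    have "N - (2 * k + s) = 2 * (n - k)" "2 * n - 2 * k = 2 * (n - k)" by (simp_all add: N_def)
    thus "t (2 * k + s) = of_nat (N choose (2 * k + s)) * of_nat ((2 * n - 2 * k) choose (n - k)) * S ^ (n - k) * F ^ (2 * k + s)"
      unfolding t_def by (simp add: coeff_pure_quadratic_power)
  qed
  finally show ?thesis unfolding N_def .
qed

text \<open>The same middle coefficient in other variables: for the values in question h is -c_6/2
  and E is -c_4^3/4, the quantities in which the Hasse invariant is expanded.\<close>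

lemma coeff_quadratic_power_completed_square:
  fixes h E :: "'a::comm_ring_1"
  shows "coeff (([:h, 1:] ^ 2 + [:E:]) ^ N) N =
    (\<Sum>k=0..N div 2. of_nat (N choose k) * of_nat ((2 * N - 2 * k) choose N) * E ^ k * h ^ (N - 2 * k))"
proof -
  have "coeff (([:h, 1:] ^ 2 + [:E:]) ^ N) N = coeff (([:E:] + [:h, 1:] ^ 2) ^ N) N" by (simp only: add.commute)
  also have "\<dots> = (\<Sum>k\<le>N. of_nat (N choose k) * (E ^ k * coeff ([:h, 1:] ^ (2 * (N - k))) N))"
    unfolding binomial_ring coeff_sum
    by (intro sum.cong refl) (simp add: of_nat_poly poly_const_pow mult.assoc flip: power_mult)
  also have "\<dots> = (\<Sum>k=0..N div 2. of_nat (N choose k) * (E ^ k * coeff ([:h, 1:] ^ (2 * (N - k))) N))"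
  proof (rule sum.mono_neutral_right)
    show "\<forall>k\<in>{..N} - {0..N div 2}. of_nat (N choose k) * (E ^ k * coeff ([:h, 1:] ^ (2 * (N - k))) N) = 0"
    proof
      fix k assume "k \<in> {..N} - {0..N div 2}"
      hence "2 * (N - k) < N" by auto
      moreover have "degree ([:h, 1:] ^ (2 * (N - k))) \<le> 2 * (N - k)"
        using degree_power_le[of "[:h, 1:]" "2 * (N - k)"] by (simp add: degree_pCons_eq_if split: if_splits)
      ultimately have "coeff ([:h, 1:] ^ (2 * (N - k))) N = 0" by (intro coeff_eq_0) linarith
      thus "of_nat (N choose k) * (E ^ k * coeff ([:h, 1:] ^ (2 * (N - k))) N) = 0" by simp
    qed
  qed auto
  also have "\<dots> = (\<Sum>k=0..N div 2. of_nat (N choose k) * of_nat ((2 * N - 2 * k) choose N) * E ^ k * h ^ (N - 2 * k))"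
  proof (intro sum.cong refl)
    fix k assume "k \<in> {0..N div 2}"
    hence "N \<le> 2 * (N - k)" "2 * (N - k) - N = N - 2 * k" by auto
    moreover have "2 * N - 2 * k = 2 * (N - k)" by simp
    ultimately show "of_nat (N choose k) * (E ^ k * coeff ([:h, 1:] ^ (2 * (N - k))) N) =
       of_nat (N choose k) * of_nat ((2 * N - 2 * k) choose N) * E ^ k * h ^ (N - 2 * k)"
      by (simp only: coeff_linear_poly_power power_one mult_1_right mult_1_left ac_simps)
  qed
  finally show ?thesis .
qed

text \<open>The exponent 2m = 6N + 4r is reached by taking x^3 from 2N + r - k factors, A x from 3k
  + r and B from the other N - 2k; thus A occurs as A^r times a power of A^3.\<close>

lemma coeff_cubic_power:
  fixes A B :: "'a::comm_ring_1"
  assumes m: "m = 3 * N + 2 * r" and r: "r \<le> 1"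
  shows "coeff ([:B, A, 0, 1:] ^ m) (2 * m) =
    (\<Sum>k=0..N div 2. of_nat (m choose (2 * N + r - k)) * of_nat ((N + k + r) choose (3 * k + r)) * A ^ (3 * k + r) * B ^ (N - 2 * k))"
proof -
  have q: "[:B, A, 0, 1:] = monom 1 3 + [:B, A:]" by (simp add: monom_altdef numeral_3_eq_3)
  define t where "t i = of_nat (m choose i) * (if 3 * i \<le> 2 * m then coeff ([:B, A:] ^ (m - i)) (2 * m - 3 * i) else 0)" for i
  have cm: "coeff (monom 1 3 ^ i * p) (2 * m) = (if 3 * i \<le> 2 * m then coeff p (2 * m - 3 * i) else (0::'a))" for i p
  proof -
    have "monom (1::'a) 3 ^ i = monom 1 (3 * i)" by (simp add: monom_power mult.commute)
    thus ?thesis by (simp add: coeff_monom_mult)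
  qed
  have "coeff ([:B, A, 0, 1:] ^ m) (2 * m) = (\<Sum>i\<le>m. t i)"
    unfolding q binomial_ring coeff_sum t_def
    by (intro sum.cong refl) (simp add: of_nat_poly mult.assoc cm)
  also have "\<dots> = (\<Sum>i\<in>(\<lambda>k. 2 * N + r - k) ` {0..N div 2}. t i)"
  proof (rule sum.mono_neutral_right)
    show "\<forall>i\<in>{..m} - (\<lambda>k. 2 * N + r - k) ` {0..N div 2}. t i = 0"
    proof
      fix i assume i: "i \<in> {..m} - (\<lambda>k. 2 * N + r - k) ` {0..N div 2}"
      show "t i = 0"
      proof (cases "3 * i \<le> 2 * m")
        case True
        hence le: "i \<le> 2 * N + r" using m r by linarith
        have "2 * N + r - i > N div 2"
        proof (rule ccontr)
          assume "\<not> N div 2 < 2 * N + r - i"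
          moreover have "i = 2 * N + r - (2 * N + r - i)" using le by simp
          ultimately show False using i by auto
        qed
        moreover have "N \<le> 2 * (N div 2) + 1" by presburger
        ultimately have "2 * i < m" using m le by linarith
        hence "2 * m - 3 * i > m - i" using True by linarith
        moreover have "degree ([:B, A:] ^ (m - i)) \<le> m - i"
          using degree_power_le[of "[:B, A:]" "m - i"] by (simp add: degree_pCons_eq_if split: if_splits)
        ultimately show ?thesis by (simp add: t_def coeff_eq_0)
      qed (simp add: t_def)
    qed
    show "(\<lambda>k. 2 * N + r - k) ` {0..N div 2} \<subseteq> {..m}" using m by auto
  qed auto
  also have "\<dots> = (\<Sum>k=0..N div 2. t (2 * N + r - k))"
    by (subst sum.reindex) (auto simp: inj_on_def)
  also have "\<dots> = (\<Sum>k=0..N div 2. of_nat (m choose (2 * N + r - k)) * of_nat ((N + k + r) choose (3 * k + r)) * A ^ (3 * k + r) * B ^ (N - 2 * k))"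
  proof (intro sum.cong refl)
    fix k assume k: "k \<in> {0..N div 2}"
    hence "2 * k \<le> N" by auto
    hence e: "m - (2 * N + r - k) = N + k + r" "2 * m - 3 * (2 * N + r - k) = 3 * k + r" "3 * (2 * N + r - k) \<le> 2 * m"
      "N + k + r - (3 * k + r) = N - 2 * k" "3 * k + r \<le> N + k + r"
      using m r by auto
    show "t (2 * N + r - k) = of_nat (m choose (2 * N + r - k)) * of_nat ((N + k + r) choose (3 * k + r)) * A ^ (3 * k + r) * B ^ (N - 2 * k)"
      unfolding t_def e using e(3,5) by (simp add: coeff_linear_poly_power e(4) mult_ac)
  qed
  finally show ?thesis .
qed

text \<open>Both sides are compared through factorials. Writing N = 2k + 2 + j keeps the factorial
  arguments free of subtraction.\<close>

lemma cubic_term_recurrence: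
  fixes N r k j :: nat
  defines "a \<equiv> \<lambda>k. ((3 * N + 2 * r) choose (2 * N + r - k)) * ((N + k + r) choose (3 * k + r))"
  assumes N: "N = 2 * k + 2 + j"
  shows "a (Suc k) * ((3 * k + r + 1) * (3 * k + r + 2) * (3 * k + r + 3)) = a k * ((3 * k + 4 + 2 * j + r) * (j + 2) * (j + 1))"
proof -
  have a: "a k * (fact (2 * N + r - k) * fact (3 * k + r) * fact (N - 2 * k)) = fact (3 * N + 2 * r)" if "2 * k \<le> N" for k
  proof -
    have 1: "fact (2 * N + r - k) * fact (N + k + r) * ((3 * N + 2 * r) choose (2 * N + r - k)) = fact (3 * N + 2 * r)"
    proof -
      have "3 * N + 2 * r - (2 * N + r - k) = N + k + r" using that by simp
      thus ?thesis using binomial_fact_lemma[of "2 * N + r - k" "3 * N + 2 * r"] by simp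
    qed
    have 2: "fact (3 * k + r) * fact (N - 2 * k) * ((N + k + r) choose (3 * k + r)) = fact (N + k + r)"
    proof -
      have "N + k + r - (3 * k + r) = N - 2 * k" by simp
      thus ?thesis using binomial_fact_lemma[of "3 * k + r" "N + k + r"] that by simp
    qed
    show ?thesis unfolding a_def 1[symmetric] 2[symmetric] by (simp only: ac_simps)
  qed
  define p where "p = 3 * k + 3 + 2 * j + r"
  define t where "t = 3 * k + r"
  define M where "M = fact p * fact t * (fact j :: nat)"
  have e1: "2 * N + r - k = Suc p" "3 * k + r = t" "N - 2 * k = Suc (Suc j)" using N by (simp_all add: p_def t_def)
  have e2: "2 * N + r - Suc k = p" "3 * Suc k + r = Suc (Suc (Suc t))" "N - 2 * Suc k = j"
    using N by (simp_all add: p_def t_def)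
  have e3: "3 * k + r + 1 = Suc t" "3 * k + r + 2 = Suc (Suc t)" "3 * k + r + 3 = Suc (Suc (Suc t))"
    "3 * k + 4 + 2 * j + r = Suc p" "j + 2 = Suc (Suc j)" "j + 1 = Suc j" by (simp_all add: p_def t_def)
  have "M * (a (Suc k) * (Suc t * Suc (Suc t) * Suc (Suc (Suc t)))) = a (Suc k) * (fact p * fact (Suc (Suc (Suc t))) * fact j)"
    by (simp only: M_def fact_Suc of_nat_id ac_simps)
  also have "\<dots> = fact (3 * N + 2 * r)" using a[of "Suc k"] N unfolding e2 by simp
  also have "\<dots> = a k * (fact (Suc p) * fact t * fact (Suc (Suc j)))" using a[of k] N unfolding e1 by simp
  also have "\<dots> = M * (a k * (Suc p * Suc (Suc j) * Suc j))"
    by (simp only: M_def fact_Suc of_nat_id ac_simps)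
  finally have "M * (a (Suc k) * (Suc t * Suc (Suc t) * Suc (Suc (Suc t)))) = M * (a k * (Suc p * Suc (Suc j) * Suc j))" .
  moreover have "M \<noteq> 0" by (simp add: M_def)
  ultimately have "a (Suc k) * (Suc t * Suc (Suc t) * Suc (Suc (Suc t))) = a k * (Suc p * Suc (Suc j) * Suc j)"
    by (simp only: mult_left_cancel[of M] mult_cancel1 simp_thms)
  thus ?thesis unfolding e3 .
qed

lemma quadratic_term_recurrence:
  fixes N k j :: nat
  defines "b \<equiv> \<lambda>k. (N choose k) * ((2 * N - 2 * k) choose N)"
  assumes N: "N = 2 * k + 2 + j"
  shows "b k * ((j + 2) * (j + 1)) = 2 * (2 * k + 3 + 2 * j) * (k + 1) * b (Suc k)"
proof -
  have b: "b k * (fact k * fact (N - k) * fact (N - 2 * k)) = fact (2 * N - 2 * k)" if "2 * k \<le> N" for k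
  proof -
    have 1: "fact k * fact (N - k) * (N choose k) = fact N"
      using binomial_fact_lemma[of k N] that by simp
    have 2: "fact N * fact (N - 2 * k) * ((2 * N - 2 * k) choose N) = fact (2 * N - 2 * k)"
    proof -
      have "2 * N - 2 * k - N = N - 2 * k" by simp
      thus ?thesis using binomial_fact_lemma[of N "2 * N - 2 * k"] that by simp
    qed
    have "fact N * (b k * (fact k * fact (N - k) * fact (N - 2 * k))) = fact N * fact (2 * N - 2 * k)"
      unfolding b_def 2[symmetric] 1[symmetric] by (simp only: ac_simps)
    thus ?thesis by simp
  qed
  define M where "M = fact k * fact (k + 1 + j) * (fact j :: nat) * (k + 2 + j)"
  have e1: "N - k = Suc (k + 1 + j)" "N - 2 * k = Suc (Suc j)" "2 * N - 2 * k = Suc (Suc (2 * k + 2 + 2 * j))" using N by simp_all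
  have e2: "N - Suc k = k + 1 + j" "N - 2 * Suc k = j" "2 * N - 2 * Suc k = 2 * k + 2 + 2 * j" using N by simp_all
  have "M * (b k * ((j + 2) * (j + 1))) = b k * (fact k * fact (N - k) * fact (N - 2 * k))"
    unfolding e1 M_def by (simp add: algebra_simps)
  also have "\<dots> = fact (2 * N - 2 * k)" using b[of k] N by simp
  also have "\<dots> = 2 * (k + 2 + j) * (2 * k + 3 + 2 * j) * fact (2 * N - 2 * Suc k)"
    unfolding e1 e2 by (simp add: algebra_simps)
  also have "fact (2 * N - 2 * Suc k) = b (Suc k) * (fact (Suc k) * fact (N - Suc k) * fact (N - 2 * Suc k))"
    using b[of "Suc k"] N by simp
  also have "2 * (k + 2 + j) * (2 * k + 3 + 2 * j) * (b (Suc k) * (fact (Suc k) * fact (N - Suc k) * fact (N - 2 * Suc k)))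
      = M * (2 * (2 * k + 3 + 2 * j) * (k + 1) * b (Suc k))"
    unfolding e2 M_def by (simp add: algebra_simps)
  finally have "M * (b k * ((j + 2) * (j + 1))) = M * (2 * (2 * k + 3 + 2 * j) * (k + 1) * b (Suc k))" .
  moreover have "M \<noteq> 0" by (simp add: M_def)
  ultimately show ?thesis by (simp del: mult_Suc mult_Suc_right)
qed

text \<open>The ratios of consecutive terms of the two expansions agree after reduction modulo l: 6N
  + 4r + 1 = 0 eliminates j from them. The induction can start because l does not divide the
  binomial coefficient of 2N over N.\<close>

lemma term_proportionality:
  fixes l N r :: nat
  assumes char: "CHAR('a::field) = l" "prime l" and l: "l = 6 * N + 4 * r + 1" and r: "r \<le> 1"
  defines "a \<equiv> \<lambda>k. ((3 * N + 2 * r) choose (2 * N + r - k)) * ((N + k + r) choose (3 * k + r))"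
  defines "b \<equiv> \<lambda>k. (N choose k) * ((2 * N - 2 * k) choose N)"
  shows "\<exists>\<kappa>::'a. \<forall>k\<le>N div 2. of_nat (a k) * 27 ^ k = \<kappa> * 4 ^ k * of_nat (b k)"
proof -
  have nz: "of_nat n \<noteq> (0::'a)" if "0 < n" "n < l" for n
    using that char(1) by (metis of_nat_eq_0_iff_char_dvd nat_dvd_not_less)
  have "\<not> l dvd (2 * N choose N)"
  proof
    assume "l dvd (2 * N choose N)"
    hence "l dvd fact N * fact (2 * N - N) * (2 * N choose N)" by (rule dvd_mult)
    hence "l dvd fact (2 * N)" using binomial_fact_lemma[of N "2 * N"] by simp
    hence "l \<le> 2 * N" using prime_dvd_fact_iff[OF char(2)] by simp
    thus False using l by simp
  qed
  hence b0: "of_nat (b 0) \<noteq> (0::'a)" using char(1) by (simp add: b_def of_nat_eq_0_iff_char_dvd)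
  define \<kappa> where "\<kappa> = of_nat (a 0) / (of_nat (b 0) :: 'a)"
  have "of_nat (a k) * 27 ^ k = \<kappa> * 4 ^ k * of_nat (b k)" if "k \<le> N div 2" for k
    using that
  proof (induction k)
    case 0 thus ?case using b0 by (simp add: \<kappa>_def)
  next
    case (Suc k)
    define j where "j = N - 2 * k - 2"
    have N: "N = 2 * k + 2 + j" using Suc.prems by (simp add: j_def)
    define R where "R = (of_nat ((3 * k + r + 1) * (3 * k + r + 2) * (3 * k + r + 3)) :: 'a)"
    define u where "u = (of_nat j :: 'a)"
    define t where "t = (of_nat k :: 'a)"
    define \<rho> where "\<rho> = (of_nat r :: 'a)"
    have rec_a: "of_nat (a (Suc k)) * R = of_nat (a k) * ((3 * t + 4 + 2 * u + \<rho>) * (u + 2) * (u + 1))"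
      using arg_cong[OF cubic_term_recurrence[OF N, of r], of "of_nat :: nat \<Rightarrow> 'a"]
      by (simp only: a_def R_def u_def t_def \<rho>_def of_nat_mult of_nat_add of_nat_numeral of_nat_1)
    have rec_b: "of_nat (b k) * ((u + 2) * (u + 1)) = 2 * (2 * t + 3 + 2 * u) * (t + 1) * of_nat (b (Suc k))"
      using arg_cong[OF quadratic_term_recurrence[OF N], of "of_nat :: nat \<Rightarrow> 'a"]
      by (simp only: b_def u_def t_def of_nat_mult of_nat_add of_nat_numeral of_nat_1)
    have "of_nat l = (0::'a)" using char(1) by auto
    hence "of_nat (6 * N + 4 * r + 1) = (0::'a)" by (simp only: l)
    hence "6 * (2 * t + 2 + u) + 4 * \<rho> + 1 = 0"
      unfolding N by (simp only: t_def u_def \<rho>_def of_nat_mult of_nat_add of_nat_numeral of_nat_1)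
    hence "6 * u + (12 * t + 13 + 4 * \<rho>) = 0" by (simp add: algebra_simps)
    hence u6: "6 * u = - (12 * t + 13 + 4 * \<rho>)" by (simp only: eq_neg_iff_add_eq_0)
    have R: "54 * (2 * t + 3 + 2 * u) * (t + 1) * (3 * t + 4 + 2 * u + \<rho>) = 4 * R"
    proof -
      have "54 * (2 * t + 3 + 2 * u) * (t + 1) * (3 * t + 4 + 2 * u + \<rho>) =
          6 * (6 * t + 9 + 6 * u) * (t + 1) * (9 * t + 12 + 6 * u + 3 * \<rho>)" by (simp add: algebra_simps)
      also have "\<dots> = 6 * (6 * t + 4 + 4 * \<rho>) * (t + 1) * (3 * t + 1 + \<rho>)"
        unfolding u6 by (simp add: algebra_simps)
      also have "\<dots> = 4 * ((3 * t + \<rho> + 1) * (3 * t + \<rho> + 2) * (3 * t + \<rho> + 3))"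
      proof -
        have "r = 0 \<or> r = 1" using r by auto
        thus ?thesis unfolding \<rho>_def by (elim disjE) (simp_all add: algebra_simps)
      qed
      also have "(3 * t + \<rho> + 1) * (3 * t + \<rho> + 2) * (3 * t + \<rho> + 3) = R"
        by (simp only: R_def t_def \<rho>_def of_nat_mult of_nat_add of_nat_numeral of_nat_1)
      finally show ?thesis .
    qed
    have "R \<noteq> 0"
      using nz[of "3 * k + r + 1"] nz[of "3 * k + r + 2"] nz[of "3 * k + r + 3"] l N unfolding R_def of_nat_mult by auto
    have "R * (of_nat (a (Suc k)) * 27 ^ Suc k) = (of_nat (a k) * 27 ^ k) * 27 * ((3 * t + 4 + 2 * u + \<rho>) * (u + 2) * (u + 1))"
      using rec_a by (simp add: mult_ac)
    also have "\<dots> = \<kappa> * 4 ^ k * 27 * (3 * t + 4 + 2 * u + \<rho>) * (of_nat (b k) * ((u + 2) * (u + 1)))"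
      using Suc by (simp add: mult_ac)
    also have "\<dots> = \<kappa> * 4 ^ k * of_nat (b (Suc k)) * (54 * (2 * t + 3 + 2 * u) * (t + 1) * (3 * t + 4 + 2 * u + \<rho>))"
      unfolding rec_b by (simp add: mult_ac)
    also have "\<dots> = R * (\<kappa> * 4 ^ Suc k * of_nat (b (Suc k)))" unfolding R by (simp add: mult_ac)
    finally show ?case using \<open>R \<noteq> 0\<close> by simp
  qed
  thus ?thesis by blast
qed

text \<open>\<open>H7\<close> at d is c_4^r \<open>G\<close>, and the Hasse coefficient is a
  constant times c_4^r \<open>G\<close>, where \<open>G\<close> is the middle coefficient of (T^2 +
  F T + S)^N.\<close>

lemma hasse_of_H7:
  fixes d :: "'a::field"
  assumes char: "CHAR('a) = l" "prime l" "l > 3" and H: "poly (H7 l) d = 0"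
  shows "coeff ([:tB d, tA d, 0, 1:] ^ ((l - 1) div 2)) (l - 1) = 0"
proof -
  define n where "n = nl l"
  define s where "s = sl l"
  define r where "r = rl l"
  define N where "N = 2 * n + s"
  define m where "m = 3 * N + 2 * r"
  have l: "l = 6 * N + 4 * r + 1" "r \<le> 1" "s \<le> 1"
    using l_decomposition[OF char(2,3)] by (simp_all add: N_def n_def s_def r_def)
  have nz: "(2::'a) \<noteq> 0" "(3::'a) \<noteq> 0"
  proof -
    have "of_nat 2 \<noteq> (0::'a)" "of_nat 3 \<noteq> (0::'a)"
      using char by (auto simp only: of_nat_eq_0_iff_char_dvd dest: dvd_imp_le)
    thus "(2::'a) \<noteq> 0" "(3::'a) \<noteq> 0" by simp_all
  qed
  have "(4::'a) = 2 * 2" "(27::'a) = 3 * 3 * 3" by simp_all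
  hence nz4: "(4::'a) \<noteq> 0" and nz27: "(27::'a) \<noteq> 0" using nz by (simp_all only: mult_eq_0_iff simp_thms)
  define c4 where "c4 = poly p_a d * poly p_b d"
  define F where "F = poly f2 d"
  define S where "S = - 432 * poly den7 d"
  define h where "h = F / 2"
  define E where "E = - (c4 ^ 3) / 4"
  have F: "F = 2 * h" and E: "c4 ^ 3 = - 4 * E" using nz nz4 by (simp_all add: h_def E_def)
  have "poly num7 d = c4 ^ 3" by (simp add: num7_def c4_def power_mult_distrib)
  hence "c4 ^ 3 - 1728 * poly den7 d = F ^ 2" using discriminant_identity[of d] by (simp add: F_def)
  hence "- 4 * E + 4 * S = 4 * h ^ 2" by (simp add: E S_def F power2_eq_square)
  hence "4 * S = 4 * (h ^ 2 + E)" by (simp add: algebra_simps)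
  hence "S = h ^ 2 + E" using nz4 by (subst (asm) mult_left_cancel) auto
  hence sq: "[:S, F, 1:] = [:h, 1:] ^ 2 + [:E:]" by (simp add: F power2_eq_square)
  define G where "G = coeff ([:S, F, 1:] ^ N) N"
  have "poly (H7 l) d = c4 ^ r * G"
    unfolding G_def N_def coeff_quadratic_power[OF l(3)]
    unfolding poly_H7 c4_def r_def n_def s_def S_def F_def ..
  hence cG: "c4 ^ r * G = 0" using H by simp
  define a where "a k = ((3 * N + 2 * r) choose (2 * N + r - k)) * ((N + k + r) choose (3 * k + r))" for k
  define b where "b k = (N choose k) * ((2 * N - 2 * k) choose N)" for k
  obtain \<kappa> :: 'a where \<kappa>: "of_nat (a k) * 27 ^ k = \<kappa> * 4 ^ k * of_nat (b k)" if "k \<le> N div 2" for k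
    using term_proportionality[OF char(1,2) l(1,2)] unfolding a_def b_def by blast
  have A: "tA d = - 27 * c4" and B: "tB d = 108 * h" by (simp_all add: tA_def tB_def c4_def F_def[symmetric] F)
  \<comment> \<open>This constant absorbs the powers of 27 and 4 in
    \<open>term_proportionality\<close>; what remains, 108^2, combines with the factor 108 in
    \<open>tB d\<close> to 108^N.\<close>
  have A3: "4 * tA d ^ 3 = 27 * (108 ^ 2 * E)"
  proof -
    have "4 * tA d ^ 3 = - 78732 * c4 ^ 3" by (simp add: A power3_eq_cube)
    thus ?thesis by (simp add: E)
  qed
  have tm: "of_nat (a k) * tA d ^ (3 * k + r) * tB d ^ (N - 2 * k) =
      \<kappa> * 108 ^ N * tA d ^ r * (of_nat (b k) * E ^ k * h ^ (N - 2 * k))" if k: "k \<le> N div 2" for k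
  proof -
    have "27 ^ k * (of_nat (a k) * (tA d ^ 3) ^ k) = \<kappa> * of_nat (b k) * (4 * tA d ^ 3) ^ k"
      using \<kappa>[OF k] by (simp add: power_mult_distrib mult_ac)
    also have "\<dots> = 27 ^ k * (\<kappa> * of_nat (b k) * (108 ^ 2) ^ k * E ^ k)"
      unfolding A3 by (simp only: power_mult_distrib ac_simps)
    finally have "of_nat (a k) * (tA d ^ 3) ^ k = \<kappa> * of_nat (b k) * (108 ^ 2) ^ k * E ^ k"
      using nz27 by (subst (asm) mult_left_cancel) auto
    moreover have "(108::'a) ^ N = (108 ^ 2) ^ k * 108 ^ (N - 2 * k)"
      using k by (simp only: power_mult[symmetric] power_add[symmetric]) simp
    moreover have "of_nat (a k) * tA d ^ (3 * k + r) * tB d ^ (N - 2 * k) =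
        (of_nat (a k) * (tA d ^ 3) ^ k) * (tA d ^ r * (108 ^ (N - 2 * k) * h ^ (N - 2 * k)))"
      by (simp only: B power_add power_mult power_mult_distrib mult.assoc)
    ultimately show ?thesis by (simp only: mult_ac)
  qed
  have "(l - 1) div 2 = m" "l - 1 = 2 * m" using l by (simp_all add: m_def)
  hence "coeff ([:tB d, tA d, 0, 1:] ^ ((l - 1) div 2)) (l - 1) =
      (\<Sum>k=0..N div 2. of_nat (a k) * tA d ^ (3 * k + r) * tB d ^ (N - 2 * k))"
    using coeff_cubic_power[OF m_def l(2), of "tB d" "tA d"] by (simp only: a_def m_def of_nat_mult)
  also have "\<dots> = (\<Sum>k=0..N div 2. \<kappa> * 108 ^ N * tA d ^ r * (of_nat (b k) * E ^ k * h ^ (N - 2 * k)))"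
    by (intro sum.cong refl tm) simp
  also have "\<dots> = \<kappa> * 108 ^ N * tA d ^ r * G"
    unfolding G_def sq coeff_quadratic_power_completed_square by (simp only: b_def of_nat_mult sum_distrib_left)
  also have "\<dots> = \<kappa> * 108 ^ N * (- 27) ^ r * (c4 ^ r * G)" unfolding A power_mult_distrib by (simp only: ac_simps)
  finally show ?thesis unfolding cG by simp
qed

text \<open>At a zero of the discriminant only the summand k = n survives, so \<open>H7\<close> is
  c_4^r f2^N with c_4^3 = f2^2. A root of it would be a common zero of c_4 and the
  discriminant.\<close>

lemma den7_nonzero:
  fixes d :: "'a::field"
  assumes char: "CHAR('a) = l" "prime l" "l > 3" "l \<noteq> 7" and H: "poly (H7 l) d = 0"
  shows "poly den7 d \<noteq> 0"
proof
  assume D: "poly den7 d = 0"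
  define c4 where "c4 = poly p_a d * poly p_b d"
  define N where "N = 2 * nl l + sl l"
  have "c4 ^ 3 = poly f2 d ^ 2"
    using discriminant_identity[of d] D by (simp add: num7_def c4_def power_mult_distrib)
  moreover have "poly (H7 l) d = c4 ^ rl l * poly f2 d ^ N"
  proof -
    have "(\<Sum>k=0..nl l. of_nat ((2 * nl l + sl l) choose (2 * k + sl l)) * of_nat ((2 * nl l - 2 * k) choose (nl l - k))
        * (- 432 * poly den7 d) ^ (nl l - k) * poly f2 d ^ (2 * k + sl l))
      = (\<Sum>k\<in>{nl l}. of_nat ((2 * nl l + sl l) choose (2 * k + sl l)) * of_nat ((2 * nl l - 2 * k) choose (nl l - k))
        * (- 432 * poly den7 d) ^ (nl l - k) * poly f2 d ^ (2 * k + sl l))"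
      by (rule sum.mono_neutral_right) (auto simp: D)
    thus ?thesis unfolding poly_H7 by (simp add: c4_def N_def)
  qed
  ultimately have c0: "c4 = 0" using H by auto
  have "poly den7 d = d ^ 7 * (d - 1) ^ 7 * poly p_c d" by (simp add: den7_def)
  with D consider "d = 0" | "d = 1" | "poly p_c d = 0" by auto
  thus False
  proof cases
    case 1 thus False using c0 by (simp add: c4_def p_a_def p_b_def)
  next
    case 2 thus False using c0 by (simp add: c4_def p_a_def p_b_def)
  next
    case 3
    \<comment> \<open>A Bezout relation between \<open>p_c\<close> and c_4, which both vanish at d;
      its constant 49 = 7^2 is where l = 7 has to be excluded.\<close>
    have "49 = (- 1661 - 1540 * d + 6776 * d ^ 2 - 693 * d ^ 3 - 6853 * d ^ 4 + 12530 * d ^ 5 - 4781 * d ^ 6 + 444 * d ^ 7) * poly p_c d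
        + (1710 + 3005 * d - 444 * d ^ 2) * c4"
      by (simp add: c4_def p_a_def p_b_def p_c_def eval_nat_numeral algebra_simps)
    hence "of_nat 49 = (0::'a)" using 3 c0 by simp
    hence "l dvd 7 ^ 2" using char(1) by (simp only: of_nat_eq_0_iff_char_dvd) simp
    hence "l dvd 7" using char(2) prime_dvd_power by blast
    thus False using char(2,4) primes_dvd_imp_eq[of l 7] by auto
  qed
qed

lemma tate_supersingular_of_H7:
  fixes d :: "'a::alg_closed_field"
  assumes char: "CHAR('a) = l" "prime l" "l > 3" "l \<noteq> 7" and H: "poly (H7 l) d = 0"
  shows "tate_supersingular d l"
proof -
  have D: "poly den7 d \<noteq> 0" using den7_nonzero[OF char H] .
  have "l \<noteq> 4" using char(2) by auto
  have "of_nat 2 \<noteq> (0::'a)" "of_nat 3 \<noteq> (0::'a)"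
    using char by (auto simp only: of_nat_eq_0_iff_char_dvd dest: dvd_imp_le)
  hence nz: "(2::'a) \<noteq> 0" "(3::'a) \<noteq> 0" by simp_all
  have "4 * tA d ^ 3 + 27 * tB d ^ 2 = - 78732 * (poly num7 d - poly f2 d ^ 2)"
    by (simp add: tA_def tB_def num7_def power_mult_distrib)
  also have "\<dots> = - (2 ^ 8 * 3 ^ 12 * poly den7 d)"
    unfolding discriminant_identity[symmetric] by (simp add: algebra_simps)
  finally have "4 * tA d ^ 3 + 27 * tB d ^ 2 \<noteq> 0" using nz D by (simp only: neg_equal_0_iff_equal mult_eq_0_iff power_eq_0_iff simp_thms)
  thus ?thesis
    using hasse_of_H7[OF char(1-3) H] char \<open>l \<noteq> 4\<close> D
    by unfold_locales (auto simp: weierstrass.f_def den7_def)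
qed

section \<open>Descent to the prime field: degrees as Frobenius periods\<close>

lemma map_poly_to_ac_H7: "map_poly to_ac (H7 l :: 'a::field poly) = H7 l"
proof -
  interpret to_ac: inj_idom_hom "to_ac :: 'a \<Rightarrow> _" by unfold_locales auto
  interpret map_to_ac: map_poly_inj_idom_hom "to_ac :: 'a \<Rightarrow> _" ..
  have "map_poly to_ac (J_poly l :: 'a poly) = J_poly l"
    by (simp add: J_poly_def Let_def map_to_ac.hom_sum hom_distribs)
  hence "to_ac (coeff (J_poly l) i :: 'a) = coeff (J_poly l) i" for i
    by (metis to_ac.coeff_map_poly_hom)
  moreover have "map_poly to_ac (p_a :: 'a poly) = p_a" "map_poly to_ac (p_b :: 'a poly) = p_b" "map_poly to_ac (p_c :: 'a poly) = p_c"
      "map_poly to_ac (f2 :: 'a poly) = f2" "map_poly to_ac ([:0, 1:] :: 'a poly) = [:0, 1:]" "map_poly to_ac ([:-1, 1:] :: 'a poly) = [:-1, 1:]"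
    by (simp_all add: p_a_def p_b_def p_c_def f2_def to_ac.map_poly_pCons_hom)
  moreover from this have "map_poly to_ac (num7 :: 'a poly) = num7" "map_poly to_ac (den7 :: 'a poly) = den7"
    unfolding num7_def den7_def by (simp_all only: map_to_ac.hom_mult map_to_ac.hom_power)
  ultimately show ?thesis
    unfolding H7_def homog_comp_def
    by (simp only: map_to_ac.hom_sum map_to_ac.hom_mult map_to_ac.hom_power to_ac.map_poly_hom_smult)
qed

text \<open>A polynomial m of least degree vanishing at d divides all others. It divides q, so by
  irreducibility q also divides m.\<close>

lemma irreducible_dvd_if_common_root:
  fixes q p :: "'a::field poly"
  assumes q: "irreducible q" "poly (map_poly to_ac q) d = 0" and p: "poly (map_poly to_ac p) d = 0"
  shows "q dvd p"
proof -
  interpret to_ac: inj_idom_hom to_ac by unfold_locales auto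
  interpret map_to_ac: map_poly_inj_idom_hom to_ac ..
  define P where "P m \<longleftrightarrow> m \<noteq> 0 \<and> poly (map_poly to_ac m) d = 0" for m :: "'a poly"
  have "P q" using q by (auto simp: P_def)
  then obtain m where m: "P m" and least: "\<And>r. P r \<Longrightarrow> degree m \<le> degree r"
    using ex_has_least_nat[of P q degree] by blast
  have dvd: "m dvd r" if r: "poly (map_poly to_ac r) d = 0" for r
  proof (rule ccontr)
    assume "\<not> m dvd r"
    hence nz: "r mod m \<noteq> 0" by (simp add: dvd_eq_mod_eq_0)
    have "map_poly to_ac r = map_poly to_ac (r div m) * map_poly to_ac m + map_poly to_ac (r mod m)"
      by (simp flip: map_to_ac.hom_mult map_to_ac.hom_add)
    hence "P (r mod m)" using r m nz by (simp add: P_def)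
    moreover have "degree (r mod m) < degree m" using nz m degree_mod_less'[of m r] by (simp add: P_def)
    ultimately show False using least by fastforce
  qed
  have "\<not> m dvd 1"
  proof
    assume "m dvd 1"
    then obtain k where "1 = m * k" by (elim dvdE)
    hence "1 = map_poly to_ac m * map_poly to_ac k" by (metis map_to_ac.hom_mult map_to_ac.hom_one)
    hence "poly 1 d = poly (map_poly to_ac m * map_poly to_ac k) d" by (rule arg_cong)
    thus False using m by (simp add: P_def)
  qed
  hence "q dvd m" using irreducibleD'[OF q(1) dvd[OF q(2)]] by blast
  thus ?thesis using dvd[OF p] by (rule dvd_trans)
qed

lemma power_card_mod_ring: "x ^ CARD('p) = x" for x :: "'p::prime_card mod_ring"
  using finite_field_power_card_eq_same[of x] by simp

text \<open>X^l - X has at most l roots, and the image of the prime field already provides l of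
  them.\<close>

lemma range_to_ac_mod_ring:
  "range (to_ac :: 'p::prime_card mod_ring \<Rightarrow> _) = {z. z ^ CARD('p) = z}"
proof -
  define P :: "'p mod_ring alg_closure poly" where "P = monom 1 (CARD('p)) - monom 1 1"
  have gt: "CARD('p) > 1" using prime_card_class.prime_card[where 'a = 'p] prime_gt_1_nat by blast
  hence P: "P \<noteq> 0" "degree P \<le> CARD('p)"
    unfolding P_def by (auto simp: monom_eq_iff' intro!: degree_diff_le order.trans[OF degree_monom_le])
  have roots: "{z. poly P z = 0} = {z. z ^ CARD('p) = z}" by (simp add: P_def poly_monom)
  have sub: "range (to_ac :: 'p mod_ring \<Rightarrow> _) \<subseteq> {z. z ^ CARD('p) = z}"
    by (auto simp: power_card_mod_ring simp flip: to_ac_power)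
  moreover have "card (range (to_ac :: 'p mod_ring \<Rightarrow> _)) = CARD('p)"
    by (simp add: card_image inj_to_ac)
  moreover have "finite {z :: 'p mod_ring alg_closure. z ^ CARD('p) = z}" "card {z :: 'p mod_ring alg_closure. z ^ CARD('p) = z} \<le> CARD('p)"
    using poly_roots_finite[OF P(1)] card_poly_roots_bound[OF P(1)] P(2) unfolding roots by simp_all
  ultimately show ?thesis by (intro card_seteq) simp_all
qed

text \<open>Let n be the least period of d. The n conjugates are distinct roots of q, so n is at
  most the degree. Conversely the product of their linear factors is Frobenius-invariant, so it has
  coefficients in the prime field and q divides it.\<close>

lemma frobenius_period_iff:
  fixes q :: "'p::prime_card mod_ring poly"
  assumes q: "irreducible q" "poly (map_poly to_ac q) d = 0"
    and per: "d ^ (CARD('p) ^ K) = d" "K > 0"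
  shows "d ^ (CARD('p) ^ k) = d \<longleftrightarrow> degree q dvd k"
proof -
  define l where "l = CARD('p)"
  have l: "prime l" using prime_card_class.prime_card[where 'a = 'p] by (simp add: l_def)
  have char: "CHAR('p mod_ring alg_closure) = l" by (simp add: l_def)
  have add: "(z + w) ^ l ^ i = z ^ l ^ i + w ^ l ^ i" for z w :: "'p mod_ring alg_closure" and i
    using l by (intro freshmans_dream'[where n = i]) (simp_all add: l_def)
  have inj: "z = w" if "z ^ l ^ i = w ^ l ^ i" for z w :: "'p mod_ring alg_closure" and i
    using add[of "z - w" w i] that by simp
  interpret to_ac: inj_idom_hom "to_ac :: 'p mod_ring \<Rightarrow> _" by unfold_locales auto
  interpret map_to_ac: map_poly_inj_idom_hom "to_ac :: 'p mod_ring \<Rightarrow> _" ..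
  interpret frob: inj_idom_hom "\<lambda>z :: 'p mod_ring alg_closure. z ^ l"
    using add[of _ _ 1] l by unfold_locales (auto simp: power_mult_distrib prime_gt_0_nat)
  interpret map_frob: map_poly_inj_idom_hom "\<lambda>z :: 'p mod_ring alg_closure. z ^ l" ..
  define n where "n = (LEAST n. n > 0 \<and> d ^ l ^ n = d)"
  have "\<exists>n. n > 0 \<and> d ^ l ^ n = d" using per unfolding l_def by blast
  hence n: "n > 0" "d ^ l ^ n = d"
    unfolding n_def by (metis (mono_tags, lifting) LeastI)+
  have least: "n \<le> j" if "j > 0" "d ^ l ^ j = d" for j
    unfolding n_def using that by (intro Least_le) simp
  have mult: "d ^ l ^ (n * c) = d" for c
    by (induction c) (simp_all add: power_add power_mult n(2))
  have period: "d ^ l ^ j = d \<longleftrightarrow> n dvd j" for j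
  proof
    assume j: "d ^ l ^ j = d"
    have "d ^ l ^ (n * (j div n) + j mod n) = d ^ l ^ (j mod n)"
      by (subst power_add, subst power_mult, subst mult) (rule refl)
    hence "d ^ l ^ (j mod n) = d" using j by simp
    moreover have "j mod n < n" using n by simp
    ultimately have "j mod n = 0" using least[of "j mod n"] by fastforce
    thus "n dvd j" by (simp add: dvd_eq_mod_eq_0)
  qed (use mult in auto)
  have distinct: "inj_on (\<lambda>i. d ^ l ^ i) {..<n}"
  proof (rule linorder_inj_onI)
    fix i j assume ij: "i < j" "i \<in> {..<n}" "j \<in> {..<n}"
    have "d ^ l ^ i \<noteq> d ^ l ^ j"
    proof
      assume e: "d ^ l ^ i = d ^ l ^ j"
      have "(d ^ l ^ (j - i)) ^ l ^ i = d ^ l ^ ((j - i) + i)" by (simp add: power_add power_mult)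
      also have "\<dots> = d ^ l ^ i" using ij e by simp
      finally have "n dvd j - i" using inj period by blast
      thus False using ij by (auto dest!: dvd_imp_le)
    qed
    thus "d ^ l ^ i \<noteq> d ^ l ^ j" .
  qed auto
  have fixed: "map_poly (\<lambda>z. z ^ l) (map_poly to_ac q) = map_poly to_ac q"
    by (intro poly_eqI) (simp add: coeff_map_poly l_def power_card_mod_ring flip: to_ac_power)
  have roots: "poly (map_poly to_ac q) (d ^ l ^ i) = 0" for i
  proof (induction i)
    case (Suc i)
    have "poly (map_poly (\<lambda>z. z ^ l) (map_poly to_ac q)) ((d ^ l ^ i) ^ l) = poly (map_poly to_ac q) (d ^ l ^ i) ^ l"
      by (rule frob.poly_map_poly)
    thus ?case using Suc l unfolding fixed by (simp add: prime_gt_0_nat power_mult[symmetric] mult.commute)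
  qed (simp add: q)
  have q0: "q \<noteq> 0" using q(1) by auto
  have "n = card ((\<lambda>i. d ^ l ^ i) ` {..<n})" using distinct by (simp add: card_image)
  also have "\<dots> \<le> card {z. poly (map_poly to_ac q) z = 0}"
    using q0 roots by (intro card_mono poly_roots_finite) auto
  also have "\<dots> \<le> degree q" using card_poly_roots_bound[of "map_poly to_ac q"] q0 by simp
  finally have "n \<le> degree q" .
  moreover have "degree q \<le> n"
  proof -
    define M where "M = (\<Prod>i<n. [:- (d ^ l ^ i), 1:])"
    have "map_poly (\<lambda>z. z ^ l) M = (\<Prod>i<n. [:- (d ^ l ^ Suc i), 1:])"
      unfolding M_def by (simp add: map_frob.hom_prod hom_distribs power_mult[symmetric] mult.commute)
    also have "\<dots> = M"
    proof -
      obtain n' where n': "n = Suc n'" using n(1) gr0_conv_Suc by blast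
      have "M = [:- (d ^ l ^ 0), 1:] * (\<Prod>i<n'. [:- (d ^ l ^ Suc i), 1:])"
        unfolding M_def n' by (rule prod.lessThan_Suc_shift)
      moreover have "(\<Prod>i<n. [:- (d ^ l ^ Suc i), 1:]) = (\<Prod>i<n'. [:- (d ^ l ^ Suc i), 1:]) * [:- (d ^ l ^ Suc n'), 1:]"
        unfolding n' by (rule prod.lessThan_Suc)
      ultimately show ?thesis using n(2) unfolding n' by (simp add: mult.commute)
    qed
    finally have "coeff M i ^ l = coeff M i" for i by (metis frob.coeff_map_poly_hom)
    hence "coeff M i \<in> range (to_ac :: 'p mod_ring \<Rightarrow> _)" for i
      unfolding range_to_ac_mod_ring l_def by simp
    hence M: "map_poly to_ac (map_poly of_ac M) = M"
      by (intro poly_eqI) (simp add: coeff_map_poly to_ac_of_ac)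
    have "degree M = n" unfolding M_def by (subst degree_prod_eq_sum_degree) auto
    moreover have "M \<noteq> 0" unfolding M_def by auto
    moreover have "poly M d = 0" unfolding M_def poly_prod using n(1) by (auto intro!: bexI[of _ 0])
    ultimately have "q dvd map_poly of_ac M" "degree (map_poly of_ac M) = n" "map_poly of_ac M \<noteq> 0"
      using irreducible_dvd_if_common_root[OF q, of "map_poly of_ac M"] M to_ac.degree_map_poly_hom[of "map_poly of_ac M"] by auto
    thus ?thesis using dvd_imp_degree_le by blast
  qed
  ultimately show ?thesis using period unfolding l_def by simp
qed

section \<open>The degrees of the irreducible factors\<close>

context tate_supersingular
begin

text \<open>The fixed points of (d - 1)/d and of 1/(1 - d) are the roots of x^2 - x + 1.\<close>

lemma frobenius_period: "d ^ (l ^ 2) = d \<Longrightarrow> l mod 7 \<in> {2, 3, 4, 5} \<Longrightarrow> d ^ 2 - d + 1 = 0"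
  using frobenius_square(3-6) d0 d1
  by (auto simp: field_simps power2_eq_square)

text \<open>The l^2-Frobenius acts on d by the identity or by a Moebius map of order 3, whose
  coefficients it fixes, so its third iterate fixes d.\<close>

lemma frobenius_sixth_power:
  assumes "l mod 7 \<noteq> 0"
  shows "d ^ (l ^ 6) = d"
proof -
  have e: "d ^ (l ^ 6) = ((d ^ (l ^ 2)) ^ (l ^ 2)) ^ (l ^ 2)" by (simp flip: power_mult power_add)
  have f: "(1 - z) ^ (l ^ 2) = 1 - z ^ (l ^ 2)" "(z - 1) ^ (l ^ 2) = z ^ (l ^ 2) - 1" for z :: 'a
    using frob_simps(2)[of _ _ 2] by simp_all
  have nz: "d \<noteq> 0" "1 - d \<noteq> 0" "d - 1 \<noteq> 0" using d0 d1 by simp_all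
  consider "d ^ (l ^ 2) = d" | "d ^ (l ^ 2) = (d - 1) / d" | "d ^ (l ^ 2) = 1 / (1 - d)"
  proof -
    have "l mod 7 = 1 \<or> l mod 7 = 2 \<or> l mod 7 = 3 \<or> l mod 7 = 4 \<or> l mod 7 = 5 \<or> l mod 7 = 6"
      using assms by presburger
    thus ?thesis using that frobenius_square by blast
  qed
  thus ?thesis
  proof cases
    case 1 thus ?thesis unfolding e by simp
  next
    case 2
    hence "(d ^ (l ^ 2)) ^ (l ^ 2) = ((d - 1) / d - 1) / ((d - 1) / d)" by (simp add: power_divide f)
    also have "\<dots> = 1 / (1 - d)" using nz by (simp add: divide_simps)
    finally have "d ^ (l ^ 6) = 1 / (1 - (d - 1) / d)" unfolding e by (simp only: power_divide f power_one 2)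
    also have "\<dots> = d" using nz by (simp add: divide_simps)
    finally show ?thesis .
  next
    case 3
    hence "(d ^ (l ^ 2)) ^ (l ^ 2) = 1 / (1 - 1 / (1 - d))" by (simp add: power_divide f)
    also have "\<dots> = (d - 1) / d" using nz by (simp add: divide_simps)
    finally have "d ^ (l ^ 6) = (1 / (1 - d) - 1) / (1 / (1 - d))" unfolding e by (simp only: power_divide f power_one 3)
    also have "\<dots> = d" using nz by (simp add: divide_simps)
    finally show ?thesis .
  qed
qed

end

lemma monic_dvd_same_degree_eq:
  fixes p q :: "'a::field poly"
  assumes "q dvd p" "monic q" "monic p" "degree q = degree p"
  shows "q = p"
proof -
  obtain k where k: "p = q * k" using assms(1) by (elim dvdE)
  have "q \<noteq> 0" "k \<noteq> 0" using assms k by auto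
  hence "degree q + degree k = degree q" using assms(4) degree_mult_eq[of q k] unfolding k by simp
  hence "degree k = 0" by simp
  then obtain c where c: "k = [:c:]" by (rule degree_eq_zeroE)
  have "lead_coeff p = lead_coeff q * lead_coeff k" unfolding k by (rule lead_coeff_mult)
  thus ?thesis using assms k c by simp
qed

text \<open>The degree of q is the Frobenius period of a root d, so each clause restates a
  restriction on that period.\<close>

lemma irreducible_factor_H7:
  fixes q :: "'p::prime_card mod_ring poly"
  assumes l: "CARD('p) = l" "l > 3" "l \<noteq> 7" and q: "monic q" "irreducible q" "q dvd H7 l"
  shows "l mod 7 = 1 \<or> l mod 7 = 6 \<Longrightarrow> degree q dvd 2"
    and "degree q dvd 6"
    and "degree q = 1 \<Longrightarrow> l mod 7 = 6"
    and "l mod 7 \<in> {2, 4} \<Longrightarrow> degree q \<noteq> 3"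
    and "l mod 7 \<in> {2, 3, 4, 5} \<Longrightarrow> degree q = 2 \<Longrightarrow> q = [:1, -1, 1:]"
proof -
  interpret to_ac: inj_idom_hom "to_ac :: 'p mod_ring \<Rightarrow> _" by unfold_locales auto
  interpret map_to_ac: map_poly_inj_idom_hom "to_ac :: 'p mod_ring \<Rightarrow> _" ..
  have p: "prime l" using prime_card_class.prime_card[where 'a = 'p] l by simp
  have l7: "l mod 7 \<noteq> 0" using p l primes_dvd_imp_eq[of 7 l] by (auto simp: mod_eq_0_iff_dvd)
  have char: "CHAR('p mod_ring alg_closure) = l" using l by simp
  have "degree (map_poly to_ac q) > 0" using q(2) is_unit_iff_degree[of q] irreducible_not_unit[of q] by fastforce
  then obtain d where d: "poly (map_poly to_ac q) d = 0" using alg_closed_imp_poly_has_root by blast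
  have "map_poly to_ac q dvd H7 l" using q(3) map_to_ac.hom_dvd map_poly_to_ac_H7 by metis
  hence "poly (H7 l) d = 0" using d by (auto elim!: dvdE)
  then interpret tate_supersingular d l using tate_supersingular_of_H7[OF char p l(2,3)] by blast
  have period: "d ^ (l ^ k) = d \<longleftrightarrow> degree q dvd k" for k
    using frobenius_period_iff[OF q(2) d, of 6] frobenius_sixth_power[OF l7] l by simp
  show "degree q dvd 2" if "l mod 7 = 1 \<or> l mod 7 = 6"
    using frobenius_square(1,2) that period by blast
  show "degree q dvd 6" using frobenius_sixth_power[OF l7] period by blast
  show "l mod 7 = 6" if "degree q = 1" using period[of 1] that no_linear l7 by simp
  show "degree q \<noteq> 3" if "l mod 7 \<in> {2, 4}" using period[of 3] that no_cubic by auto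
  show "q = [:1, -1, 1:]" if "l mod 7 \<in> {2, 3, 4, 5}" "degree q = 2"
  proof -
    have "d ^ 2 - d + 1 = 0" using frobenius_period period[of 2] that by simp
    hence "poly (map_poly to_ac [:1, -1, 1:]) d = 0" by (simp add: hom_distribs power2_eq_square algebra_simps)
    hence "q dvd [:1, -1, 1:]" using irreducible_dvd_if_common_root[OF q(2) d] by blast
    thus ?thesis using q that by (intro monic_dvd_same_degree_eq) simp_all
  qed
qed

lemma dvd_two_cases: "k dvd 2 \<Longrightarrow> k = 1 \<or> k = (2::nat)"
  using prime_nat_iff two_is_prime_nat by blast

lemma dvd_six_cases:
  assumes "k dvd (6::nat)"
  shows "k = 1 \<or> k = 2 \<or> k = 3 \<or> k = 6"
proof -
  have "k \<le> 6" "k \<noteq> 0" using assms by (auto dest: dvd_imp_le intro: ccontr)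
  hence "k \<in> {1, 2, 3, 4, 5, 6}" by auto
  thus ?thesis using assms by auto
qed

theorem theorem5p2:
  fixes l :: nat
  assumes "CARD('p::prime_card) = l"
    and "prime l" and "l \<noteq> 2" and "l \<noteq> 3" and "l \<noteq> 7"
  defines "H \<equiv> (H7 l :: 'p mod_ring poly)"
  shows "(l mod 7 = 1 \<longrightarrow>
            (\<forall>q. monic q \<and> irreducible q \<and> q dvd H \<longrightarrow> degree q = 2))
       \<and> (l mod 7 = 6 \<longrightarrow>
            (\<forall>q. monic q \<and> irreducible q \<and> q dvd H \<longrightarrow> degree q = 1 \<or> degree q = 2))
       \<and> (l mod 7 \<in> {2, 4} \<longrightarrow>
            (\<forall>q. monic q \<and> irreducible q \<and> q dvd H \<longrightarrow> q = [:1, -1, 1:] \<or> degree q = 6))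
       \<and> (l mod 7 \<in> {3, 5} \<longrightarrow>
            (\<forall>q. monic q \<and> irreducible q \<and> q dvd H \<longrightarrow>
                 q = [:1, -1, 1:] \<or> degree q = 3 \<or> degree q = 6))"
proof -
  have "l \<ge> 2" using assms(2) prime_ge_2_nat by blast
  hence l: "l > 3" using assms(3,4) by linarith
  note F = irreducible_factor_H7[OF assms(1) l assms(5), folded H_def]
  show ?thesis
  proof (intro conjI impI allI; elim conjE)
    fix q :: "'p mod_ring poly"
    assume q: "monic q" "irreducible q" "q dvd H"
    note F = F[OF q]
    note six = dvd_six_cases[OF F(2)]
    show "degree q = 2" if "l mod 7 = 1" using dvd_two_cases[OF F(1)] F(3) that by auto
    show "degree q = 1 \<or> degree q = 2" if "l mod 7 = 6" using dvd_two_cases[OF F(1)] that by auto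
    show "q = [:1, -1, 1:] \<or> degree q = 6" if "l mod 7 \<in> {2, 4}"
      using six F(3-5) that by auto
    show "q = [:1, -1, 1:] \<or> degree q = 3 \<or> degree q = 6" if "l mod 7 \<in> {3, 5}"
      using six F(3,5) that by auto
  qed
qed

end
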